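(* Let $n \geq 1$ be an integer and let $K \in C(\mathbb{R}^{2n})$, $K\not\equiv 0$, satisfy $$|K(x)| \leq C(|x|^\lambda + 1) \quad \text{in } \mathbb{R}^{2n}, \quad \text{for some } C > 0,\ \lambda \geq 0.$$ Let $u$ be a solution to $$(-\Delta)^n u = K(x)e^{2nu} \quad \text{in } \mathbb{R}^{2n}$$ satisfying $u(x) = O(\ln|x|)$ as $|x|\to\infty$ and $Ke^{2nu} \in L^1(\mathbb{R}^{2n})$. If $\Lambda_u > - \alpha_1(K)\gamma_n$, then $$u(x)= -\frac{\Lambda_u}{\gamma_n} \ln |x|+u(0)+\frac{1}{\gamma_n}\int_{\mathbb{R}^{2n}} \ln |y|\, K(y) e^{2nu(y)}\, dy +o(1)\quad\text{as } |x|\to\infty.$$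
   Context: $\gamma_n := \frac{(2n-1)!}{2}|S^{2n}| = 2^{2n-1}(n-1)!\,\pi^n$; $\Lambda_u := \int_{\mathbb{R}^{2n}} K e^{2nu}\,dx$; $\alpha_1(K) := \sup\{\beta \in \mathbb{R} : K(x)(1+ |x|)^{2n\beta} \in L^1(\mathbb{R}^{2n})\}$, where the value $+\infty$ is allowed. A solution is a continuous function satisfying the equation in the sense of distributions. *)

theory Defs
  imports "HOL-Analysis.Analysis" "HOL-Library.Landau_Symbols"
begin

definition partial :: "'a::euclidean_space \<Rightarrow> ('a \<Rightarrow> real) \<Rightarrow> 'a \<Rightarrow> real" where
  "partial b f x = frechet_derivative f (at x) b"

primrec C_k :: "nat \<Rightarrow> ('a::euclidean_space \<Rightarrow> real) \<Rightarrow> bool" where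
  "C_k 0 f \<longleftrightarrow> continuous_on UNIV f"
| "C_k (Suc k) f \<longleftrightarrow> f differentiable_on UNIV \<and> (\<forall>b\<in>Basis. C_k k (partial b f))"

definition test_function :: "('a::euclidean_space \<Rightarrow> real) \<Rightarrow> bool" where
  "test_function \<phi> \<longleftrightarrow> (\<forall>k. C_k k \<phi>) \<and> compact (closure {x. \<phi> x \<noteq> 0})"

definition neg_laplacian :: "('a::euclidean_space \<Rightarrow> real) \<Rightarrow> 'a \<Rightarrow> real" where
  "neg_laplacian f x = - (\<Sum>b\<in>Basis. partial b (partial b f) x)"

(* Distributional equation: the operator is formally self-adjoint, so it acts on the
   test function without a sign. *)
definition is_solution ::
    "nat \<Rightarrow> ('a::euclidean_space \<Rightarrow> real) \<Rightarrow> ('a \<Rightarrow> real) \<Rightarrow> bool" where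
  "is_solution n K u \<longleftrightarrow> continuous_on UNIV u \<and>
     (\<forall>\<phi>. test_function \<phi> \<longrightarrow>
        (LINT x|lborel. u x * (neg_laplacian ^^ n) \<phi> x) =
        (LINT x|lborel. K x * exp (2 * real n * u x) * \<phi> x))"

(* Surface measure of the unit sphere of R^(m+1): the derivative at r = 1 of the
   volume r^(m+1) * unit_ball_vol (m+1) of the ball of radius r. *)
definition sphere_area :: "nat \<Rightarrow> real" where
  "sphere_area m = real (m + 1) * unit_ball_vol (real (m + 1))"

definition gamma_const :: "nat \<Rightarrow> real" where
  "gamma_const n = fact (2 * n - 1) / 2 * sphere_area (2 * n)"

lemma gamma_const_closed_form:
  assumes "n \<ge> 1"
  shows "gamma_const n = 2 ^ (2 * n - 1) * fact (n - 1) * pi ^ n"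
proof -
  obtain m where n: "n = Suc m"
    using assms by (cases n) auto
  define F where "F = (fact (2 * n - 1) :: real)"
  have F: "F > 0"
    by (simp add: F_def)
  have fact_top: "fact (2 * Suc n) = real (2 * n + 2) * real (2 * n + 1) * real (2 * n) * F"
    by (simp add: F_def n algebra_simps)
  have fact_n: "fact (Suc n) = real (n + 1) * real n * fact (n - 1)"
    by (simp add: n algebra_simps)
  have pow: "2 ^ (2 * Suc n) = (8 :: real) * 2 ^ (2 * n - 1)"
    by (simp add: n)
  have "gamma_const n = F / 2 * (real (2 * n + 1) *
          ((2 ^ (2 * Suc n) * fact (Suc n)) / fact (2 * Suc n) * pi ^ n))"
    unfolding gamma_const_def sphere_area_def unit_ball_vol_odd F_def ..
  also have "\<dots> = F / 2 * (real (2 * n + 1) * (8 * 2 ^ (2 * n - 1) *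
          (real (n + 1) * real n * fact (n - 1)) /
          (real (2 * n + 2) * real (2 * n + 1) * real (2 * n) * F) * pi ^ n))"
    unfolding fact_top fact_n pow ..
  also have "\<dots> = 2 ^ (2 * n - 1) * fact (n - 1) * pi ^ n"
  proof -
    have cancel: "F / 2 * (d * (8 * P * (a * b * f) / (2 * a * d * (2 * b) * F) * Q)) = P * f * Q"
      if "a \<noteq> 0" "b \<noteq> 0" "d \<noteq> 0" for a b d f P Q :: real
      using that F by simp
    have "real (2 * n + 2) = 2 * real (n + 1)" "real (2 * n) = 2 * real n"
      by simp_all
    moreover have "real (n + 1) \<noteq> 0" "real n \<noteq> 0" "real (2 * n + 1) \<noteq> 0"
      using assms by simp_all
    ultimately show ?thesis
      by (simp only: cancel not_False_eq_True)
  qed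
  finally show ?thesis .
qed

definition Lambda ::
    "nat \<Rightarrow> ('a::euclidean_space \<Rightarrow> real) \<Rightarrow> ('a \<Rightarrow> real) \<Rightarrow> real" where
  "Lambda n K u = (LINT x|lborel. K x * exp (2 * real n * u x))"

definition alpha1 :: "nat \<Rightarrow> ('a::euclidean_space \<Rightarrow> real) \<Rightarrow> ereal" where
  "alpha1 n K =
     Sup (ereal ` {\<beta>. integrable lborel (\<lambda>x. K x * (1 + norm x) powr (2 * real n * \<beta>))})"

end

theory Submission
  imports Defs "HOL-Probability.Distributions"
begin

text \<open>The equation is tested with a difference of regularised logarithms
  \<open>G y = - ln (e\<^sup>2 + \<bar>y - x\<bar>\<^sup>2) / 2 + ln (e\<^sup>2 + \<bar>y\<bar>\<^sup>2) / 2\<close>, cut off at radius \<open>N\<close>. All derivatives of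
  \<open>G\<close> decay one order better than those of the logarithm, so the logarithmic growth of \<open>u\<close> makes the
  cutoff error vanish as \<open>N\<close> tends to infinity. By conformal invariance, \<open>(-\<Delta>)\<^sup>n\<close> maps
  \<open>- ln (e\<^sup>2 + \<bar>y\<bar>\<^sup>2) / 2\<close> to the explicit bubble \<open>c e\<^sup>2\<^sup>n (e\<^sup>2 + \<bar>y\<bar>\<^sup>2)\<^sup>-\<^sup>2\<^sup>n\<close>, an approximate identity of
  mass \<open>\<gamma>\<^sub>n\<close>. Letting \<open>e\<close> tend to \<open>0\<close> gives \<open>\<gamma>\<^sub>n (u x - u 0) = \<integral> ln (\<bar>y\<bar> / \<bar>x - y\<bar>) f y dy\<close> with
  \<open>f = K e\<^sup>2\<^sup>n\<^sup>u\<close>, and hence \<open>u x = - (\<Lambda> / \<gamma>\<^sub>n) ln \<bar>x\<bar> + o(ln \<bar>x\<bar>)\<close>. Combined with the hypothesis on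
  \<open>\<alpha>\<^sub>1(K)\<close>, this makes \<open>f\<close> integrable against a power of \<open>1 + \<bar>y\<bar>\<close>, which is what
  dominated convergence needs to pass to the limit in the representation formula.\<close>

section \<open>Families of symbols of finite order\<close>

text \<open>Two obstacles shape the estimates. The truncation error has to be small although
  \<open>u\<close> grows; hence bounds are stated for families with one common constant, each
  derivative gaining one order. The orders balance: the difference of logarithms has order -1, the
  truncation error scaled by \<open>(1 + N) powr (1 / 2)\<close> has order 1/2, so the product has
  order -1/2 and still beats \<open>u\<close>, of which only growth of order 1/4 is kept. The other
  obstacle is the singularity of the kernel at \<open>y = x\<close>, which escapes to infinity with
  \<open>x\<close>, while \<open>f\<close> is known only to be integrable and of polynomial growth.
  A radius that is a negative power of \<open>norm x\<close> separates a tiny ball, whose volume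
  compensates the growth of \<open>f\<close>, from the rest of the unit ball, where the logarithm is
  at most a multiple of \<open>ln (norm x)\<close> and \<open>f\<close> has vanishing mass. This
  costs a factor \<open>ln (norm x)\<close>, which is why there are two rounds: division by
  \<open>ln (norm x)\<close> pays for it in the leading term, and the weight
  \<open>ln (2 + norm y)\<close>, available after a power has been gained, pays for it in the
  refined expansion.\<close>

lemma partial_has_derivative:
  assumes "(f has_derivative f') (at x)"
  shows "partial b f x = f' b"
  using frechet_derivative_at[OF assms] by (simp add: partial_def)

lemma partial_eq:
  assumes "\<And>x. (f has_derivative f' x) (at x)"
  shows "partial b f = (\<lambda>x. f' x b)"
  using partial_has_derivative[OF assms] by blast

lemma has_derivative_frechet:
  assumes "f differentiable_on UNIV"
  shows "(f has_derivative frechet_derivative f (at x)) (at x)"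
  using assms by (simp add: differentiable_on_def frechet_derivative_works[symmetric])

lemma partial_add:
  assumes "f differentiable_on UNIV" "g differentiable_on UNIV"
  shows "partial b (\<lambda>x. f x + g x) = (\<lambda>x. partial b f x + partial b g x)"
  using partial_eq[OF has_derivative_add[OF has_derivative_frechet[OF assms(1)] has_derivative_frechet[OF assms(2)]]]
  by (simp add: partial_def)

lemma partial_mult:
  fixes f g :: "'a::euclidean_space \<Rightarrow> real"
  assumes "f differentiable_on UNIV" "g differentiable_on UNIV"
  shows "partial b (\<lambda>x. f x * g x) = (\<lambda>x. f x * partial b g x + partial b f x * g x)"
  using partial_eq[OF has_derivative_mult[OF has_derivative_frechet[OF assms(1)] has_derivative_frechet[OF assms(2)]]]
  by (simp add: partial_def)

lemma partial_const: "partial b (\<lambda>x. c) = (\<lambda>x. 0)"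
  by (simp add: partial_def fun_eq_iff)

text \<open>One constant serves all indices \<open>i\<close>. The index will be the truncation
  radius; a single function enters as a constant family.\<close>

definition order_le :: "real \<Rightarrow> (nat \<Rightarrow> 'a::euclidean_space \<Rightarrow> real) \<Rightarrow> bool" where
  "order_le m F \<longleftrightarrow> (\<exists>C. \<forall>i x. \<bar>F i x\<bar> \<le> C * (1 + norm x) powr m)"

text \<open>The symbol classes of pseudodifferential calculus, for functions of the space variable
  alone and stopped after \<open>k\<close> derivatives. The cap \<open>k\<close> lets functions
  whose derivatives involve the function itself be treated by induction.\<close>

primrec symbol_k :: "nat \<Rightarrow> real \<Rightarrow> (nat \<Rightarrow> 'a::euclidean_space \<Rightarrow> real) \<Rightarrow> bool" where
  "symbol_k 0 m F \<longleftrightarrow> order_le m F \<and> (\<forall>i. continuous_on UNIV (F i))"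
| "symbol_k (Suc k) m F \<longleftrightarrow> order_le m F \<and> (\<forall>i. F i differentiable_on UNIV) \<and>
     (\<forall>b\<in>Basis. symbol_k k (m - 1) (\<lambda>i. partial b (F i)))"

definition symbol :: "real \<Rightarrow> (nat \<Rightarrow> 'a::euclidean_space \<Rightarrow> real) \<Rightarrow> bool" where
  "symbol m F \<longleftrightarrow> (\<forall>k. symbol_k k m F)"

section \<open>Calculus of orders: sums, products, derivatives\<close>

lemma order_leE:
  fixes F :: "nat \<Rightarrow> 'a::euclidean_space \<Rightarrow> real"
  assumes "order_le m F"
  obtains C where "C > 0" "\<And>i x. \<bar>F i x\<bar> \<le> C * (1 + norm x) powr m"
proof -
  from assms obtain C where C: "\<And>i x. \<bar>F i x\<bar> \<le> C * (1 + norm x) powr m"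
    by (auto simp: order_le_def)
  have "C * (1 + norm x) powr m \<le> (\<bar>C\<bar> + 1) * (1 + norm x) powr m" for x :: 'a
    by (intro mult_right_mono) auto
  then have "\<bar>F i x\<bar> \<le> (\<bar>C\<bar> + 1) * (1 + norm x) powr m" for i x
    using C order_trans by blast
  then show thesis
    by (intro that[of "\<bar>C\<bar> + 1"]) auto
qed

lemma order_le_mono:
  fixes F :: "nat \<Rightarrow> 'a::euclidean_space \<Rightarrow> real"
  assumes "order_le m F" "m \<le> m'"
  shows "order_le m' F"
  using assms
proof (elim order_leE)
  fix C assume m: "m \<le> m'" and C: "C > 0" "\<And>i x. \<bar>F i x\<bar> \<le> C * (1 + norm x) powr m"
  have "C * (1 + norm x) powr m \<le> C * (1 + norm x) powr m'" for x :: 'a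
    using C(1) m by (intro mult_left_mono powr_mono) auto
  with C(2) show "order_le m' F"
    unfolding order_le_def by (meson order_trans)
qed

lemma order_le_add:
  assumes "order_le m F" "order_le m G"
  shows "order_le m (\<lambda>i x. F i x + G i x)"
proof -
  obtain C D where C: "\<And>i x. \<bar>F i x\<bar> \<le> C * (1 + norm x) powr m"
     and D: "\<And>i x. \<bar>G i x\<bar> \<le> D * (1 + norm x) powr m"
    using assms by (auto simp: order_le_def)
  have "\<bar>F i x + G i x\<bar> \<le> (C + D) * (1 + norm x) powr m" for i x
    using C[of i x] D[of i x] by (simp add: distrib_right)
  then show ?thesis unfolding order_le_def by blast
qed

lemma order_le_mult:
  assumes "order_le m F" "order_le m' G"
  shows "order_le (m + m') (\<lambda>i x. F i x * G i x)"
proof -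
  obtain C where C: "C > 0" "\<And>i x. \<bar>F i x\<bar> \<le> C * (1 + norm x) powr m"
    using order_leE[OF assms(1)] by blast
  obtain D where D: "D > 0" "\<And>i x. \<bar>G i x\<bar> \<le> D * (1 + norm x) powr m'"
    using order_leE[OF assms(2)] by blast
  have "\<bar>F i x * G i x\<bar> \<le> (C * D) * (1 + norm x) powr (m + m')" for i x
  proof -
    have "\<bar>F i x * G i x\<bar> \<le> (C * (1 + norm x) powr m) * (D * (1 + norm x) powr m')"
      unfolding abs_mult using C D by (intro mult_mono) auto
    then show ?thesis by (simp add: powr_add mult_ac)
  qed
  then show ?thesis unfolding order_le_def by blast
qed

lemma symbol_k_order: "symbol_k k m F \<Longrightarrow> order_le m F"
  by (cases k) auto

lemma symbol_k_Suc: "symbol_k (Suc k) m F \<Longrightarrow> symbol_k k m F"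
proof (induction k arbitrary: m F)
  case 0
  then show ?case by (auto simp: differentiable_imp_continuous_on)
next
  case (Suc k)
  then show ?case by (metis symbol_k.simps(2))
qed

lemma symbol_k_mono: "symbol_k k m F \<Longrightarrow> m \<le> m' \<Longrightarrow> symbol_k k m' F"
proof (induction k arbitrary: m m' F)
  case 0
  then show ?case by (auto intro: order_le_mono)
next
  case (Suc k)
  then show ?case
    by (auto intro: order_le_mono Suc.IH[of "m - 1"])
qed

lemma symbol_k_add:
  "symbol_k k m F \<Longrightarrow> symbol_k k m G \<Longrightarrow> symbol_k k m (\<lambda>i x. F i x + G i x)"
proof (induction k arbitrary: m F G)
  case 0
  then show ?case by (auto intro!: order_le_add continuous_on_add)
next
  case (Suc k)
  then show ?case
    by (auto intro!: order_le_add Suc.IH simp: partial_add)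
qed

lemma symbol_k_mult:
  fixes F G :: "nat \<Rightarrow> 'a::euclidean_space \<Rightarrow> real"
  shows "symbol_k k m F \<Longrightarrow> symbol_k k m' G \<Longrightarrow> symbol_k k (m + m') (\<lambda>i x. F i x * G i x)"
proof (induction k arbitrary: m m' F G)
  case 0
  then show ?case by (auto intro!: order_le_mult continuous_on_mult)
next
  case (Suc k)
  have "symbol_k k (m + m' - 1) (\<lambda>i x. F i x * partial b (G i) x + partial b (F i) x * G i x)"
    if b: "b \<in> Basis" for b
  proof (rule symbol_k_add)
    show "symbol_k k (m + m' - 1) (\<lambda>i x. F i x * partial b (G i) x)"
      using Suc.IH[OF symbol_k_Suc[OF Suc.prems(1)], of "m' - 1" "\<lambda>i. partial b (G i)"] Suc.prems(2) b
      by (simp add: add_diff_eq)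
    show "symbol_k k (m + m' - 1) (\<lambda>i x. partial b (F i) x * G i x)"
      using Suc.IH[OF _ symbol_k_Suc[OF Suc.prems(2)], of "m - 1" "\<lambda>i. partial b (F i)"] Suc.prems(1) b
      by (simp add: algebra_simps)
  qed
  then show ?case
    using Suc.prems by (auto intro!: order_le_mult simp: partial_mult)
qed

lemma symbol_k_C_k: "symbol_k k m F \<Longrightarrow> C_k k (F i)"
proof (induction k arbitrary: m F i)
  case (Suc k)
  have "C_k k (partial b (F i))" if "b \<in> Basis" for b
    using Suc.IH[of "m - 1" "\<lambda>i. partial b (F i)" i] Suc.prems that by simp
  then show ?case using Suc.prems by simp
qed simp

lemma symbol_order: "symbol m F \<Longrightarrow> order_le m F"
  by (auto simp: symbol_def intro: symbol_k_order)

lemma symbol_mono: "symbol m F \<Longrightarrow> m \<le> m' \<Longrightarrow> symbol m' F"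
  by (auto simp: symbol_def intro: symbol_k_mono)

lemma symbol_add: "symbol m F \<Longrightarrow> symbol m G \<Longrightarrow> symbol m (\<lambda>i x. F i x + G i x)"
  by (auto simp: symbol_def intro: symbol_k_add)

lemma symbol_mult: "symbol m F \<Longrightarrow> symbol m' G \<Longrightarrow> symbol (m + m') (\<lambda>i x. F i x * G i x)"
  by (auto simp: symbol_def intro: symbol_k_mult)

lemma symbol_partial: "symbol m F \<Longrightarrow> b \<in> Basis \<Longrightarrow> symbol (m - 1) (\<lambda>i. partial b (F i))"
  unfolding symbol_def by (metis symbol_k.simps(2))

lemma symbol_differentiable: "symbol m F \<Longrightarrow> F i differentiable_on UNIV"
  unfolding symbol_def by (metis symbol_k.simps(2))

lemma symbol_C_k: "symbol m F \<Longrightarrow> C_k k (F i)"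
  by (auto simp: symbol_def intro: symbol_k_C_k)

lemma symbol_zero: "symbol m (\<lambda>i x. 0)"
  unfolding symbol_def
proof
  fix k
  show "symbol_k k m (\<lambda>i x. 0)"
    by (induction k arbitrary: m) (auto simp: order_le_def partial_const intro!: exI[of _ 0])
qed

text \<open>Spares an induction on the number of derivatives whenever the first derivatives are
  already known to be symbols.\<close>

lemma symbolI:
  assumes "order_le m F" "\<And>i. F i differentiable_on UNIV"
    "\<And>b. b \<in> Basis \<Longrightarrow> symbol (m - 1) (\<lambda>i. partial b (F i))"
  shows "symbol m F"
  unfolding symbol_def
proof
  fix k
  show "symbol_k k m F"
    using assms by (cases k) (auto simp: symbol_def differentiable_imp_continuous_on)
qed

lemma symbol_const: "symbol 0 (\<lambda>i x. c)"
  by (rule symbolI)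
    (auto simp: order_le_def partial_const symbol_zero add_nonneg_eq_0_iff intro!: exI[of _ "\<bar>c\<bar>"])

lemma symbol_cmult: "symbol m F \<Longrightarrow> symbol m (\<lambda>i x. c * F i x)"
  using symbol_mult[OF symbol_const, of m F c] by simp

lemma symbol_minus: "symbol m F \<Longrightarrow> symbol m (\<lambda>i x. - F i x)"
  using symbol_cmult[of m F "-1"] by simp

lemma symbol_sum: "(\<And>b. b \<in> A \<Longrightarrow> symbol m (F b)) \<Longrightarrow> symbol m (\<lambda>i x. \<Sum>b\<in>A. F b i x)"
  by (induction A rule: infinite_finite_induct) (auto intro!: symbol_zero symbol_add)

text \<open>This is the factor that the chain rule produces for every radial function below, so its
  order 1 enters all the counts of orders.\<close>

lemma symbol_inner: "symbol 1 (\<lambda>i x. (x - c) \<bullet> b)"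
proof (rule symbolI)
  have "\<bar>(x - c) \<bullet> b\<bar> \<le> (norm b * (1 + norm c)) * (1 + norm x)" for x
  proof -
    have "norm (x - c) \<le> norm x + norm c" by norm
    also have "\<dots> \<le> (1 + norm c) * (1 + norm x)"
      by (simp add: algebra_simps)
    finally have "norm (x - c) * norm b \<le> (1 + norm c) * (1 + norm x) * norm b"
      by (rule mult_right_mono) simp
    then show ?thesis using Cauchy_Schwarz_ineq2[of "x - c" b] by (simp add: mult_ac)
  qed
  then show "order_le 1 (\<lambda>i x. (x - c) \<bullet> b)"
    unfolding order_le_def by (auto intro!: exI[of _ "norm b * (1 + norm c)"])
  have d: "((\<lambda>x. (x - c) \<bullet> b) has_derivative (\<lambda>h. h \<bullet> b)) (at x)" for x
    by (auto intro!: derivative_eq_intros)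
  then show "(\<lambda>x. (x - c) \<bullet> b) differentiable_on UNIV"
    by (meson differentiable_def differentiable_on_def has_derivative_at_withinI)
  show "symbol (1 - 1) (\<lambda>i. partial b' (\<lambda>x. (x - c) \<bullet> b))" for b'
    using symbol_const by (simp add: partial_eq[OF d])
qed

lemma symbol_neg_laplacian: "symbol m F \<Longrightarrow> symbol (m - 2) (\<lambda>i. neg_laplacian (F i))"
proof -
  assume F: "symbol m F"
  have "symbol (m - 1 - 1) (\<lambda>i. partial b (partial b (F i)))" if "b \<in> Basis" for b
    by (intro symbol_partial F that)
  then have "symbol (m - 2) (\<lambda>i x. - (\<Sum>b\<in>Basis. partial b (partial b (F i)) x))"
    by (intro symbol_minus symbol_sum) simp
  then show ?thesis unfolding neg_laplacian_def[abs_def] .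
qed

lemma symbol_neg_laplacian_iter:
  "symbol m F \<Longrightarrow> symbol (m - 2 * real k) (\<lambda>i. (neg_laplacian ^^ k) (F i))"
proof (induction k)
  case (Suc k)
  then show ?case using symbol_neg_laplacian[OF Suc.IH] by (simp add: algebra_simps)
qed simp

text \<open>\<open>partial\<close> takes an arbitrary value where no derivative exists, so even
  additivity needs regularity. Symbols provide it, and the two orders may differ.\<close>

lemma neg_laplacian_add:
  assumes "symbol m F" "symbol m' G"
  shows "neg_laplacian (\<lambda>x. F i x + G i x) = (\<lambda>x. neg_laplacian (F i) x + neg_laplacian (G i) x)"
proof -
  have "partial b (partial b (\<lambda>x. F i x + G i x)) =
      (\<lambda>x. partial b (partial b (F i)) x + partial b (partial b (G i)) x)" if "b \<in> Basis" for b
    using partial_add[OF symbol_differentiable[OF symbol_partial[OF assms(1) that]]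
        symbol_differentiable[OF symbol_partial[OF assms(2) that]], of b i i]
    by (simp add: partial_add symbol_differentiable[OF assms(1)] symbol_differentiable[OF assms(2)])
  then show ?thesis
    by (simp add: neg_laplacian_def[abs_def] sum.distrib)
qed

lemma neg_laplacian_iter_add:
  assumes "symbol m F" "symbol m' G"
  shows "(neg_laplacian ^^ k) (\<lambda>x. F i x + G i x) =
    (\<lambda>x. (neg_laplacian ^^ k) (F i) x + (neg_laplacian ^^ k) (G i) x)"
proof (induction k)
  case (Suc k)
  then show ?case
    using neg_laplacian_add[OF symbol_neg_laplacian_iter[OF assms(1)] symbol_neg_laplacian_iter[OF assms(2)]]
    by simp
qed simp

lemma neg_laplacian_cmult:
  assumes "symbol m F"
  shows "neg_laplacian (\<lambda>x. c * F i x) = (\<lambda>x. c * neg_laplacian (F i) x)"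
proof -
  have "partial b (partial b (\<lambda>x. c * F i x)) = (\<lambda>x. c * partial b (partial b (F i)) x)"
    if "b \<in> Basis" for b
    using partial_mult[OF differentiable_on_const symbol_differentiable[OF symbol_partial[OF assms that]], of b c i]
    by (simp add: partial_mult symbol_differentiable[OF assms] partial_const)
  then show ?thesis
    by (simp add: neg_laplacian_def[abs_def] sum_distrib_left)
qed

lemma neg_laplacian_iter_cmult:
  assumes "symbol m F"
  shows "(neg_laplacian ^^ k) (\<lambda>x. c * F i x) = (\<lambda>x. c * (neg_laplacian ^^ k) (F i) x)"
proof (induction k)
  case (Suc k)
  then show ?case
    using neg_laplacian_cmult[OF symbol_neg_laplacian_iter[OF assms]] by simp
qed simp

section \<open>A smooth cutoff\<close>

text \<open>The standard smooth function that is flat at the origin, with a polynomial factor in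
  \<open>1 / s\<close> so that the family is closed under differentiation.\<close>

definition flat :: "real poly \<Rightarrow> real \<Rightarrow> real" where
  "flat p s = (if s > 0 then poly p (1 / s) * exp (- (1 / s)) else 0)"

text \<open>Differentiating \<open>p(1/s) exp(-1/s)\<close> gives
  \<open>(p - p')(1/s) exp(-1/s)\<close> divided by the square of \<open>s\<close>; that division is
  multiplication of the polynomial by the square of its variable.\<close>

definition flat_deriv :: "real poly \<Rightarrow> real poly" where
  "flat_deriv p = [:0, 0, 1:] * (p - pderiv p)"

lemma poly_times_exp_minus_tendsto_0:
  "((\<lambda>x::real. poly p x * exp (- x)) \<longlongrightarrow> 0) at_top"
proof -
  have "((\<lambda>x. \<Sum>i\<le>degree p. coeff p i * (x ^ i / exp x)) \<longlongrightarrow> (\<Sum>i\<le>degree p. coeff p i * 0)) at_top"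
    by (intro tendsto_intros tendsto_power_div_exp_0)
  then show ?thesis
    by (simp add: poly_altdef sum_distrib_right exp_minus divide_inverse mult.assoc)
qed

lemma flat_tendsto_0: "(flat p \<longlongrightarrow> 0) (at 0)"
proof (rule filterlim_split_at)
  have "((\<lambda>x. poly p (inverse x) * exp (- inverse x)) \<longlongrightarrow> 0) (at_right 0)"
    by (rule filterlim_compose[OF poly_times_exp_minus_tendsto_0 filterlim_inverse_at_top_right])
  moreover have "eventually (\<lambda>x. poly p (inverse x) * exp (- inverse x) = flat p x) (at_right 0)"
    by (auto simp: eventually_at_filter flat_def inverse_eq_divide)
  ultimately show "(flat p \<longlongrightarrow> 0) (at_right 0)"
    by (rule Lim_transform_eventually)
  have "eventually (\<lambda>x. 0 = flat p x) (at_left 0)"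
    by (auto simp: eventually_at_filter flat_def)
  then show "(flat p \<longlongrightarrow> 0) (at_left 0)"
    by (rule Lim_transform_eventually[OF tendsto_const])
qed

lemma flat_has_derivative: "(flat p has_real_derivative flat (flat_deriv p) s) (at s)"
proof -
  consider "s > 0" | "s = 0" | "s < 0" by linarith
  then show ?thesis
  proof cases
    case 1
    have "((\<lambda>s. poly p (1 / s) * exp (- (1 / s))) has_real_derivative flat (flat_deriv p) s) (at s)"
      using 1 by (auto intro!: derivative_eq_intros DERIV_chain'[OF _ poly_DERIV]
          simp: flat_def flat_deriv_def field_simps power2_eq_square)
    moreover have "poly p (1 / x) * exp (- (1 / x)) = flat p x" if "x \<in> {0<..}" for x
      using that by (simp add: flat_def)
    ultimately show ?thesis
      using 1 by (elim has_field_derivative_transform_within_open[where S = "{0<..}"]) auto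
  next
    case 2
    \<comment> \<open>The difference quotient at 0 belongs to the family again, so its limit is the
      one already computed.\<close>
    have "flat p h / h = flat ([:0, 1:] * p) h" for h
      by (simp add: flat_def)
    then have "((\<lambda>h. (flat p (0 + h) - flat p 0) / h) \<longlongrightarrow> 0) (at 0)"
      using flat_tendsto_0[of "[:0, 1:] * p"] by (simp add: flat_def[of p 0])
    then show ?thesis
      using 2 by (simp add: DERIV_def flat_def[of _ 0])
  next
    case 3
    have "((\<lambda>s. 0) has_real_derivative flat (flat_deriv p) s) (at s)"
      using 3 by (simp add: flat_def)
    moreover have "0 = flat p x" if "x \<in> {..<0}" for x
      using that by (simp add: flat_def)
    ultimately show ?thesis
      using 3 by (elim has_field_derivative_transform_within_open[where S = "{..<0}"]) auto
  qed
qed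

text \<open>The range \<open>s \<le> 1\<close> is all that occurs: the arguments will be 1 minus a
  square.\<close>

lemma flat_bounded:
  obtains B where "B > 0" "\<And>s. s \<le> 1 \<Longrightarrow> \<bar>flat p s\<bar> \<le> B"
proof -
  have "continuous_on {0..1} (flat p)"
    using flat_has_derivative by (intro DERIV_continuous_on) (auto intro: has_field_derivative_at_within)
  then have "bounded (flat p ` {0..1})"
    by (intro compact_imp_bounded compact_continuous_image) auto
  then obtain B where B: "B > 0" "\<And>s. s \<in> {0..1} \<Longrightarrow> \<bar>flat p s\<bar> \<le> B"
    by (auto simp: bounded_pos)
  have "\<bar>flat p s\<bar> \<le> B" if "s \<le> 1" for s
    using B that by (cases "s \<ge> 0") (auto simp: flat_def)
  then show thesis using that B by blast
qed

lemma flat_radial_has_derivative: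
  fixes y :: "'a::euclidean_space"
  shows "((\<lambda>y. flat p (1 - (norm y)\<^sup>2 / r\<^sup>2)) has_derivative
     (\<lambda>h. - 2 * (y \<bullet> h) / r\<^sup>2 * flat (flat_deriv p) (1 - (norm y)\<^sup>2 / r\<^sup>2))) (at y)"
proof -
  have "((\<lambda>y::'a. 1 - (y \<bullet> y) / r\<^sup>2) has_derivative (\<lambda>h. - 2 * (y \<bullet> h) / r\<^sup>2)) (at y)"
    unfolding divide_inverse
    by (auto intro!: derivative_eq_intros simp: inner_commute fun_eq_iff)
  from has_derivative_compose[OF this flat_has_derivative[of p, unfolded has_field_derivative_def]]
  show ?thesis
    by (simp add: power2_norm_eq_inner mult_ac)
qed

lemma flat_radial_differentiable:
  "(\<lambda>y::'a::euclidean_space. c * flat p (1 - (norm y)\<^sup>2 / r\<^sup>2)) differentiable_on UNIV"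
  unfolding differentiable_on_def differentiable_def
  by (auto intro!: exI has_derivative_mult_right flat_radial_has_derivative)

lemma flat_radial_partial:
  fixes b :: "'a::euclidean_space"
  shows "partial b (\<lambda>y. c * flat p (1 - (norm y)\<^sup>2 / r\<^sup>2)) =
    (\<lambda>y. - 2 * ((y - 0) \<bullet> b) * (c / r\<^sup>2 * flat (flat_deriv p) (1 - (norm y)\<^sup>2 / r\<^sup>2)))"
  by (subst partial_eq[OF has_derivative_mult_right[OF flat_radial_has_derivative]])
    (simp add: fun_eq_iff)

text \<open>On the support \<open>1 + norm y\<close> is at most \<open>2 * (1 + real N)\<close>, so
  negative powers of \<open>1 + real N\<close> turn into decay in \<open>y\<close>, uniformly in
  \<open>N\<close>. A derivative brings a linear factor and two more negative powers of the radius: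
  the order becomes \<open>1 - (j + 2) = - j - 1\<close>. The induction therefore runs over all
  \<open>j\<close> and \<open>p\<close>.\<close>

lemma symbol_flat_radial:
  fixes j :: real
  assumes "j \<ge> 0"
  shows "symbol (- j) (\<lambda>N (y::'a::euclidean_space).
    (1 + real N) powr (- j) * flat p (1 - (norm y)\<^sup>2 / (1 + real N)\<^sup>2))"
  unfolding symbol_def
proof
  have ord: "order_le (- j) (\<lambda>N (y::'a). (1 + real N) powr (- j) * flat p (1 - (norm y)\<^sup>2 / (1 + real N)\<^sup>2))"
    if "j \<ge> 0" for j p
  proof -
    obtain B where B: "B > 0" "\<And>s. s \<le> 1 \<Longrightarrow> \<bar>flat p s\<bar> \<le> B"
      using flat_bounded[of p] by blast
    have "\<bar>(1 + real N) powr (- j) * flat p (1 - (norm y)\<^sup>2 / (1 + real N)\<^sup>2)\<bar>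
        \<le> 2 powr j * B * (1 + norm y) powr (- j)" for N and y :: 'a
    proof (cases "norm y < 1 + real N")
      case True
      have "(1 + norm y) powr j \<le> (2 * (1 + real N)) powr j"
        using True \<open>j \<ge> 0\<close> by (intro powr_mono2) auto
      then have "(1 + norm y) powr j \<le> 2 powr j * (1 + real N) powr j"
        by (simp only: powr_mult)
      then have "(1 + real N) powr (- j) \<le> 2 powr j * (1 + norm y) powr (- j)"
        using add_pos_nonneg[of 1 "norm y"]
        by (simp add: powr_minus inverse_eq_divide divide_le_eq le_divide_eq pos_divide_le_eq pos_le_divide_eq mult_ac)
      then have "(1 + real N) powr (- j) * \<bar>flat p (1 - (norm y)\<^sup>2 / (1 + real N)\<^sup>2)\<bar>
          \<le> (2 powr j * (1 + norm y) powr (- j)) * B"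
        using B by (intro mult_mono) auto
      then show ?thesis by (simp add: abs_mult mult_ac)
    next
      case False
      then have "(1 + real N)\<^sup>2 \<le> (norm y)\<^sup>2" by (intro power_mono) auto
      then have "\<not> (0 < 1 - (norm y)\<^sup>2 / (1 + real N)\<^sup>2)" by (simp add: not_less)
      then have "flat p (1 - (norm y)\<^sup>2 / (1 + real N)\<^sup>2) = 0"
        unfolding flat_def by simp
      then show ?thesis using B(1) by simp
    qed
    then show ?thesis unfolding order_le_def by blast
  qed
  fix k
  show "symbol_k k (- j) (\<lambda>N (y::'a). (1 + real N) powr (- j) * flat p (1 - (norm y)\<^sup>2 / (1 + real N)\<^sup>2))"
    using assms
  proof (induction k arbitrary: j p)
    case 0
    then show ?case
      by (auto intro!: ord differentiable_imp_continuous_on flat_radial_differentiable)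
  next
    case (Suc k)
    have "symbol_k k (- j - 1) (\<lambda>N. partial b (\<lambda>y. (1 + real N) powr (- j) * flat p (1 - (norm y)\<^sup>2 / (1 + real N)\<^sup>2)))"
      for b :: 'a
    proof -
      have e: "(1 + real N) powr (- j) / (1 + real N)\<^sup>2 = (1 + real N) powr (- (j + 2))" for N
      proof -
        have "(1 + real N) powr (- (j + 2)) = (1 + real N) powr (- j - 2)" by simp
        also have "\<dots> = (1 + real N) powr (- j) / (1 + real N)\<^sup>2"
          by (subst powr_diff) (simp add: powr_numeral)
        finally show ?thesis by simp
      qed
      have "symbol_k k (1 + - (j + 2)) (\<lambda>N y. (- 2 * ((y - 0) \<bullet> b)) *
          ((1 + real N) powr (- (j + 2)) * flat (flat_deriv p) (1 - (norm y)\<^sup>2 / (1 + real N)\<^sup>2)))"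
        using symbol_cmult[OF symbol_inner, of "-2" 0 b] Suc.prems
        by (intro symbol_k_mult Suc.IH) (auto simp: symbol_def)
      moreover have "1 + - (j + 2) = - j - 1" by simp
      ultimately show ?thesis unfolding flat_radial_partial e by (simp only:)
    qed
    then show ?case
      using Suc.prems by (auto intro!: ord flat_radial_differentiable)
  qed
qed

text \<open>The factor \<open>exp 1\<close> makes the value at the origin 1. The function is not
  constant near the origin, so its distance from 1 has to be estimated everywhere; the radius
  \<open>1 + real N\<close> never vanishes.\<close>

definition cutoff :: "nat \<Rightarrow> 'a::euclidean_space \<Rightarrow> real" where
  "cutoff N y = flat [:exp 1:] (1 - (norm y)\<^sup>2 / (1 + real N)\<^sup>2)"

lemma symbol_cutoff: "symbol 0 cutoff"
  using symbol_flat_radial[of 0 "[:exp 1:]"] by (simp add: cutoff_def[abs_def])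

lemma cutoff_support:
  assumes "cutoff N y \<noteq> 0"
  shows "norm y \<le> 1 + real N"
proof (rule ccontr)
  assume "\<not> ?thesis"
  then have "(1 + real N)\<^sup>2 \<le> (norm y)\<^sup>2" by (intro power_mono) auto
  then have "\<not> (0 < 1 - (norm y)\<^sup>2 / (1 + real N)\<^sup>2)" by (simp add: not_less)
  then show False using assms unfolding cutoff_def flat_def by simp
qed

text \<open>Interpolation: the error is at most a multiple of
  \<open>(norm y / (1 + real N)) powr (1 / 2)\<close>, so half an order of growth in
  \<open>y\<close> buys the factor \<open>(1 + real N) powr (- 1 / 2)\<close>.\<close>

lemma symbol_cutoff_remainder:
  "symbol (1 / 2) (\<lambda>N (y::'a::euclidean_space). (1 + real N) powr (1 / 2) * (cutoff N y - 1))"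
proof (rule symbolI)
  let ?q = "[:exp 1:] :: real poly"
  obtain B where B: "B > 0" "\<And>s. s \<le> 1 \<Longrightarrow> \<bar>flat (flat_deriv ?q) s\<bar> \<le> B"
    using flat_bounded[of "flat_deriv ?q"] by blast
  have one: "flat ?q 1 = 1"
    by (simp add: flat_def mult_exp_exp)
  have lip: "\<bar>flat ?q (1 - s) - 1\<bar> \<le> B * s" if "0 \<le> s" "s \<le> 1" for s
  proof -
    have "norm (flat ?q (1 - s) - flat ?q 1) \<le> B * norm ((1 - s) - 1)"
      by (rule field_differentiable_bound[where S = "{..1}" and f' = "flat (flat_deriv ?q)"])
        (use that B in \<open>auto intro: has_field_derivative_at_within flat_has_derivative\<close>)
    then show ?thesis using that one by simp
  qed
  \<comment> \<open>The exponent is 1/4 because \<open>s\<close> will be the square of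
    \<open>norm y / (1 + real N)\<close>. Small \<open>s\<close> use the Lipschitz bound, and for
    \<open>s > 1\<close> the cutoff vanishes and the error is exactly 1.\<close>
  have bd: "\<bar>flat ?q (1 - s) - 1\<bar> \<le> (B + 1) * s powr (1 / 4)" if "0 \<le> s" for s
  proof (cases "s \<le> 1")
    case True
    have "s powr 1 \<le> s powr (1 / 4)" using True that by (intro powr_mono') auto
    then have "B * s \<le> (B + 1) * s powr (1 / 4)"
      using B that by (intro mult_mono) auto
    then show ?thesis using lip[OF that True] by linarith
  next
    case False
    then have "1 \<le> s powr (1 / 4)" by (intro ge_one_powr_ge_zero) auto
    moreover have "0 \<le> B * s powr (1 / 4)" using B by simp
    ultimately have "1 \<le> (B + 1) * s powr (1 / 4)" by (simp add: distrib_right)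
    then show ?thesis using False by (simp add: flat_def)
  qed
  have "\<bar>(1 + real N) powr (1 / 2) * (cutoff N y - 1)\<bar> \<le> (B + 1) * (1 + norm y) powr (1 / 2)"
    for N and y :: 'a
  proof -
    have "((norm y)\<^sup>2 / (1 + real N)\<^sup>2) powr (1 / 4) = (norm y / (1 + real N)) powr (1 / 2)"
    proof (cases "y = 0")
      case False
      then have "(norm y / (1 + real N)) powr 2 = (norm y)\<^sup>2 / (1 + real N)\<^sup>2"
        by (simp add: powr_numeral power_divide)
      then show ?thesis using False powr_powr[of "norm y / (1 + real N)" 2 "1/4"] by simp
    qed simp
    also have "\<dots> = norm y powr (1 / 2) / (1 + real N) powr (1 / 2)"
      by (simp add: powr_divide)
    finally have e: "(1 + real N) powr (1 / 2) * ((norm y)\<^sup>2 / (1 + real N)\<^sup>2) powr (1 / 4) = norm y powr (1 / 2)"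
      by (simp add: add_nonneg_eq_0_iff)
    have "\<bar>(1 + real N) powr (1 / 2) * (cutoff N y - 1)\<bar>
        \<le> (1 + real N) powr (1 / 2) * ((B + 1) * ((norm y)\<^sup>2 / (1 + real N)\<^sup>2) powr (1 / 4))"
      unfolding abs_mult cutoff_def by (intro mult_mono bd) auto
    also have "\<dots> = (B + 1) * norm y powr (1 / 2)"
      using e by (simp add: mult_ac)
    also have "\<dots> \<le> (B + 1) * (1 + norm y) powr (1 / 2)"
      using B by (intro mult_left_mono powr_mono2) auto
    finally show ?thesis .
  qed
  then show "order_le (1 / 2) (\<lambda>N (y::'a). (1 + real N) powr (1 / 2) * (cutoff N y - 1))"
    unfolding order_le_def by blast
  have d: "((\<lambda>y::'a. (1 + real N) powr (1 / 2) * (cutoff N y - 1)) has_derivative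
     (\<lambda>h. (1 + real N) powr (1 / 2) * (- 2 * (y \<bullet> h) / (1 + real N)\<^sup>2 *
        flat (flat_deriv ?q) (1 - (norm y)\<^sup>2 / (1 + real N)\<^sup>2)))) (at y)" for N y
    unfolding cutoff_def
    using has_derivative_mult_right[OF has_derivative_diff[OF flat_radial_has_derivative[of ?q "1 + real N" y] has_derivative_const[of 1]], of "(1 + real N) powr (1 / 2)"]
    by simp
  then show "(\<lambda>y::'a. (1 + real N) powr (1 / 2) * (cutoff N y - 1)) differentiable_on UNIV" for N
    unfolding differentiable_on_def differentiable_def using d by (auto intro!: exI)
  show "symbol (1 / 2 - 1) (\<lambda>N. partial b (\<lambda>y::'a. (1 + real N) powr (1 / 2) * (cutoff N y - 1)))" for b
  proof -
    \<comment> \<open>The exponents combine to \<open>1/2 - 2 = - 3/2\<close>; with the linear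
      factor the derivative has order \<open>1 - 3/2 = 1/2 - 1\<close>, as required.\<close>
    have e: "(1 + real N) powr (1 / 2) * (- 2 * (y \<bullet> b) / (1 + real N)\<^sup>2 * z)
       = (- 2 * ((y - 0) \<bullet> b)) * ((1 + real N) powr (- (3 / 2)) * z)" for N y z
    proof -
      have "(1 + real N) powr (- (3 / 2)) = (1 + real N) powr (1 / 2 - 2)" by simp
      also have "\<dots> = (1 + real N) powr (1 / 2) / (1 + real N)\<^sup>2"
        by (subst powr_diff) (simp add: powr_numeral)
      finally show ?thesis by simp
    qed
    have "symbol (1 + - (3 / 2)) (\<lambda>N y. (- 2 * ((y - 0) \<bullet> b)) *
        ((1 + real N) powr (- (3 / 2)) * flat (flat_deriv ?q) (1 - (norm y)\<^sup>2 / (1 + real N)\<^sup>2)))"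
      by (intro symbol_mult symbol_cmult symbol_inner symbol_flat_radial) auto
    then show ?thesis unfolding partial_eq[OF d] e by simp
  qed
qed

section \<open>Bubbles\<close>

text \<open>Squared distance to \<open>c\<close>, smoothed at scale \<open>e\<close>. All kernels
  below are functions of it.\<close>

definition qd :: "real \<Rightarrow> 'a::euclidean_space \<Rightarrow> 'a \<Rightarrow> real" where
  "qd e c y = e\<^sup>2 + (norm (y - c))\<^sup>2"

lemma qd_pos: "e > 0 \<Longrightarrow> qd e c y > 0"
  by (simp add: qd_def add_pos_nonneg)

lemma qd_has_derivative: "(qd e c has_derivative (\<lambda>h. 2 * ((y - c) \<bullet> h))) (at y)"
  unfolding qd_def[abs_def] power2_norm_eq_inner
  by (auto intro!: derivative_eq_intros simp: inner_commute fun_eq_iff)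

lemma radial_has_derivative:
  assumes "e > 0" "\<And>t. t > 0 \<Longrightarrow> (\<phi> has_real_derivative \<phi>' t) (at t)"
  shows "((\<lambda>y. \<phi> (qd e c y)) has_derivative (\<lambda>h. 2 * ((y - c) \<bullet> h) * \<phi>' (qd e c y))) (at y)"
  using has_derivative_compose[OF qd_has_derivative assms(2)[OF qd_pos[OF assms(1)], unfolded has_field_derivative_def]]
  by (simp add: mult_ac)

lemma radial_differentiable:
  assumes "e > 0" "\<And>t. t > 0 \<Longrightarrow> (\<phi> has_real_derivative \<phi>' t) (at t)"
  shows "(\<lambda>y. \<phi> (qd e c y)) differentiable_on UNIV"
  unfolding differentiable_on_def differentiable_def
  using radial_has_derivative[OF assms] by (auto intro!: exI)

lemma radial_partial:
  assumes "e > 0" "\<And>t. t > 0 \<Longrightarrow> (\<phi> has_real_derivative \<phi>' t) (at t)"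
  shows "partial b (\<lambda>y. \<phi> (qd e c y)) = (\<lambda>y. 2 * ((y - c) \<bullet> b) * \<phi>' (qd e c y))"
  using partial_eq[OF radial_has_derivative[OF assms]] .

text \<open>Chain rule: the Laplacian of \<open>qd e c\<close> is \<open>2 * real DIM('a)\<close>,
  and its squared gradient is 4 times the squared distance, that is
  \<open>4 * (qd e c y - e\<^sup>2)\<close>. Thus the result is again a function of
  \<open>qd e c\<close>, and the operator can be iterated.\<close>

lemma neg_laplacian_radial:
  fixes c :: "'a::euclidean_space"
  assumes "e > 0" "\<And>t. t > 0 \<Longrightarrow> (\<phi> has_real_derivative \<phi>' t) (at t)"
    "\<And>t. t > 0 \<Longrightarrow> (\<phi>' has_real_derivative \<phi>'' t) (at t)"
  shows "neg_laplacian (\<lambda>y. \<phi> (qd e c y)) = (\<lambda>y. - (2 * real DIM('a) * \<phi>' (qd e c y)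
     + 4 * (qd e c y - e\<^sup>2) * \<phi>'' (qd e c y)))"
proof
  fix y
  have p2: "partial b (\<lambda>y. 2 * ((y - c) \<bullet> b) * \<phi>' (qd e c y)) y =
      2 * \<phi>' (qd e c y) + 4 * ((y - c) \<bullet> b)\<^sup>2 * \<phi>'' (qd e c y)" if "b \<in> Basis" for b
  proof -
    have 1: "((\<lambda>y. 2 * ((y - c) \<bullet> b)) has_derivative (\<lambda>h. 2 * (h \<bullet> b))) (at y)"
      by (auto intro!: derivative_eq_intros)
    have "partial b (\<lambda>y. 2 * ((y - c) \<bullet> b) * \<phi>' (qd e c y)) y =
        2 * ((y - c) \<bullet> b) * (2 * ((y - c) \<bullet> b) * \<phi>'' (qd e c y)) + 2 * (b \<bullet> b) * \<phi>' (qd e c y)"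
      using partial_has_derivative[OF has_derivative_mult[OF 1
            radial_has_derivative[OF assms(1,3), where c = c and y = y]], of b] .
    then show ?thesis
      using that by (simp add: power2_eq_square)
  qed
  have "(\<Sum>b\<in>Basis. ((y - c) \<bullet> b)\<^sup>2) = qd e c y - e\<^sup>2"
    unfolding qd_def power2_norm_eq_inner
    by (subst euclidean_inner[of "y - c" "y - c"]) (simp add: power2_eq_square)
  then have "(\<Sum>b\<in>Basis. 2 * \<phi>' (qd e c y) + 4 * ((y - c) \<bullet> b)\<^sup>2 * \<phi>'' (qd e c y)) =
      2 * real DIM('a) * \<phi>' (qd e c y) + 4 * (qd e c y - e\<^sup>2) * \<phi>'' (qd e c y)"
    by (simp add: sum.distrib sum_distrib_left[symmetric] sum_distrib_right[symmetric])
  note s = this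
  show "neg_laplacian (\<lambda>y. \<phi> (qd e c y)) y = - (2 * real DIM('a) * \<phi>' (qd e c y)
     + 4 * (qd e c y - e\<^sup>2) * \<phi>'' (qd e c y))"
  proof -
    have "partial b (\<lambda>y. \<phi> (qd e c y)) = (\<lambda>y. 2 * ((y - c) \<bullet> b) * \<phi>' (qd e c y))" for b
      by (rule radial_partial[OF assms(1,2)])
    then have "neg_laplacian (\<lambda>y. \<phi> (qd e c y)) y =
        - (\<Sum>b\<in>Basis. 2 * \<phi>' (qd e c y) + 4 * ((y - c) \<bullet> b)\<^sup>2 * \<phi>'' (qd e c y))"
      unfolding neg_laplacian_def using p2 by simp
    then show ?thesis unfolding s .
  qed
qed

section \<open>Iterated Laplacians of the smoothed logarithm\<close>

lemma has_derivative_inverse_power: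
  fixes t :: real
  assumes "t > 0"
  shows "((\<lambda>t. 1 / t ^ k) has_real_derivative - real k / t ^ Suc k) (at t)"
proof (cases k)
  case (Suc l)
  have "((\<lambda>t. inverse (t ^ Suc l)) has_real_derivative
      - (inverse (t ^ Suc l) * (real (Suc l) * t ^ (Suc l - Suc 0)) * inverse (t ^ Suc l))) (at t)"
    using assms by (intro DERIV_inverse' DERIV_pow) simp
  moreover have "- (inverse (t ^ Suc l) * (real (Suc l) * t ^ (Suc l - Suc 0)) * inverse (t ^ Suc l)) =
      - real k / t ^ Suc k"
    using assms by (simp add: Suc divide_simps)
  ultimately show ?thesis
    by (simp only: inverse_eq_divide Suc)
qed simp

text \<open>Coefficient of \<open>e ^ (2 * j) / qd e c y ^ (m + j)\<close> after \<open>m\<close>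
  applications of the operator in dimension \<open>2 * n\<close>: the closed form of the solution of
  the two recursions that follow, meant for \<open>m \<ge> 1\<close>.\<close>

definition bubble_coeff :: "nat \<Rightarrow> nat \<Rightarrow> nat \<Rightarrow> real" where
  "bubble_coeff n m j = 4 ^ m / 2 * real (m choose j) * fact (m + j - 1) * (\<Prod>i\<in>{Suc j..m}. real n - real i)"

lemma bubble_coeff_0:
  assumes "m \<ge> 1"
  shows "bubble_coeff n (Suc m) 0 = 4 * real m * (real n - real m - 1) * bubble_coeff n m 0"
proof -
  obtain k where k: "m = Suc k" using assms by (cases m) auto
  show ?thesis by (simp add: bubble_coeff_def k algebra_simps)
qed

text \<open>In dimension \<open>2 * n\<close> the operator maps \<open>q\<close> to the power
  \<open>-k\<close> to two terms: one of power \<open>-(k+1)\<close> with factor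
  \<open>4k(n-k-1)\<close>, and one of power \<open>-(k+2)\<close> with factor
  \<open>4k(k+1)\<close> times the square of \<open>e\<close>. The second term of index
  \<open>j\<close> and the first term of index \<open>j + 1\<close> meet in the same power.\<close>

lemma bubble_coeff_Suc:
  assumes "m \<ge> 1" "j \<le> m"
  shows "bubble_coeff n (Suc m) (Suc j) =
    4 * real (m + j + 1) * (real n - real m - real j - 2) * bubble_coeff n m (Suc j) +
    4 * real (m + j) * real (m + j + 1) * bubble_coeff n m j"
proof -
  obtain k where k: "m = Suc k" using assms by (cases m) auto
  have f: "fact (Suc m + Suc j - 1) = real (m + j + 1) * (real (m + j) * fact (m + j - 1))"
    "fact (m + Suc j - 1) = real (m + j) * fact (m + j - 1)"
    by (simp_all add: k algebra_simps)
  show ?thesis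
  proof (cases "j = m")
    case True
    show ?thesis unfolding bubble_coeff_def f by (simp add: True)
  next
    case False
    define F where "F = (\<Prod>i\<in>{Suc (Suc j)..m}. real n - real i)"
    have F1: "(\<Prod>i\<in>{Suc j..m}. real n - real i) = (real n - real j - 1) * F"
      using False assms by (simp add: prod.atLeast_Suc_atMost F_def)
    have F2: "(\<Prod>i\<in>{Suc (Suc j)..Suc m}. real n - real i) = F * (real n - real m - 1)"
      using False assms by (simp add: F_def)
    have "Suc j * (m choose Suc j) = (m - j) * (m choose j)"
      using binomial_absorb_comp[of m j] binomial_absorption[of j m] by simp
    then have "real (Suc j * (m choose Suc j)) = real ((m - j) * (m choose j))" by simp
    then have c: "(real j + 1) * real (m choose Suc j) = (real m - real j) * real (m choose j)"
      using assms(2) by (simp add: of_nat_diff distrib_right)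
    \<comment> \<open>After cancelling common factors, this is all that remains of the recursion:
      Pascal's rule on the left, the absorption identity \<open>c\<close> for the
      comparison.\<close>
    have "(real n - real m - 1) * (real (m choose j) + real (m choose Suc j)) =
      (real n - real m - real j - 2) * real (m choose Suc j) + (real n - real j - 1) * real (m choose j)"
      using c by (simp add: algebra_simps)
    moreover have gen: "4 * P / 2 * (C\<^sub>0 + C\<^sub>1) * (a * (b * f)) * (F * x) =
        4 * a * y * (P / 2 * C\<^sub>1 * (b * f) * F) + 4 * b * a * (P / 2 * C\<^sub>0 * f * (z * F))"
      if "x * (C\<^sub>0 + C\<^sub>1) = y * C\<^sub>1 + z * C\<^sub>0" for a b f x y z P C\<^sub>0 C\<^sub>1 :: real
    proof -
      have "4 * P / 2 * (C\<^sub>0 + C\<^sub>1) * (a * (b * f)) * (F * x) = 2 * P * a * b * f * F * (x * (C\<^sub>0 + C\<^sub>1))"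
        by simp
      then show ?thesis unfolding that by (simp add: algebra_simps)
    qed
    moreover have ch: "real (Suc m choose Suc j) = real (m choose j) + real (m choose Suc j)" by simp
    ultimately show ?thesis
      unfolding bubble_coeff_def f F1 F2 F_def[symmetric] power_Suc ch by blast
  qed
qed

lemma neg_laplacian_iter_log:
  fixes c :: "'a::euclidean_space"
  assumes "e > 0" "DIM('a) = 2 * n" "m \<ge> 1"
  shows "(neg_laplacian ^^ m) (\<lambda>y. - (1 / 2) * ln (qd e c y)) =
    (\<lambda>y. \<Sum>j\<le>m. bubble_coeff n m j * e ^ (2 * j) / qd e c y ^ (m + j))"
  using assms(3)
proof (induction m rule: nat_induct_at_least)
  case base
  have "neg_laplacian (\<lambda>y. - (1 / 2) * ln (qd e c y)) = (\<lambda>y. - (2 * real DIM('a) * (- (1 / 2) / qd e c y)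
     + 4 * (qd e c y - e\<^sup>2) * ((1 / 2) / (qd e c y)\<^sup>2)))"
    by (rule neg_laplacian_radial[OF assms(1)])
      (auto intro!: derivative_eq_intros simp: field_simps power2_eq_square)
  also have "\<dots> = (\<lambda>y. 2 * (real n - 1) / qd e c y + 2 * e\<^sup>2 / (qd e c y)\<^sup>2)"
  proof
    fix y
    have "- (2 * (2 * N) * (- (1 / 2) / q) + 4 * (q - e\<^sup>2) * ((1 / 2) / q\<^sup>2)) = 2 * (N - 1) / q + 2 * e\<^sup>2 / q\<^sup>2"
      if "q > 0" for q N
      using that by (simp add: field_simps power2_eq_square)
    from this[OF qd_pos[OF assms(1)]]
    show "- (2 * real DIM('a) * (- (1 / 2) / qd e c y) + 4 * (qd e c y - e\<^sup>2) * ((1 / 2) / (qd e c y)\<^sup>2)) =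
        2 * (real n - 1) / qd e c y + 2 * e\<^sup>2 / (qd e c y)\<^sup>2"
      unfolding assms(2) of_nat_mult of_nat_numeral .
  qed
  finally show ?case
    by (simp add: bubble_coeff_def power2_eq_square)
next
  case (Suc m)
  let ?B = "bubble_coeff n"
  have d: "((\<lambda>t. \<Sum>j\<le>m. b j / t ^ q j) has_real_derivative (\<Sum>j\<le>m. - (b j * real (q j)) / t ^ Suc (q j))) (at t)"
    if "t > 0" for t :: real and b q
  proof -
    have "((\<lambda>t. \<Sum>j\<le>m. b j * (1 / t ^ q j)) has_real_derivative (\<Sum>j\<le>m. b j * (- real (q j) / t ^ Suc (q j)))) (at t)"
      using that by (intro DERIV_sum DERIV_cmult has_derivative_inverse_power)
    then show ?thesis by (simp del: power_Suc)
  qed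
  have d1: "((\<lambda>t. \<Sum>j\<le>m. ?B m j * e ^ (2 * j) / t ^ (m + j)) has_real_derivative
      (\<Sum>j\<le>m. - (?B m j * e ^ (2 * j) * real (m + j)) / t ^ Suc (m + j))) (at t)" if "t > 0" for t
    using d[OF that, of "\<lambda>j. ?B m j * e ^ (2 * j)" "\<lambda>j. m + j"] .
  have d2: "((\<lambda>t. \<Sum>j\<le>m. - (?B m j * e ^ (2 * j) * real (m + j)) / t ^ Suc (m + j)) has_real_derivative
      (\<Sum>j\<le>m. - (- (?B m j * e ^ (2 * j) * real (m + j)) * real (Suc (m + j))) / t ^ Suc (Suc (m + j)))) (at t)" if "t > 0" for t
    using d[OF that, of "\<lambda>j. - (?B m j * e ^ (2 * j) * real (m + j))" "\<lambda>j. Suc (m + j)"] .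
  have alg: "- (2 * real (2 * n) * (\<Sum>j\<le>m. - (?B m j * e ^ (2 * j) * real (m + j)) / t ^ Suc (m + j)) +
      4 * (t - e\<^sup>2) * (\<Sum>j\<le>m. - (- (?B m j * e ^ (2 * j) * real (m + j)) * real (Suc (m + j))) / t ^ Suc (Suc (m + j))))
    = (\<Sum>j\<le>Suc m. ?B (Suc m) j * e ^ (2 * j) / t ^ (Suc m + j))" (is "?L = ?R") if t: "t > 0" for t
  proof -
    \<comment> \<open>\<open>g\<close> and \<open>h\<close> are the two terms into which the
      operator splits the summand of index \<open>j\<close>; \<open>h j\<close> carries one more
      factor \<open>e\<^sup>2\<close> and hence belongs to index \<open>j + 1\<close>.\<close>
    define g where "g j = 4 * real (m + j) * (real n - real m - real j - 1) * ?B m j * e ^ (2 * j) / t ^ (Suc m + j)" for j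
    define h where "h j = 4 * real (m + j) * real (m + j + 1) * ?B m j * e ^ (2 * Suc j) / t ^ (Suc m + Suc j)" for j
    have "?L = (\<Sum>j\<le>m. g j + h j)"
      unfolding sum_distrib_left sum.distrib[symmetric] sum_negf[symmetric]
    proof (rule sum.cong[OF refl])
      fix j
      have *: "- (2 * (2 * N) * (- (b * E * M) / T) + 4 * (t - e\<^sup>2) * (b * E * M * (M + 1) / (t * T))) =
          4 * M * (N - M - 1) * b * E / T + 4 * M * (M + 1) * b * (E * e\<^sup>2) / (t * T)"
        if "T > 0" for N b E M T
        using t that by (simp add: field_simps)
      show "- (2 * real (2 * n) * (- (?B m j * e ^ (2 * j) * real (m + j)) / t ^ Suc (m + j)) +
          4 * (t - e\<^sup>2) * (- (- (?B m j * e ^ (2 * j) * real (m + j)) * real (Suc (m + j))) / t ^ Suc (Suc (m + j)))) = g j + h j"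
        using *[of "t ^ Suc (m + j)" "real n" "?B m j" "e ^ (2 * j)" "real (m + j)"] t
        by (simp add: g_def h_def power2_eq_square power_add mult_ac add_ac diff_diff_eq)
    qed
    \<comment> \<open>The added term \<open>g (Suc m)\<close> is zero, since
      \<open>m choose Suc m\<close> is; it makes the shift of the index uniform.\<close>
    also have "\<dots> = (\<Sum>j\<le>Suc m. g j) + (\<Sum>j\<le>m. h j)"
      by (simp add: sum.distrib g_def bubble_coeff_def)
    also have "\<dots> = g 0 + (\<Sum>j\<le>m. g (Suc j) + h j)"
      by (simp only: sum.atMost_Suc_shift sum.distrib add.assoc)
    also have "\<dots> = ?R"
      unfolding sum.atMost_Suc_shift
    proof (intro arg_cong2[where f = "(+)"] sum.cong refl)
      show "g 0 = ?B (Suc m) 0 * e ^ (2 * 0) / t ^ (Suc m + 0)"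
        using Suc.hyps by (simp add: g_def bubble_coeff_0)
      fix j assume "j \<in> {..m}"
      then show "g (Suc j) + h j = ?B (Suc m) (Suc j) * e ^ (2 * Suc j) / t ^ (Suc m + Suc j)"
      proof -
        have *: "real (m + Suc j) = real (m + j + 1)"
          "real n - real m - real (Suc j) - 1 = real n - real m - real j - 2" by simp_all
        assume "j \<in> {..m}"
        then have "j \<le> m" by simp
        show ?thesis
          unfolding g_def h_def * bubble_coeff_Suc[OF Suc.hyps \<open>j \<le> m\<close>] distrib_right add_divide_distrib ..
      qed
    qed
    finally show ?thesis .
  qed
  have "(neg_laplacian ^^ Suc m) (\<lambda>y. - (1 / 2) * ln (qd e c y)) =
      neg_laplacian (\<lambda>y. \<Sum>j\<le>m. bubble_coeff n m j * e ^ (2 * j) / qd e c y ^ (m + j))"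
    using Suc.IH by simp
  also have "\<dots> = (\<lambda>y. \<Sum>j\<le>Suc m. ?B (Suc m) j * e ^ (2 * j) / qd e c y ^ (Suc m + j))"
    using neg_laplacian_radial[OF assms(1) d1 d2, of c, unfolded assms(2)]
    unfolding alg[OF qd_pos[OF assms(1)]] .
  finally show ?case .
qed

text \<open>In dimension \<open>2 * n\<close> the factor \<open>i = n\<close> kills every coefficient of the \<open>n\<close>-th iterate but the last.\<close>

lemma neg_laplacian_log_bubble:
  fixes c :: "'a::euclidean_space"
  assumes "e > 0" "DIM('a) = 2 * n" "n \<ge> 1"
  shows "(neg_laplacian ^^ n) (\<lambda>y. - (1 / 2) * ln (qd e c y)) =
    (\<lambda>y. 4 ^ n / 2 * fact (2 * n - 1) * e ^ (2 * n) / qd e c y ^ (2 * n))"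
proof -
  have z: "bubble_coeff n n j = 0" if "j < n" for j
    using that by (auto simp: bubble_coeff_def intro!: bexI[of _ n])
  have "(\<Sum>j\<le>n. bubble_coeff n n j * e ^ (2 * j) / q ^ (n + j)) =
      4 ^ n / 2 * fact (2 * n - 1) * e ^ (2 * n) / q ^ (2 * n)" for q
  proof -
    have "(\<Sum>j\<le>n. bubble_coeff n n j * e ^ (2 * j) / q ^ (n + j)) =
        (\<Sum>j\<in>{n}. bubble_coeff n n j * e ^ (2 * j) / q ^ (n + j))"
    proof (rule sum.mono_neutral_right)
      show "\<forall>j\<in>{..n} - {n}. bubble_coeff n n j * e ^ (2 * j) / q ^ (n + j) = 0"
      proof
        fix j assume "j \<in> {..n} - {n}"
        then have "j < n" by auto
        then show "bubble_coeff n n j * e ^ (2 * j) / q ^ (n + j) = 0"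
          by (simp only: z mult_zero_left div_0)
      qed
    qed simp_all
    then show ?thesis by (simp add: bubble_coeff_def flip: mult_2)
  qed
  then show ?thesis
    unfolding neg_laplacian_iter_log[OF assms] by simp
qed

section \<open>Orders of the smoothed kernels\<close>

lemma order_inverse_qd:
  assumes "e > 0"
  shows "order_le (- 2) (\<lambda>i y. 1 / qd e c y)"
proof -
  \<comment> \<open>Chosen so that \<open>1 + norm y\<close> is at most
    \<open>M + norm (y - c)\<close>; squaring with the factor 2 then produces the constant
    below.\<close>
  define M where "M = 1 + norm c"
  have "1 / qd e c y \<le> (2 * M\<^sup>2 / e\<^sup>2 + 2) * (1 + norm y) powr (- 2)" for y
  proof -
    have "1 + norm y \<le> M + norm (y - c)" unfolding M_def by norm
    then have "(1 + norm y)\<^sup>2 \<le> (M + norm (y - c))\<^sup>2" by (intro power_mono) auto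
    also have "\<dots> \<le> 2 * M\<^sup>2 + 2 * (norm (y - c))\<^sup>2"
      using zero_le_power2[of "M - norm (y - c)"] by (simp add: power2_sum power2_diff)
    also have "\<dots> \<le> (2 * M\<^sup>2 / e\<^sup>2 + 2) * qd e c y"
      using assms by (simp add: qd_def field_simps)
    finally have "(1 + norm y)\<^sup>2 \<le> (2 * M\<^sup>2 / e\<^sup>2 + 2) * qd e c y" .
    moreover have "(1 + norm y) powr (- 2) = 1 / (1 + norm y)\<^sup>2"
    proof -
      have *: "x powr (- 2) = 1 / x\<^sup>2" if "x > 0" for x :: real
        using that by (simp add: powr_minus powr_numeral inverse_eq_divide)
      show ?thesis by (rule *) (simp add: add_pos_nonneg)
    qed
    moreover have "(1 + norm y)\<^sup>2 > 0" by (intro zero_less_power add_pos_nonneg) auto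
    ultimately show ?thesis
      using qd_pos[OF assms, of c y] by (simp add: divide_le_eq le_divide_eq pos_divide_le_eq pos_le_divide_eq mult_ac)
  qed
  then show ?thesis
    unfolding order_le_def using qd_pos[OF assms, of c]
    by (intro exI[of _ "2 * M\<^sup>2 / e\<^sup>2 + 2"]) (simp add: less_imp_le)
qed

lemma inverse_qd_derivative:
  fixes t :: real shows "t > 0 \<Longrightarrow> ((\<lambda>t. 1 / t) has_real_derivative - (1 / t * (1 / t))) (at t)"
  by (auto intro!: derivative_eq_intros simp: field_simps power2_eq_square)

lemma inverse_qd_partial:
  "e > 0 \<Longrightarrow> partial b (\<lambda>y. 1 / qd e c y) = (\<lambda>y. - 2 * ((y - c) \<bullet> b) * ((1 / qd e c y) * (1 / qd e c y)))"
  by (subst radial_partial[where \<phi> = "\<lambda>t. 1 / t", OF _ inverse_qd_derivative]) (auto simp: fun_eq_iff)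

text \<open>The derivative is a linear factor times the square of the function, of order
  \<open>1 - 2 - 2 = - 3\<close>. As the function recurs in its own derivative, the induction is on
  the number of controlled derivatives.\<close>

lemma symbol_inverse_qd:
  assumes "e > 0"
  shows "symbol (- 2) (\<lambda>i y. 1 / qd e c y)"
  unfolding symbol_def
proof
  fix k
  note d = radial_differentiable[where \<phi> = "\<lambda>t. 1 / t", OF assms inverse_qd_derivative, of c]
  show "symbol_k k (- 2) (\<lambda>i y. 1 / qd e c y)"
  proof (induction k)
    case 0
    then show ?case by (auto intro!: order_inverse_qd[OF assms] differentiable_imp_continuous_on d)
  next
    case (Suc k)
    have "symbol_k k (- 2 - 1) (\<lambda>i. partial b (\<lambda>y. 1 / qd e c y))" for b
    proof -
      have "symbol_k k (1 + (- 2 + - 2)) (\<lambda>i y. - 2 * ((y - c) \<bullet> b) * ((1 / qd e c y) * (1 / qd e c y)))"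
        using symbol_cmult[OF symbol_inner, of "-2" c b]
        by (intro symbol_k_mult Suc.IH) (auto simp: symbol_def)
      then have "symbol_k k (- 3) (\<lambda>i y. - 2 * ((y - c) \<bullet> b) * ((1 / qd e c y) * (1 / qd e c y)))" by simp
      then show ?thesis
        unfolding inverse_qd_partial[OF assms] by simp
    qed
    then show ?case using d order_inverse_qd[OF assms] by simp
  qed
qed

lemma log_qd_derivative:
  fixes t :: real shows "t > 0 \<Longrightarrow> ((\<lambda>t. - (1 / 2) * ln t) has_real_derivative - (1 / 2) * (1 / t)) (at t)"
  by (auto intro!: derivative_eq_intros simp: field_simps)

lemma log_qd_partial:
  "e > 0 \<Longrightarrow> partial b (\<lambda>y. - (1 / 2) * ln (qd e c y)) = (\<lambda>y. - 1 * ((y - c) \<bullet> b) * (1 / qd e c y))"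
  by (subst radial_partial[OF _ log_qd_derivative]) (auto simp: fun_eq_iff)

text \<open>The bound of order 1 is crude, since the growth is logarithmic, but it is enough to make
  the operator linear on such functions. The derivatives are really of order -1.\<close>

lemma symbol_log_qd:
  assumes "e > 0"
  shows "symbol 1 (\<lambda>i y. - (1 / 2) * ln (qd e c y))"
proof (rule symbolI)
  have "\<bar>- (1 / 2) * ln (qd e c y)\<bar> \<le> (\<bar>ln e\<bar> + e + norm c + 1) * (1 + norm y) powr 1" for y
  proof -
    have "qd e c y \<le> (e + norm (y - c))\<^sup>2" using assms by (simp add: qd_def power2_sum)
    then have "ln (qd e c y) \<le> ln ((e + norm (y - c))\<^sup>2)"
      using qd_pos[OF assms, of c y] by (intro ln_mono) auto
    also have "\<dots> = 2 * ln (e + norm (y - c))"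
      using assms by (simp add: ln_realpow add_pos_nonneg)
    also have "\<dots> \<le> 2 * (e + norm (y - c))"
      using assms ln_le_minus_one[of "e + norm (y - c)"] by (simp add: add_pos_nonneg)
    also have "\<dots> \<le> 2 * (e + norm c + norm y)" by norm
    finally have 1: "ln (qd e c y) \<le> 2 * (e + norm c + norm y)" .
    have "2 * ln e = ln (e\<^sup>2)" using assms by (simp add: ln_realpow)
    also have "\<dots> \<le> ln (qd e c y)" using assms by (intro ln_mono) (auto simp: qd_def qd_pos add_pos_nonneg)
    finally have 2: "2 * ln e \<le> ln (qd e c y)" .
    have "\<bar>- (1 / 2) * L\<bar> \<le> \<bar>l\<bar> + e + p + q"
      if "L \<le> 2 * (e + p + q)" "2 * l \<le> L" "p \<ge> 0" "q \<ge> 0" for L l p q :: real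
      using that assms by (auto simp: abs_if)
    from this[OF 1 2 norm_ge_zero norm_ge_zero] have "\<bar>- (1 / 2) * ln (qd e c y)\<bar> \<le> \<bar>ln e\<bar> + e + norm c + norm y" .
    also have "\<dots> \<le> (\<bar>ln e\<bar> + e + norm c + 1) * (1 + norm y)"
      using assms by (simp add: algebra_simps)
    finally show ?thesis by simp
  qed
  then show "order_le 1 (\<lambda>i y. - (1 / 2) * ln (qd e c y))"
    unfolding order_le_def by blast
  show "(\<lambda>y. - (1 / 2) * ln (qd e c y)) differentiable_on UNIV"
    by (rule radial_differentiable[OF assms log_qd_derivative])
  fix b
  have "symbol (1 + - 2) (\<lambda>i y. - 1 * ((y - c) \<bullet> b) * (1 / qd e c y))"
    by (intro symbol_mult symbol_cmult symbol_inner symbol_inverse_qd[OF assms])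
  then show "symbol (1 - 1) (\<lambda>i. partial b (\<lambda>y. - (1 / 2) * ln (qd e c y)))"
    unfolding log_qd_partial[OF assms] by (rule symbol_mono) simp
qed

text \<open>The quadratic terms cancel. An affine numerator, of order 1 instead of 2, is the whole
  source of the decay of the difference of logarithms.\<close>

lemma qd_diff: "qd e 0 y - qd e c y = 2 * ((y - 0) \<bullet> c) + - (c \<bullet> c)"
  by (simp add: qd_def power2_norm_eq_inner algebra_simps inner_commute)

text \<open>The logarithms alone only form a symbol of order \<open>1\<close>; the order \<open>- 1\<close> of the
  difference is what makes the errors caused by the cutoff vanish.\<close>

lemma symbol_log_diff:
  fixes c :: "'a::euclidean_space"
  assumes "e > 0"
  shows "symbol (- 1) (\<lambda>i y. - (1 / 2) * ln (qd e c y) + 1 / 2 * ln (qd e 0 y))"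
proof (rule symbolI)
  have s: "symbol 1 (\<lambda>i y. 2 * ((y - 0) \<bullet> c) + - (c \<bullet> c))"
    by (intro symbol_add symbol_cmult symbol_inner symbol_mono[OF symbol_const]) simp
  have *: "order_le (- 1) (\<lambda>i y. (qd e 0 y - qd e c y) * (1 / qd e d y))" for d
    using order_le_mult[OF symbol_order[OF s] order_inverse_qd[OF assms, of d]]
    unfolding qd_diff by simp
  obtain A where A: "\<And>y. \<bar>(qd e 0 y - qd e c y) * (1 / qd e c y)\<bar> \<le> A * (1 + norm y) powr (- 1)"
    using *[of c] unfolding order_le_def by blast
  obtain B where B: "\<And>y. \<bar>(qd e 0 y - qd e c y) * (1 / qd e 0 y)\<bar> \<le> B * (1 + norm y) powr (- 1)"
    using *[of 0] unfolding order_le_def by blast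
  have "\<bar>- (1 / 2) * ln (qd e c y) + 1 / 2 * ln (qd e 0 y)\<bar> \<le> (A + B) * (1 + norm y) powr (- 1)" for y
  proof -
    let ?a = "qd e 0 y" and ?b = "qd e c y"
    have p: "?a > 0" "?b > 0" using qd_pos[OF assms] by auto
    \<comment> \<open>The tangent inequality for the logarithm in both directions; each right-hand
      side is an affine function over a quadratic one.\<close>
    have "ln ?a - ln ?b \<le> (?a - ?b) * (1 / ?b)" "ln ?b - ln ?a \<le> (?b - ?a) * (1 / ?a)"
      using ln_diff_le[OF p] ln_diff_le[OF p(2,1)] by simp_all
    then have "\<bar>ln ?a - ln ?b\<bar> \<le> \<bar>(?a - ?b) * (1 / ?b)\<bar> + \<bar>(?a - ?b) * (1 / ?a)\<bar>"
      by (simp add: abs_mult algebra_simps)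
    then show ?thesis using A[of y] B[of y] unfolding distrib_right by linarith
  qed
  then show "order_le (- 1) (\<lambda>i y. - (1 / 2) * ln (qd e c y) + 1 / 2 * ln (qd e 0 y))"
    unfolding order_le_def by blast
  have L: "(\<lambda>y. - (1 / 2) * ln (qd e c y)) differentiable_on UNIV" for c :: 'a
    by (rule radial_differentiable[OF assms log_qd_derivative])
  have L0: "(\<lambda>y::'a. 1 / 2 * ln (qd e 0 y)) differentiable_on UNIV"
    using differentiable_on_minus[OF L[of 0]] by simp
  show "(\<lambda>y. - (1 / 2) * ln (qd e c y) + 1 / 2 * ln (qd e 0 y)) differentiable_on UNIV"
    by (intro differentiable_on_add L L0)
  fix b
  have p0: "partial b (\<lambda>y::'a. 1 / 2 * ln (qd e 0 y)) = (\<lambda>y. ((y - 0) \<bullet> b) * (1 / qd e 0 y))"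
    by (subst radial_partial[OF assms, where \<phi> = "\<lambda>t. 1 / 2 * ln t" and \<phi>' = "\<lambda>t. 1 / 2 * (1 / t)"])
      (auto intro!: derivative_eq_intros simp: fun_eq_iff field_simps)
  have "symbol (- 2) (\<lambda>i y. (c \<bullet> b) * (1 / qd e c y) +
      - 1 * (((y - 0) \<bullet> b) * ((2 * ((y - 0) \<bullet> c) + - (c \<bullet> c)) * ((1 / qd e c y) * (1 / qd e 0 y)))))"
    using symbol_mult[OF symbol_inner[where c = 0 and b = b] symbol_mult[OF s symbol_mult[OF
            symbol_inverse_qd[OF assms, of c] symbol_inverse_qd[OF assms, of 0]]]]
    by (intro symbol_add symbol_cmult symbol_inverse_qd[OF assms]) simp
  also have "(\<lambda>i y. (c \<bullet> b) * (1 / qd e c y) +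
      - 1 * (((y - 0) \<bullet> b) * ((2 * ((y - 0) \<bullet> c) + - (c \<bullet> c)) * ((1 / qd e c y) * (1 / qd e 0 y)))))
     = (\<lambda>i y. - 1 * ((y - c) \<bullet> b) * (1 / qd e c y) + ((y - 0) \<bullet> b) * (1 / qd e 0 y))"
  proof (intro ext)
    fix y
    have p: "qd e 0 y > 0" "qd e c y > 0" using qd_pos[OF assms] by auto
    show "(c \<bullet> b) * (1 / qd e c y) +
      - 1 * (((y - 0) \<bullet> b) * ((2 * ((y - 0) \<bullet> c) + - (c \<bullet> c)) * ((1 / qd e c y) * (1 / qd e 0 y))))
     = - 1 * ((y - c) \<bullet> b) * (1 / qd e c y) + ((y - 0) \<bullet> b) * (1 / qd e 0 y)"
    proof -
      \<comment> \<open>Each gradient alone has order -1. Over a common denominator the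
        \<open>y\<close> parts leave a linear factor times an affine numerator over two quadratics,
        of order -2.\<close>
      have "(qd e 0 y - qd e c y) * ((1 / qd e c y) * (1 / qd e 0 y)) = 1 / qd e c y - 1 / qd e 0 y"
        using p by (simp add: field_simps)
      then show ?thesis
        unfolding qd_diff[symmetric, where e = e] by (simp only:) (simp add: algebra_simps inner_diff_left diff_divide_distrib)
    qed
  qed
  finally show "symbol (- 1 - 1) (\<lambda>i. partial b (\<lambda>y. - (1 / 2) * ln (qd e c y) + 1 / 2 * ln (qd e 0 y)))"
    unfolding partial_add[OF L L0] log_qd_partial[OF assms] p0 by simp
qed

section \<open>Explicit integrals\<close>

text \<open>The integral factorises over coordinates, and each factor is the normalisation of a
  normal density with variance \<open>1 / (2 * t)\<close>.\<close>

lemma nn_integral_gaussian: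
  assumes "t > 0"
  shows "(\<integral>\<^sup>+ (y::'a::euclidean_space). ennreal (exp (- t * (norm y)\<^sup>2)) \<partial>lborel)
     = ennreal ((pi / t) powr (real DIM('a) / 2))"
proof -
  have one: "(\<integral>\<^sup>+ (x::real). ennreal (exp (- t * x\<^sup>2)) \<partial>lborel) = ennreal (sqrt (pi / t))"
  proof -
    define \<sigma> where "\<sigma> = sqrt (1 / (2 * t))"
    have \<sigma>: "\<sigma> > 0" "\<sigma>\<^sup>2 = 1 / (2 * t)" using assms by (auto simp: \<sigma>_def)
    interpret prob_space "density lborel (normal_density 0 \<sigma>)"
      by (rule prob_space_normal_density[OF \<sigma>(1)])
    have dens: "normal_density 0 \<sigma> x = 1 / sqrt (pi / t) * exp (- t * x\<^sup>2)" for x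
      unfolding normal_density_def \<sigma>(2) using assms by (simp add: field_simps)
    have "(\<integral>\<^sup>+ x. ennreal (normal_density 0 \<sigma> x) \<partial>lborel) = 1"
      using emeasure_space_1 by (simp add: emeasure_density)
    then have *: "ennreal (1 / sqrt (pi / t)) * (\<integral>\<^sup>+ x. ennreal (exp (- t * x\<^sup>2)) \<partial>lborel) = 1"
      unfolding dens by (subst (asm) ennreal_mult) (auto simp: nn_integral_cmult assms less_imp_le)
    have "(\<integral>\<^sup>+ x. ennreal (exp (- t * x\<^sup>2)) \<partial>lborel)
        = ennreal (sqrt (pi / t)) * (ennreal (1 / sqrt (pi / t)) * (\<integral>\<^sup>+ x. ennreal (exp (- t * x\<^sup>2)) \<partial>lborel))"
      unfolding mult.assoc[symmetric] using assms by (subst ennreal_mult[symmetric]) (auto simp: less_imp_le)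
    then show ?thesis unfolding * by simp
  qed
  have "(\<integral>\<^sup>+ (y::'a). ennreal (exp (- t * (norm y)\<^sup>2)) \<partial>lborel)
      = (\<integral>\<^sup>+ (y::'a). (\<Prod>b\<in>Basis. ennreal (exp (- t * (y \<bullet> b)\<^sup>2))) \<partial>lborel)"
  proof (rule nn_integral_cong)
    fix y :: 'a
    have "exp (- t * (norm y)\<^sup>2) = (\<Prod>b\<in>Basis. exp (- t * (y \<bullet> b)\<^sup>2))"
    proof -
      have "(norm y)\<^sup>2 = (\<Sum>b\<in>Basis. (y \<bullet> b)\<^sup>2)"
        unfolding power2_norm_eq_inner by (subst euclidean_inner) (simp add: power2_eq_square)
      then show ?thesis by (simp add: exp_sum[symmetric] sum_negf sum_distrib_left)
    qed
    then show "ennreal (exp (- t * (norm y)\<^sup>2)) = (\<Prod>b\<in>Basis. ennreal (exp (- t * (y \<bullet> b)\<^sup>2)))"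
      by (simp add: prod_ennreal)
  qed
  also have "\<dots> = (\<Prod>b\<in>(Basis::'a set). \<integral>\<^sup>+ x. ennreal (exp (- t * x\<^sup>2)) \<partial>lborel)"
    by (subst nn_integral_lborel_prod) auto
  also have "\<dots> = ennreal (sqrt (pi / t) ^ DIM('a))"
    using assms unfolding one by (simp add: ennreal_power less_imp_le)
  also have "sqrt (pi / t) ^ DIM('a) = (pi / t) powr (real DIM('a) / 2)"
    using assms by (simp add: powr_half_sqrt[symmetric] powr_realpow[symmetric] powr_powr)
  finally show ?thesis .
qed

lemma nn_integral_gamma_scaled:
  assumes "s > 0" "A > 0"
  shows "(\<integral>\<^sup>+ t. ennreal (indicator {0..} t * (t powr (s - 1) * exp (- A * t))) \<partial>lborel)
    = ennreal (Gamma s * A powr (- s))"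
proof -
  have G: "ennreal (Gamma s) = (\<integral>\<^sup>+ t. ennreal (indicator {0..} t * t powr (s - 1) / exp t) \<partial>lborel)"
    using Gamma_conv_nn_integral_real[OF assms(1)] .
  also have "\<dots> = ennreal A * (\<integral>\<^sup>+ t. ennreal (indicator {0..} (0 + A * t) * (0 + A * t) powr (s - 1) / exp (0 + A * t)) \<partial>lborel)"
    using assms by (subst nn_integral_real_affine[where c = A and t = 0]) auto
  also have "\<dots> = (\<integral>\<^sup>+ t. ennreal (A powr s) * ennreal (indicator {0..} t * (t powr (s - 1) * exp (- A * t))) \<partial>lborel)"
    using assms
    by (subst nn_integral_cmult[symmetric])
      (auto intro!: nn_integral_cong simp: ennreal_mult[symmetric] indicator_def zero_le_mult_iff
        powr_mult powr_diff exp_minus divide_inverse split: if_splits)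
  also have "\<dots> = ennreal (A powr s) * (\<integral>\<^sup>+ t. ennreal (indicator {0..} t * (t powr (s - 1) * exp (- A * t))) \<partial>lborel)"
    by (subst nn_integral_cmult) auto
  finally have *: "ennreal (Gamma s) = ennreal (A powr s) * (\<integral>\<^sup>+ t. ennreal (indicator {0..} t * (t powr (s - 1) * exp (- A * t))) \<partial>lborel)" .
  have "ennreal (A powr (- s)) * ennreal (A powr s) = 1"
    using assms by (simp add: ennreal_mult[symmetric] powr_add[symmetric])
  then have "(\<integral>\<^sup>+ t. ennreal (indicator {0..} t * (t powr (s - 1) * exp (- A * t))) \<partial>lborel)
     = ennreal (A powr (- s)) * ennreal (Gamma s)"
    unfolding * mult.assoc[symmetric] by simp
  then show ?thesis using assms by (simp add: ennreal_mult mult.commute)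
qed

text \<open>Write \<open>(1 + \<bar>y\<bar>\<^sup>2) powr (- s)\<close> as a Gamma integral over Gaussians and exchange the integrals.\<close>

lemma nn_integral_bracket_powr:
  assumes "s > real DIM('a) / 2"
  shows "(\<integral>\<^sup>+ (y::'a::euclidean_space). ennreal ((1 + (norm y)\<^sup>2) powr (- s)) \<partial>lborel)
    = ennreal (pi powr (real DIM('a) / 2) * Gamma (s - real DIM('a) / 2) / Gamma s)"
proof -
  let ?d = "real DIM('a) / 2"
  have s: "s > 0" using assms by (meson divide_nonneg_nonneg le_less_trans of_nat_0_le_iff zero_le_numeral)
  define g where "g t = indicator {0..} t * (t powr (s - 1) * exp (- 1 * t))" for t :: real
  have g0: "g t \<ge> 0" for t by (simp add: g_def)
  have gm[measurable]: "g \<in> borel_measurable borel" unfolding g_def by measurable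
  have "ennreal (Gamma s) * (\<integral>\<^sup>+ (y::'a). ennreal ((1 + (norm y)\<^sup>2) powr (- s)) \<partial>lborel)
      = (\<integral>\<^sup>+ (y::'a). ennreal (Gamma s * (1 + (norm y)\<^sup>2) powr (- s)) \<partial>lborel)"
    using s by (subst nn_integral_cmult[symmetric]) (auto simp: ennreal_mult)
  also have "\<dots> = (\<integral>\<^sup>+ (y::'a). \<integral>\<^sup>+ t. ennreal (g t) * ennreal (exp (- t * (norm y)\<^sup>2)) \<partial>lborel \<partial>lborel)"
  proof (rule nn_integral_cong)
    fix y :: 'a
    have "1 + (norm y)\<^sup>2 > 0" by (simp add: add_pos_nonneg)
    from nn_integral_gamma_scaled[OF s this]
    have "ennreal (Gamma s * (1 + (norm y)\<^sup>2) powr (- s)) =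
        (\<integral>\<^sup>+ t. ennreal (indicator {0..} t * (t powr (s - 1) * exp (- (1 + (norm y)\<^sup>2) * t))) \<partial>lborel)" by simp
    also have "\<dots> = (\<integral>\<^sup>+ t. ennreal (g t) * ennreal (exp (- t * (norm y)\<^sup>2)) \<partial>lborel)"
      by (intro nn_integral_cong) (simp add: ennreal_mult[symmetric] g_def exp_add[symmetric] algebra_simps)
    finally show "ennreal (Gamma s * (1 + (norm y)\<^sup>2) powr (- s)) =
        (\<integral>\<^sup>+ t. ennreal (g t) * ennreal (exp (- t * (norm y)\<^sup>2)) \<partial>lborel)" .
  qed
  also have "\<dots> = (\<integral>\<^sup>+ t. \<integral>\<^sup>+ (y::'a). ennreal (g t) * ennreal (exp (- t * (norm y)\<^sup>2)) \<partial>lborel \<partial>lborel)"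
    by (rule lborel_pair.Fubini'[symmetric]) measurable
  also have "\<dots> = (\<integral>\<^sup>+ t. ennreal (g t) * (\<integral>\<^sup>+ (y::'a). ennreal (exp (- t * (norm y)\<^sup>2)) \<partial>lborel) \<partial>lborel)"
    by (intro nn_integral_cong nn_integral_cmult) auto
  also have "\<dots> = (\<integral>\<^sup>+ t. ennreal (pi powr ?d) * ennreal (indicator {0..} t * (t powr (s - ?d - 1) * exp (- 1 * t))) \<partial>lborel)"
  proof (intro nn_integral_cong_AE)
    have "AE t in lborel. t \<noteq> (0::real)" by (rule AE_lborel_singleton)
    then show "AE t in lborel. ennreal (g t) * (\<integral>\<^sup>+ (y::'a). ennreal (exp (- t * (norm y)\<^sup>2)) \<partial>lborel) =
        ennreal (pi powr ?d) * ennreal (indicator {0..} t * (t powr (s - ?d - 1) * exp (- 1 * t)))"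
    proof eventually_elim
      case (elim t)
      show ?case
      proof (cases "t > 0")
        case True
        have "t powr (s - ?d - 1) = t powr (s - 1) / t powr ?d"
          using True by (simp add: powr_diff[symmetric] algebra_simps)
        then show ?thesis
          using True nn_integral_gaussian[OF True, where 'a = 'a]
          by (simp add: g_def ennreal_mult[symmetric] powr_divide mult_ac)
      next
        case False
        then show ?thesis using elim by (simp add: g_def)
      qed
    qed
  qed
  also have "\<dots> = ennreal (pi powr ?d) * ennreal (Gamma (s - ?d) * 1 powr - (s - ?d))"
    using nn_integral_gamma_scaled[of "s - ?d" 1] assms by (subst nn_integral_cmult) auto
  finally have *: "ennreal (Gamma s) * (\<integral>\<^sup>+ (y::'a). ennreal ((1 + (norm y)\<^sup>2) powr (- s)) \<partial>lborel)
    = ennreal (pi powr ?d * Gamma (s - ?d))"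
    using assms by (simp add: ennreal_mult)
  have "ennreal (1 / Gamma s) * ennreal (Gamma s) = 1"
  proof -
    have "Gamma s \<noteq> 0" using Gamma_real_pos[OF s] by linarith
    then show ?thesis
      using s by (subst ennreal_mult[symmetric]) (auto simp: less_imp_le)
  qed
  then have "(\<integral>\<^sup>+ (y::'a). ennreal ((1 + (norm y)\<^sup>2) powr (- s)) \<partial>lborel)
     = ennreal (1 / Gamma s) * ennreal (pi powr ?d * Gamma (s - ?d))"
    unfolding *[symmetric] mult.assoc[symmetric] by simp
  then show ?thesis using s assms by (simp add: ennreal_mult[symmetric])
qed

lemma integral_bracket_powr:
  assumes "s > real DIM('a) / 2"
  shows "integrable lborel (\<lambda>y::'a::euclidean_space. (1 + (norm y)\<^sup>2) powr (- s))"
    and "(LINT (y::'a)|lborel. (1 + (norm y)\<^sup>2) powr (- s))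
      = pi powr (real DIM('a) / 2) * Gamma (s - real DIM('a) / 2) / Gamma s"
proof -
  have s: "s > 0" using assms by (meson divide_nonneg_nonneg le_less_trans of_nat_0_le_iff zero_le_numeral)
  show *: "integrable lborel (\<lambda>y::'a::euclidean_space. (1 + (norm y)\<^sup>2) powr (- s))"
    using nn_integral_bracket_powr[OF assms] by (intro integrableI_nonneg) auto
  show "(LINT (y::'a)|lborel. (1 + (norm y)\<^sup>2) powr (- s))
      = pi powr (real DIM('a) / 2) * Gamma (s - real DIM('a) / 2) / Gamma s"
    using nn_integral_bracket_powr[OF assms] s assms
    by (subst integral_eq_nn_integral) (auto simp: enn2real_ennreal)
qed

lemma integrable_powr_decay:
  assumes "p > real DIM('a)"
  shows "integrable lborel (\<lambda>y::'a::euclidean_space. (1 + norm y) powr (- p))"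
proof (rule Bochner_Integration.integrable_bound[OF integral_bracket_powr(1)[of "p / 2"]])
  show "real DIM('a) / 2 < p / 2" using assms by simp
  show "AE y::'a in lborel. norm ((1 + norm y) powr (- p)) \<le> norm ((1 + (norm y)\<^sup>2) powr (- (p / 2)))"
  proof (intro AE_I2)
    fix y :: 'a
    have p: "p \<ge> 0" using assms by (meson le_less_trans less_imp_le of_nat_0_le_iff)
    have "(1 + norm y) powr (- p) = ((1 + norm y) powr 2) powr (- (p / 2))"
      by (subst powr_powr) simp
    also have "\<dots> \<le> (1 + (norm y)\<^sup>2) powr (- (p / 2))"
      using p by (intro powr_mono2') (auto simp: powr_numeral power2_sum add_pos_nonneg)
    finally show "norm ((1 + norm y) powr (- p)) \<le> norm ((1 + (norm y)\<^sup>2) powr (- (p / 2)))" by simp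
  qed
qed measurable

text \<open>The positive part of \<open>ln (r / \<bar>z\<bar>)\<close>, except at \<open>z = 0\<close>, where \<open>ln 0 = 0\<close> gives a finite junk value.\<close>

definition log_part :: "real \<Rightarrow> 'a::euclidean_space \<Rightarrow> real" where
  "log_part r z = max 0 (ln r - ln (norm z))"

lemma log_part_nonneg: "log_part r z \<ge> 0"
  by (simp add: log_part_def)

lemma log_part_measurable[measurable]: "log_part r \<in> borel_measurable borel"
  unfolding log_part_def by measurable

text \<open>Layer-cake formula over the balls \<open>{z. \<bar>z\<bar> < r e\<^sup>-\<^sup>t}\<close>.\<close>

lemma nn_integral_log_part:
  assumes "r > 0"
  shows "(\<integral>\<^sup>+ (z::'a::euclidean_space). ennreal (log_part r z) \<partial>lborel)
    = ennreal (unit_ball_vol (real DIM('a)) * r ^ DIM('a) / real DIM('a))"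
proof -
  let ?D = "real DIM('a)" and ?V = "unit_ball_vol (real DIM('a))"
  have "(\<integral>\<^sup>+ (z::'a). ennreal (log_part r z) \<partial>lborel)
     = (\<integral>\<^sup>+ (z::'a). \<integral>\<^sup>+ t. indicator {0..} t * indicator {z. norm z < r * exp (- t)} z \<partial>lborel \<partial>lborel)"
  proof (intro nn_integral_cong_AE)
    have "AE z in lborel. z \<noteq> (0::'a)" by (rule AE_lborel_singleton)
    then show "AE z::'a in lborel. ennreal (log_part r z) =
        (\<integral>\<^sup>+ t. indicator {0..} t * indicator {z. norm z < r * exp (- t)} z \<partial>lborel)"
    proof eventually_elim
      case (elim z)
      have "norm z < r * exp (- t) \<longleftrightarrow> t < ln r - ln (norm z)" for t
      proof -
        have "norm z < r * exp (- t) \<longleftrightarrow> ln (norm z) < ln (r * exp (- t))"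
          using elim assms by (intro ln_less_cancel_iff[symmetric]) auto
        also have "ln (r * exp (- t)) = ln r - t" using assms by (simp add: ln_mult)
        finally show ?thesis by auto
      qed
      then have "(\<integral>\<^sup>+ t. indicator {0..} t * indicator {z. norm z < r * exp (- t)} z \<partial>lborel)
          = (\<integral>\<^sup>+ t. indicator {0..<ln r - ln (norm z)} t \<partial>lborel)"
        by (intro nn_integral_cong) (auto simp: indicator_def)
      then show ?case by (simp add: log_part_def max_def ennreal_neg)
    qed
  qed
  also have "\<dots> = (\<integral>\<^sup>+ t. \<integral>\<^sup>+ (z::'a). indicator {0..} t * indicator {z. norm z < r * exp (- t)} z \<partial>lborel \<partial>lborel)"
    by (rule lborel_pair.Fubini'[symmetric]) measurable
  also have "\<dots> = (\<integral>\<^sup>+ t. ennreal (?V * r ^ DIM('a)) * ennreal (indicator {0..} t * (t powr (1 - 1) * exp (- ?D * t))) \<partial>lborel)"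
  proof (intro nn_integral_cong_AE)
    \<comment> \<open>\<open>0 powr 0\<close> is 0, so the two integrands disagree at
      \<open>t = 0\<close>.\<close>
    have "AE t in lborel. t \<noteq> (0::real)" by (rule AE_lborel_singleton)
    then show "AE t in lborel. (\<integral>\<^sup>+ (z::'a). indicator {0..} t * indicator {z. norm z < r * exp (- t)} z \<partial>lborel) =
      ennreal (?V * r ^ DIM('a)) * ennreal (indicator {0..} t * (t powr (1 - 1) * exp (- ?D * t)))"
    proof eventually_elim
      case (elim t)
      have "{z::'a. norm z < r * exp (- t)} = ball 0 (r * exp (- t))" by (auto simp: dist_norm)
      then have "(\<integral>\<^sup>+ (z::'a). indicator {0..} t * indicator {z. norm z < r * exp (- t)} z \<partial>lborel) =
          indicator {0..} t * emeasure lborel (ball (0::'a) (r * exp (- t)))"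
        by (simp add: nn_integral_cmult)
      also have "\<dots> = indicator {0..} t * ennreal (?V * (r * exp (- t)) ^ DIM('a))"
        using assms by (subst emeasure_ball) auto
      also have "(r * exp (- t)) ^ DIM('a) = r ^ DIM('a) * exp (- ?D * t)"
        by (simp add: power_mult_distrib exp_of_nat_mult[symmetric])
      finally show ?case
        using elim assms by (auto simp: indicator_def ennreal_mult[symmetric] mult_ac)
    qed
  qed
  also have "\<dots> = ennreal (?V * r ^ DIM('a)) * ennreal (Gamma 1 * ?D powr (- 1))"
    using nn_integral_gamma_scaled[of 1 "real DIM('a)"] by (subst nn_integral_cmult) auto
  also have "\<dots> = ennreal (?V * r ^ DIM('a) / ?D)"
    using assms by (simp add: ennreal_mult[symmetric] powr_minus divide_inverse)
  finally show ?thesis .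
qed

lemma integral_log_part:
  assumes "r > 0"
  shows "integrable lborel (log_part r :: 'a::euclidean_space \<Rightarrow> real)"
    and "(LINT (z::'a)|lborel. log_part r z) = unit_ball_vol (real DIM('a)) * r ^ DIM('a) / real DIM('a)"
proof -
  show *: "integrable lborel (log_part r :: 'a::euclidean_space \<Rightarrow> real)"
    using nn_integral_log_part[OF assms, where 'a = 'a]
    by (intro integrableI_nonneg) (auto simp: log_part_nonneg)
  show "(LINT (z::'a)|lborel. log_part r z) = unit_ball_vol (real DIM('a)) * r ^ DIM('a) / real DIM('a)"
    using nn_integral_log_part[OF assms, where 'a = 'a] assms
    by (subst integral_eq_nn_integral) (auto simp: log_part_nonneg enn2real_ennreal)
qed

section \<open>The representation formula\<close>

lemma integral_lborel_affine:
  fixes h :: "'a::euclidean_space \<Rightarrow> real"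
  assumes [measurable]: "h \<in> borel_measurable borel" and e: "e > 0"
  shows "(LINT y|lborel. h y) = e ^ DIM('a) * (LINT z|lborel. h (c + e *\<^sub>R z))"
  using e by (subst lborel_affine[of e c]) (simp_all add: integral_density integral_distr)

lemma integrable_lborel_affine:
  fixes h :: "'a::euclidean_space \<Rightarrow> real"
  assumes [measurable]: "h \<in> borel_measurable borel" and e: "e > 0"
    and i: "integrable lborel (\<lambda>z. h (c + e *\<^sub>R z))"
  shows "integrable lborel h"
  using e i by (subst lborel_affine[of e c]) (simp_all add: integrable_density integrable_distr_eq)

lemma integrable_lborel_shift:
  fixes h :: "'a::euclidean_space \<Rightarrow> real"
  assumes "integrable lborel h"
  shows "integrable lborel (\<lambda>y. h (y - x))"
proof -
  have [measurable]: "h \<in> borel_measurable borel"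
    using borel_measurable_integrable[OF assms] by simp
  have "integrable (distr lborel borel ((+) (- x))) h"
    using assms by (simp add: lborel_distr_plus)
  then show ?thesis by (simp add: integrable_distr_eq)
qed

text \<open>Dominated convergence is available along sequences only. The lower bound
  \<open>R\<close> on the norms keeps the logarithms of \<open>norm (X k)\<close> nonnegative, or
  bounded away from zero, for every \<open>k\<close>.\<close>

lemma tendsto_at_infinity_sequentiallyI:
  fixes g :: "'a::real_normed_vector \<Rightarrow> real"
  assumes "\<And>X. filterlim X at_infinity sequentially \<Longrightarrow> (\<And>k. R \<le> norm (X k)) \<Longrightarrow> (\<lambda>k. g (X k)) \<longlonglongrightarrow> L"
  shows "(g \<longlongrightarrow> L) at_infinity"
proof (rule ccontr)
  assume "\<not> ?thesis"
  then obtain e where e: "e > 0" "\<not> (\<exists>b. \<forall>x. b \<le> norm x \<longrightarrow> dist (g x) L < e)"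
    by (auto simp: tendsto_iff eventually_at_infinity)
  then have "\<forall>k. \<exists>x. max (real k) R \<le> norm x \<and> \<not> dist (g x) L < e" by blast
  then obtain X where "\<And>k. max (real k) R \<le> norm (X k)" "\<And>k. \<not> dist (g (X k)) L < e" by metis
  then have X: "\<And>k. real k \<le> norm (X k)" "\<And>k. R \<le> norm (X k)" "\<And>k. \<not> dist (g (X k)) L < e" by auto
  have "filterlim (\<lambda>k. norm (X k)) at_top sequentially"
    by (rule filterlim_at_top_mono[OF filterlim_real_sequentially]) (simp add: X)
  then have "(\<lambda>k. g (X k)) \<longlonglongrightarrow> L"
    by (intro assms X(2)) (simp add: filterlim_at_infinity_conv_norm_at_top)
  then have "eventually (\<lambda>k. dist (g (X k)) L < e) sequentially"
    using e(1) by (simp add: tendsto_iff)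
  then show False using X(3) by (auto simp: eventually_sequentially)
qed

section \<open>Bounds for the logarithmic kernel\<close>

lemma ln_diff_le_add:
  assumes "0 < p" "0 < q" "0 \<le> a" "p \<le> q + a"
  shows "ln p - ln q \<le> ln (1 + a) + max 0 (ln 1 - ln (q::real))"
proof (cases "q \<ge> 1")
  case True
  \<comment> \<open>For \<open>q \<ge> 1\<close> the sum \<open>q + a\<close> is at most
    \<open>q * (1 + a)\<close>; for smaller \<open>q\<close> one has \<open>p \<le> 1 + a\<close>,
    and the last term of the claim, which has the shape of \<open>log_part 1\<close>, absorbs
    \<open>- ln q\<close>.\<close>
  have "a * 1 \<le> a * q" using assms True by (intro mult_left_mono) auto
  then have "p \<le> q * (1 + a)" using assms(4) by (simp add: algebra_simps)
  then have "ln p \<le> ln (q * (1 + a))" using assms by (intro ln_mono) auto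
  then show ?thesis using assms by (simp add: ln_mult)
next
  case False
  have "ln p \<le> ln (1 + a)" using assms False by (intro ln_mono) auto
  then show ?thesis by simp
qed

lemma abs_ln_norm_diff_le:
  fixes x y :: "'a::euclidean_space"
  assumes "y \<noteq> 0" "y \<noteq> x"
  shows "\<bar>ln (norm y) - ln (norm (y - x))\<bar> \<le> ln (1 + norm x) + log_part 1 y + log_part 1 (y - x)"
proof -
  have p: "norm y > 0" "norm (y - x) > 0" using assms by auto
  have "norm y \<le> norm (y - x) + norm x" "norm (y - x) \<le> norm y + norm x" by norm+
  from ln_diff_le_add[OF p norm_ge_zero this(1)] ln_diff_le_add[OF p(2,1) norm_ge_zero this(2)]
  show ?thesis
    unfolding abs_le_iff log_part_def
    using max.cobounded1[of 0 "ln 1 - ln (norm y)"] max.cobounded1[of 0 "ln 1 - ln (norm (y - x))"] by linarith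
qed

text \<open>Adding the same positive number to both squares moves their ratio towards 1. Hence the
  smoothed kernels are dominated by the singular one for all \<open>e\<close> at once.\<close>

lemma abs_log_qd_diff_le:
  assumes "y \<noteq> 0" "y \<noteq> x" "e > 0"
  shows "\<bar>- (1 / 2) * ln (qd e x y) + 1 / 2 * ln (qd e 0 y)\<bar> \<le> \<bar>ln (norm y) - ln (norm (y - x))\<bar>"
proof -
  have *: "\<bar>ln (e\<^sup>2 + p\<^sup>2) - ln (e\<^sup>2 + q\<^sup>2)\<bar> \<le> 2 * \<bar>ln p - ln q\<bar>" if "0 < q" "q \<le> p" for p q :: real
  proof -
    have p: "0 < p" using that by simp
    have "q\<^sup>2 \<le> p\<^sup>2" using that by (intro power_mono) auto
    then have "ln (e\<^sup>2 + q\<^sup>2) \<le> ln (e\<^sup>2 + p\<^sup>2)" using assms(3) by (intro ln_mono) (auto intro: add_pos_nonneg)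
    moreover have "ln q \<le> ln p" using that p by simp
    moreover have "ln (e\<^sup>2 + p\<^sup>2) + 2 * ln q \<le> ln (e\<^sup>2 + q\<^sup>2) + 2 * ln p"
    proof -
      have "(e\<^sup>2 + p\<^sup>2) * q\<^sup>2 \<le> (e\<^sup>2 + q\<^sup>2) * p\<^sup>2"
        using \<open>q\<^sup>2 \<le> p\<^sup>2\<close> mult_left_mono[of "q\<^sup>2" "p\<^sup>2" "e\<^sup>2"] by (simp add: algebra_simps)
      then have "ln ((e\<^sup>2 + p\<^sup>2) * q\<^sup>2) \<le> ln ((e\<^sup>2 + q\<^sup>2) * p\<^sup>2)"
        using assms(3) that p by (intro ln_mono mult_pos_pos add_pos_pos) auto
      then show ?thesis
        using assms(3) that p by (simp add: ln_mult ln_realpow add_pos_pos)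
    qed
    ultimately show ?thesis by simp
  qed
  have p: "norm y > 0" "norm (y - x) > 0" using assms by auto
  have "\<bar>ln (e\<^sup>2 + (norm y)\<^sup>2) - ln (e\<^sup>2 + (norm (y - x))\<^sup>2)\<bar> \<le> 2 * \<bar>ln (norm y) - ln (norm (y - x))\<bar>"
    using *[OF p(1), of "norm (y - x)"] *[OF p(2), of "norm y"]
    by (cases "norm (y - x) \<le> norm y") (simp_all add: abs_minus_commute)
  then show ?thesis by (simp add: qd_def abs_if split: if_splits)
qed

text \<open>The nonlinearity is hidden in \<open>f\<close>, so the equation is linear with a given
  source. The exponent 1/4 has to stay below the 1/2 by which truncated symbols decay, and
  \<open>f_growth\<close> controls \<open>f\<close> near the moving singularity of the
  kernel.\<close>

locale distributional_solution =
  fixes n :: nat and u f :: "'a::euclidean_space \<Rightarrow> real"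
  assumes n: "n \<ge> 1" and dim: "DIM('a) = 2 * n"
    and u_cont: "continuous_on UNIV u"
    and f_cont: "continuous_on UNIV f"
    and f_int: "integrable lborel f"
    and weak: "\<And>\<phi>. test_function \<phi> \<Longrightarrow>
      (LINT x|lborel. u x * (neg_laplacian ^^ n) \<phi> x) = (LINT x|lborel. f x * \<phi> x)"
    and u_growth: "\<exists>A. \<forall>x. \<bar>u x\<bar> \<le> A * (1 + norm x) powr (1 / 4)"
    and f_growth: "\<exists>B q. q \<ge> 0 \<and> (\<forall>x. \<bar>f x\<bar> \<le> B * (1 + norm x) powr q)"
begin

lemma u_measurable[measurable]: "u \<in> borel_measurable borel"
  using u_cont by (rule borel_measurable_continuous_onI)

lemma f_measurable[measurable]: "f \<in> borel_measurable borel"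
  using f_cont by (rule borel_measurable_continuous_onI)

text \<open>The orders add up to \<open>1/4 - 1/2 - 2n\<close>, which lies 1/4 below the threshold
  \<open>- real DIM('a)\<close> of integrability. The bound \<open>M\<close> is common to the
  family.\<close>

lemma integrable_times_symbol:
  assumes "symbol m F" "m \<le> - 1 / 2"
  obtains M where "\<And>i. integrable lborel (\<lambda>y. u y * (neg_laplacian ^^ n) (F i) y)"
    "\<And>i. \<bar>LINT y|lborel. u y * (neg_laplacian ^^ n) (F i) y\<bar> \<le> M"
proof -
  obtain A where A: "\<And>x. \<bar>u x\<bar> \<le> A * (1 + norm x) powr (1 / 4)" using u_growth by blast
  have s: "symbol (- 1 / 2 - 2 * real n) (\<lambda>i. (neg_laplacian ^^ n) (F i))"
    using symbol_neg_laplacian_iter[OF symbol_mono[OF assms]] .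
  obtain C where C: "\<And>i x. \<bar>(neg_laplacian ^^ n) (F i) x\<bar> \<le> C * (1 + norm x) powr (- 1 / 2 - 2 * real n)"
    using symbol_order[OF s] unfolding order_le_def by blast
  define w where "w x = A * C * (1 + norm x) powr (- (2 * real n + 1 / 4))" for x :: 'a
  have w: "integrable lborel w"
    unfolding w_def by (intro integrable_mult_right integrable_powr_decay) (simp add: dim)
  have le: "\<bar>u x * (neg_laplacian ^^ n) (F i) x\<bar> \<le> w x" for i x
  proof -
    have "\<bar>u x * (neg_laplacian ^^ n) (F i) x\<bar> \<le>
        (A * (1 + norm x) powr (1 / 4)) * (C * (1 + norm x) powr (- 1 / 2 - 2 * real n))"
      unfolding abs_mult by (intro mult_mono A C order_trans[OF abs_ge_zero A]) auto
    also have "\<dots> = A * C * ((1 + norm x) powr (1 / 4) * (1 + norm x) powr (- 1 / 2 - 2 * real n))"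
      by simp
    also have "\<dots> = w x"
    proof -
      have "1 / 4 + (- 1 / 2 - 2 * real n) = - (2 * real n + 1 / 4)" by simp
      then show ?thesis unfolding powr_add[symmetric] w_def by (simp only:)
    qed
    finally show ?thesis .
  qed
  have meas: "(\<lambda>y. u y * (neg_laplacian ^^ n) (F i) y) \<in> borel_measurable borel" for i
    by (intro borel_measurable_continuous_onI continuous_on_mult u_cont
        differentiable_imp_continuous_on symbol_differentiable[OF s])
  have int: "integrable lborel (\<lambda>y. u y * (neg_laplacian ^^ n) (F i) y)" for i
    by (rule Bochner_Integration.integrable_bound[OF w]) (use meas in \<open>auto intro!: AE_I2 order_trans[OF le abs_ge_self]\<close>)
  have "\<bar>LINT y|lborel. u y * (neg_laplacian ^^ n) (F i) y\<bar> \<le> (LINT y|lborel. w y)" for i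
  proof -
    have "\<bar>LINT y|lborel. u y * (neg_laplacian ^^ n) (F i) y\<bar> \<le>
        (LINT y|lborel. \<bar>u y * (neg_laplacian ^^ n) (F i) y\<bar>)"
      by (rule integral_abs_bound)
    also have "\<dots> \<le> (LINT y|lborel. w y)"
      by (intro integral_mono integrable_abs int w le)
    finally show ?thesis .
  qed
  then show thesis using that int by blast
qed

text \<open>Symbols of order at most 0 are bounded uniformly in the index, and \<open>f\<close> is
  integrable.\<close>

lemma integrable_source_times_symbol:
  assumes "symbol m F" "m \<le> 0"
  obtains M where "\<And>i. integrable lborel (\<lambda>y. f y * F i y)"
    "\<And>i. \<bar>LINT y|lborel. f y * F i y\<bar> \<le> M"
proof -
  obtain C where C: "\<And>i x. \<bar>F i x\<bar> \<le> C * (1 + norm x) powr 0"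
    using symbol_order[OF symbol_mono[OF assms]] unfolding order_le_def by blast
  have le: "\<bar>f x * F i x\<bar> \<le> C * \<bar>f x\<bar>" for i x
  proof -
    have "1 + norm x > 0" by (simp add: add_pos_nonneg)
    then have "\<bar>F i x\<bar> \<le> C" using C[of i x] by simp
    then show ?thesis by (simp add: abs_mult mult.commute[of C] mult_left_mono)
  qed
  have w: "integrable lborel (\<lambda>x. C * \<bar>f x\<bar>)"
    using f_int by (intro integrable_mult_right integrable_abs)
  have meas: "(\<lambda>y. f y * F i y) \<in> borel_measurable borel" for i
    by (intro borel_measurable_continuous_onI continuous_on_mult f_cont
        differentiable_imp_continuous_on symbol_differentiable[OF assms(1)])
  have int: "integrable lborel (\<lambda>y. f y * F i y)" for i
    by (rule Bochner_Integration.integrable_bound[OF w]) (use meas in \<open>auto intro: order_trans[OF le abs_ge_self]\<close>)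
  have "\<bar>LINT y|lborel. f y * F i y\<bar> \<le> (LINT y|lborel. C * \<bar>f y\<bar>)" for i
  proof -
    have "\<bar>LINT y|lborel. f y * F i y\<bar> \<le> (LINT y|lborel. \<bar>f y * F i y\<bar>)"
      by (rule integral_abs_bound)
    also have "\<dots> \<le> (LINT y|lborel. C * \<bar>f y\<bar>)"
      by (intro integral_mono integrable_abs int w le)
    finally show ?thesis .
  qed
  then show thesis using that int by blast
qed

lemma test_function_cutoff:
  assumes "symbol m (\<lambda>N. g)"
  shows "test_function (\<lambda>y. cutoff N y * g y)"
  unfolding test_function_def
proof
  show "\<forall>k. C_k k (\<lambda>y. cutoff N y * g y)"
    using symbol_C_k[OF symbol_mult[OF symbol_cutoff assms], of _ N] by simp
  have "closure {x. cutoff N x * g x \<noteq> 0} \<subseteq> cball 0 (1 + real N)"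
    by (rule closure_minimal) (auto dest: cutoff_support)
  then show "compact (closure {x. cutoff N x * g x \<noteq> 0})"
    by (metis bounded_cball bounded_subset closed_closure compact_eq_bounded_closed)
qed

text \<open>No Liouville theorem is needed: the growth of \<open>u\<close> allows testing directly with symbols of
  order \<open>- 1\<close>, since truncating them at radius \<open>N\<close> costs only \<open>O(N powr (- 1 / 2))\<close>.\<close>

lemma weak_symbol:
  assumes g: "symbol (- 1) (\<lambda>N::nat. g)"
  shows "(LINT y|lborel. u y * (neg_laplacian ^^ n) g y) = (LINT y|lborel. f y * g y)"
proof -
  \<comment> \<open>The truncation error, magnified so that it stays a symbol of order
    \<open>1/2 - 1 = - 1/2\<close> uniformly in \<open>N\<close>.\<close>
  define \<psi> where "\<psi> N y = (1 + real N) powr (1 / 2) * (cutoff N y - 1) * g y" for N y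
  have \<psi>: "symbol (- 1 / 2) \<psi>"
    using symbol_mult[OF symbol_cutoff_remainder g] by (simp add: \<psi>_def[abs_def])
  have split: "cutoff N y * g y = g y + (1 + real N) powr (- 1 / 2) * \<psi> N y" for N y
  proof -
    have "(1 + real N) powr (- 1 / 2) * (1 + real N) powr (1 / 2) = 1"
      by (simp add: powr_add[symmetric])
    then have "(1 + real N) powr (- 1 / 2) * \<psi> N y = (cutoff N y - 1) * g y"
      by (simp add: \<psi>_def mult.assoc[symmetric])
    then show ?thesis by (simp add: algebra_simps)
  qed
  obtain M1 where M1: "\<And>i. integrable lborel (\<lambda>y. u y * (neg_laplacian ^^ n) (\<psi> i) y)"
    "\<And>i. \<bar>LINT y|lborel. u y * (neg_laplacian ^^ n) (\<psi> i) y\<bar> \<le> M1"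
    using integrable_times_symbol[OF \<psi>] by auto
  obtain M2 where M2: "\<And>i. integrable lborel (\<lambda>y. f y * \<psi> i y)" "\<And>i. \<bar>LINT y|lborel. f y * \<psi> i y\<bar> \<le> M2"
    using integrable_source_times_symbol[OF \<psi>] by auto
  have Lg: "integrable lborel (\<lambda>y. u y * (neg_laplacian ^^ n) g y)"
    by (rule integrable_times_symbol[OF g]) auto
  have fg: "integrable lborel (\<lambda>y. f y * g y)"
    by (rule integrable_source_times_symbol[OF g]) auto
  \<comment> \<open>The defect of the claimed identity does not depend on \<open>N\<close>, whereas
    the truncated equation bounds it by a null sequence.\<close>
  define d where "d = (LINT y|lborel. u y * (neg_laplacian ^^ n) g y) - (LINT y|lborel. f y * g y)"
  have d: "norm d \<le> (M1 + M2) * (1 + real N) powr (- 1 / 2)" for N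
  proof -
    let ?r = "(1 + real N) powr (- 1 / 2)"
    have r\<psi>: "symbol (- 1 / 2) (\<lambda>i y. ?r * \<psi> i y)" by (rule symbol_cmult[OF \<psi>])
    have "(neg_laplacian ^^ n) (\<lambda>y. cutoff N y * g y) =
        (\<lambda>y. (neg_laplacian ^^ n) g y + ?r * (neg_laplacian ^^ n) (\<psi> N) y)"
      unfolding split neg_laplacian_iter_add[OF g r\<psi>] neg_laplacian_iter_cmult[OF \<psi>] ..
    then have "(LINT y|lborel. u y * (neg_laplacian ^^ n) (\<lambda>y. cutoff N y * g y) y) =
        (LINT y|lborel. u y * (neg_laplacian ^^ n) g y + ?r * (u y * (neg_laplacian ^^ n) (\<psi> N) y))"
      by (simp add: algebra_simps)
    also have "\<dots> = (LINT y|lborel. u y * (neg_laplacian ^^ n) g y) + ?r * (LINT y|lborel. u y * (neg_laplacian ^^ n) (\<psi> N) y)"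
      using Lg M1(1) by simp
    finally have 1: "(LINT y|lborel. f y * (cutoff N y * g y)) =
       (LINT y|lborel. u y * (neg_laplacian ^^ n) g y) + ?r * (LINT y|lborel. u y * (neg_laplacian ^^ n) (\<psi> N) y)"
      unfolding weak[OF test_function_cutoff[OF g]] .
    have "(LINT y|lborel. f y * (cutoff N y * g y)) = (LINT y|lborel. f y * g y + ?r * (f y * \<psi> N y))"
      unfolding split by (simp add: algebra_simps)
    also have "\<dots> = (LINT y|lborel. f y * g y) + ?r * (LINT y|lborel. f y * \<psi> N y)"
      using fg M2(1) by simp
    finally have "d = ?r * ((LINT y|lborel. f y * \<psi> N y) - (LINT y|lborel. u y * (neg_laplacian ^^ n) (\<psi> N) y))"
      using 1 by (simp add: d_def algebra_simps)
    moreover have "\<bar>(LINT y|lborel. f y * \<psi> N y) - (LINT y|lborel. u y * (neg_laplacian ^^ n) (\<psi> N) y)\<bar> \<le> M1 + M2"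
      using M1(2)[of N] M2(2)[of N] by linarith
    ultimately show ?thesis by (simp add: abs_mult mult.commute mult_left_mono)
  qed
  have "(\<lambda>N. (M1 + M2) * (1 + real N) powr (- 1 / 2)) \<longlonglongrightarrow> (M1 + M2) * 0"
    by (intro tendsto_intros tendsto_neg_powr
        filterlim_tendsto_add_at_top[OF tendsto_const filterlim_real_sequentially]) simp
  then have "(\<lambda>N::nat. d) \<longlonglongrightarrow> 0"
    using d by (intro Lim_null_comparison[of "\<lambda>N. d"]) auto
  then have "d = 0" by (simp add: LIMSEQ_const_iff)
  then show ?thesis by (simp add: d_def)
qed

text \<open>Only the difference of the logarithms decays enough to be tested with; the separate
  logarithms serve to split the iterated operator.\<close>

lemma weak_bubble:
  assumes e: "e > 0"
  shows "4 ^ n / 2 * fact (2 * n - 1) * (LINT y|lborel. u y *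
      (e ^ (2 * n) / qd e c y ^ (2 * n) - e ^ (2 * n) / qd e 0 y ^ (2 * n)))
    = (LINT y|lborel. f y * (- (1 / 2) * ln (qd e c y) + 1 / 2 * ln (qd e 0 y)))"
proof -
  define k :: real where "k = 4 ^ n / 2 * fact (2 * n - 1)"
  have L: "symbol 1 (\<lambda>i y. - (1 / 2) * ln (qd e c y))" for c :: 'a
    by (rule symbol_log_qd[OF e])
  have L0: "symbol 1 (\<lambda>i y::'a. - 1 * (- (1 / 2) * ln (qd e 0 y)))"
    by (rule symbol_cmult[OF L])
  have "(neg_laplacian ^^ n) (\<lambda>y. - (1 / 2) * ln (qd e c y) + 1 / 2 * ln (qd e 0 y)) =
      (\<lambda>y. k * (e ^ (2 * n) / qd e c y ^ (2 * n) - e ^ (2 * n) / qd e 0 y ^ (2 * n)))"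
    using neg_laplacian_iter_add[OF L L0, of n c]
    unfolding neg_laplacian_iter_cmult[OF L] neg_laplacian_log_bubble[OF e dim n] k_def
    by (simp add: algebra_simps)
  with weak_symbol[OF symbol_log_diff[OF e, of c]]
  have "(LINT y|lborel. f y * (- (1 / 2) * ln (qd e c y) + 1 / 2 * ln (qd e 0 y))) =
     (LINT y|lborel. k * (u y * (e ^ (2 * n) / qd e c y ^ (2 * n) - e ^ (2 * n) / qd e 0 y ^ (2 * n))))"
    by (simp add: mult.left_commute)
  then show ?thesis by (simp add: k_def)
qed

section \<open>Mass and concentration of the bubbles\<close>

lemma bubble_mass:
  "4 ^ n / 2 * fact (2 * n - 1) * (LINT z::'a|lborel. 1 / (1 + (norm z)\<^sup>2) ^ (2 * n)) = gamma_const n"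
proof -
  have "(1 + (norm z)\<^sup>2) powr (- real (2 * n)) = 1 / (1 + (norm z)\<^sup>2) ^ (2 * n)" for z :: 'a
    by (subst powr_minus, subst powr_realpow) (auto simp: add_pos_nonneg inverse_eq_divide)
  \<comment> \<open>The exponent is \<open>2 * n\<close> and half the dimension is \<open>n\<close>,
    so the Gamma quotient becomes a quotient of factorials; \<open>fact (2 * n - 1)\<close> cancels
    against the prefactor.\<close>
  then have "(LINT z::'a|lborel. 1 / (1 + (norm z)\<^sup>2) ^ (2 * n)) = pi ^ n * Gamma (real n) / Gamma (real (2 * n))"
    using integral_bracket_powr(2)[where 'a = 'a, of "real (2 * n)"] n by (simp add: dim powr_realpow)
  moreover have "Gamma (real n) = fact (n - 1)" "Gamma (real (2 * n)) = fact (2 * n - 1)"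
    using n Gamma_fact[of "n - 1", where 'a = real] Gamma_fact[of "2 * n - 1", where 'a = real]
    by (simp_all add: of_nat_diff)
  moreover have "(4::real) ^ n / 2 = 2 ^ (2 * n - 1)"
    using n by (cases n) (simp_all add: power_mult)
  ultimately show ?thesis
    by (simp add: gamma_const_closed_form[OF n])
qed

text \<open>For \<open>e \<le> 1\<close> the translated and scaled growth of \<open>u\<close> splits
  as \<open>1 + norm (c + e *\<^sub>R z) \<le> (1 + norm c) * (1 + norm z)\<close>. The bubble
  decays with power \<open>4n\<close>, so \<open>4n - 1/4\<close> exceeds the dimension
  \<open>2n\<close>; the factor \<open>2 ^ (2 * n)\<close> comes from comparing
  \<open>(1 + norm z)\<^sup>2\<close> with \<open>1 + (norm z)\<^sup>2\<close>.\<close>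

lemma bubble_majorant:
  obtains w where "integrable lborel w"
    "\<And>e z. 0 < e \<Longrightarrow> e \<le> 1 \<Longrightarrow> \<bar>u (c + e *\<^sub>R z) * (1 / (1 + (norm z)\<^sup>2) ^ (2 * n))\<bar> \<le> w z"
proof -
  obtain A where A: "\<And>x. \<bar>u x\<bar> \<le> A * (1 + norm x) powr (1 / 4)" using u_growth by blast
  have A0: "A \<ge> 0" using order_trans[OF abs_ge_zero A[of 0]] by simp
  define w where "w z = A * (1 + norm c) powr (1 / 4) * 2 ^ (2 * n) * (1 + norm z) powr (- (4 * real n - 1 / 4))" for z :: 'a
  have "integrable lborel w"
    unfolding w_def using n by (intro integrable_mult_right integrable_powr_decay) (simp add: dim)
  moreover have "\<bar>u (c + e *\<^sub>R z) * (1 / (1 + (norm z)\<^sup>2) ^ (2 * n))\<bar> \<le> w z" if "0 < e" "e \<le> 1" for e z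
  proof -
    have z0: "1 + norm z > 0" by (simp add: add_pos_nonneg)
    have "norm (c + e *\<^sub>R z) \<le> norm c + e * norm z"
      using norm_triangle_ineq[of c "e *\<^sub>R z"] that by simp
    moreover have "e * norm z \<le> norm z" using that by (simp add: mult_left_le_one_le)
    moreover have "1 + (norm c + norm z) \<le> (1 + norm c) * (1 + norm z)" by (simp add: algebra_simps)
    ultimately have "1 + norm (c + e *\<^sub>R z) \<le> (1 + norm c) * (1 + norm z)" by linarith
    then have "(1 + norm (c + e *\<^sub>R z)) powr (1 / 4) \<le> ((1 + norm c) * (1 + norm z)) powr (1 / 4)"
      by (intro powr_mono2) auto
    also have "\<dots> = (1 + norm c) powr (1 / 4) * (1 + norm z) powr (1 / 4)"
      by (simp add: powr_mult)
    finally have 1: "\<bar>u (c + e *\<^sub>R z)\<bar> \<le> A * ((1 + norm c) powr (1 / 4) * (1 + norm z) powr (1 / 4))"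
      using A[of "c + e *\<^sub>R z"] mult_left_mono[OF _ A0] order_trans by blast
    have "(1 + norm z)\<^sup>2 \<le> 2 * (1 + (norm z)\<^sup>2)"
      using zero_le_power2[of "1 - norm z"] by (simp add: power2_sum power2_diff)
    then have "((1 + norm z)\<^sup>2) ^ (2 * n) \<le> (2 * (1 + (norm z)\<^sup>2)) ^ (2 * n)"
      by (intro power_mono) auto
    then have "(1 + norm z) ^ (4 * n) \<le> 2 ^ (2 * n) * (1 + (norm z)\<^sup>2) ^ (2 * n)"
    proof -
      have "((1 + norm z)\<^sup>2) ^ (2 * n) = (1 + norm z) ^ (4 * n)"
        by (simp flip: power_mult)
      then show ?thesis
        using \<open>((1 + norm z)\<^sup>2) ^ (2 * n) \<le> (2 * (1 + (norm z)\<^sup>2)) ^ (2 * n)\<close>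
        by (simp only: power_mult_distrib)
    qed
    moreover have "(1 + (norm z)\<^sup>2) ^ (2 * n) > 0" by (intro zero_less_power add_pos_nonneg) auto
    moreover have "(1 + norm z) ^ (4 * n) > 0" using z0 by simp
    ultimately have "1 / (1 + (norm z)\<^sup>2) ^ (2 * n) \<le> 2 ^ (2 * n) * (1 / (1 + norm z) ^ (4 * n))"
      by (simp add: divide_le_eq pos_le_divide_eq mult.commute)
    also have "1 / (1 + norm z) ^ (4 * n) = (1 + norm z) powr (- real (4 * n))"
      using z0 by (simp only: powr_minus powr_realpow inverse_eq_divide)
    finally have 2: "\<bar>1 / (1 + (norm z)\<^sup>2) ^ (2 * n)\<bar> \<le> 2 ^ (2 * n) * (1 + norm z) powr (- real (4 * n))"
      by simp
    have "\<bar>u (c + e *\<^sub>R z) * (1 / (1 + (norm z)\<^sup>2) ^ (2 * n))\<bar> \<le>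
       (A * ((1 + norm c) powr (1 / 4) * (1 + norm z) powr (1 / 4))) * (2 ^ (2 * n) * (1 + norm z) powr (- real (4 * n)))"
      unfolding abs_mult by (intro mult_mono 1 2) (use A0 in auto)
    also have "\<dots> = A * (1 + norm c) powr (1 / 4) * 2 ^ (2 * n) * ((1 + norm z) powr (1 / 4) * (1 + norm z) powr (- real (4 * n)))"
      by simp
    also have "\<dots> = w z"
    proof -
      have "1 / 4 + - real (4 * n) = - (4 * real n - 1 / 4)" by simp
      then show ?thesis unfolding powr_add[symmetric] w_def by (simp only:)
    qed
    finally show ?thesis .
  qed
  ultimately show thesis by (rule that)
qed

text \<open>Substitution \<open>y = c + e *\<^sub>R z\<close>: the bubble scales by
  \<open>1 / e ^ (2 * n)\<close>, which the Jacobian in dimension \<open>2 * n\<close>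
  cancels.\<close>

lemma bubble_average:
  fixes c :: 'a
  assumes "0 < e" "e \<le> 1"
  shows "integrable lborel (\<lambda>y. u y * (e ^ (2 * n) / qd e c y ^ (2 * n)))"
    and "(LINT y|lborel. u y * (e ^ (2 * n) / qd e c y ^ (2 * n))) =
      (LINT z|lborel. u (c + e *\<^sub>R z) * (1 / (1 + (norm z)\<^sup>2) ^ (2 * n)))"
proof -
  let ?h = "\<lambda>y. u y * (e ^ (2 * n) / qd e c y ^ (2 * n))"
  obtain w where w: "integrable lborel w"
    "\<And>e z. 0 < e \<Longrightarrow> e \<le> 1 \<Longrightarrow> \<bar>u (c + e *\<^sub>R z) * (1 / (1 + (norm z)\<^sup>2) ^ (2 * n))\<bar> \<le> w z"
    using bubble_majorant[of c] by blast
  have meas: "?h \<in> borel_measurable borel"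
    unfolding qd_def by measurable
  have h: "?h (c + e *\<^sub>R z) = 1 / e ^ (2 * n) * (u (c + e *\<^sub>R z) * (1 / (1 + (norm z)\<^sup>2) ^ (2 * n)))" for z
  proof -
    have "qd e c (c + e *\<^sub>R z) = e\<^sup>2 * (1 + (norm z)\<^sup>2)"
      by (simp add: qd_def power_mult_distrib algebra_simps)
    then have "qd e c (c + e *\<^sub>R z) ^ (2 * n) = e ^ (2 * n) * e ^ (2 * n) * (1 + (norm z)\<^sup>2) ^ (2 * n)"
      by (simp add: power_mult_distrib power_mult[symmetric] power_add[symmetric])
    then show ?thesis using assms(1) by simp
  qed
  have "integrable lborel (\<lambda>z. u (c + e *\<^sub>R z) * (1 / (1 + (norm z)\<^sup>2) ^ (2 * n)))"
    by (rule Bochner_Integration.integrable_bound[OF w(1)])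
      (auto intro: order_trans[OF w(2)[OF assms] abs_ge_self] simp del: times_divide_eq_right)
  then have "integrable lborel (\<lambda>z. ?h (c + e *\<^sub>R z))"
    unfolding h by (rule integrable_mult_right)
  then show "integrable lborel ?h"
    by (rule integrable_lborel_affine[OF meas assms(1)])
  show "(LINT y|lborel. ?h y) = (LINT z|lborel. u (c + e *\<^sub>R z) * (1 / (1 + (norm z)\<^sup>2) ^ (2 * n)))"
    unfolding integral_lborel_affine[OF meas assms(1), of c] h dim integral_mult_right_zero using assms(1) by simp
qed

lemma bubble_average_tendsto:
  assumes "E \<longlonglongrightarrow> 0" "\<And>k. 0 < E k" "\<And>k. E k \<le> 1"
  shows "(\<lambda>k. LINT y|lborel. u y * (E k ^ (2 * n) / qd (E k) c y ^ (2 * n))) \<longlonglongrightarrow>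
    u c * (LINT z::'a|lborel. 1 / (1 + (norm z)\<^sup>2) ^ (2 * n))"
proof -
  obtain w where w: "integrable lborel w"
    "\<And>e z. 0 < e \<Longrightarrow> e \<le> 1 \<Longrightarrow> \<bar>u (c + e *\<^sub>R z) * (1 / (1 + (norm z)\<^sup>2) ^ (2 * n))\<bar> \<le> w z"
    using bubble_majorant[of c] by blast
  have "(\<lambda>k. LINT z|lborel. u (c + E k *\<^sub>R z) * (1 / (1 + (norm z)\<^sup>2) ^ (2 * n))) \<longlonglongrightarrow>
    (LINT z::'a|lborel. u c * (1 / (1 + (norm z)\<^sup>2) ^ (2 * n)))"
  proof (rule integral_dominated_convergence[OF _ _ w(1)])
    show "AE z in lborel. (\<lambda>k. u (c + E k *\<^sub>R z) * (1 / (1 + (norm z)\<^sup>2) ^ (2 * n))) \<longlonglongrightarrow>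
        u c * (1 / (1 + (norm z)\<^sup>2) ^ (2 * n))"
    proof (intro AE_I2 tendsto_intros)
      fix z :: 'a
      have "isCont u c" using u_cont by (simp add: continuous_on_eq_continuous_at)
      moreover have "(\<lambda>k. c + E k *\<^sub>R z) \<longlonglongrightarrow> c + 0 *\<^sub>R z" by (intro tendsto_intros assms(1))
      ultimately show "(\<lambda>k. u (c + E k *\<^sub>R z)) \<longlonglongrightarrow> u c"
        using isCont_tendsto_compose[of c u] by simp
    qed
    show "AE z in lborel. norm (u (c + E k *\<^sub>R z) * (1 / (1 + (norm z)\<^sup>2) ^ (2 * n))) \<le> w z" for k
      using w(2)[OF assms(2,3)] by simp
  qed measurable
  then show ?thesis
    unfolding bubble_average(2)[OF assms(2,3)] integral_mult_right_zero .
qed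

text \<open>\<open>log_part 1\<close> vanishes outside the unit ball, and on the unit ball around
  \<open>x\<close> the polynomial growth bounds \<open>f\<close>.\<close>

lemma integrable_log_part: "integrable lborel (\<lambda>y. \<bar>f y\<bar> * log_part 1 (y - x))"
proof -
  obtain B q where q: "q \<ge> 0" and B: "\<And>x. \<bar>f x\<bar> \<le> B * (1 + norm x) powr q" using f_growth by blast
  have B0: "B \<ge> 0" using order_trans[OF abs_ge_zero B[of 0]] by simp
  have "integrable lborel (\<lambda>y. B * (2 + norm x) powr q * log_part 1 (y - x))"
    by (intro integrable_mult_right integrable_lborel_shift integral_log_part(1)) simp
  then show ?thesis
  proof (rule Bochner_Integration.integrable_bound)
    show "AE y in lborel. norm (\<bar>f y\<bar> * log_part 1 (y - x)) \<le> norm (B * (2 + norm x) powr q * log_part 1 (y - x))"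
    proof (intro AE_I2)
      fix y
      show "norm (\<bar>f y\<bar> * log_part 1 (y - x)) \<le> norm (B * (2 + norm x) powr q * log_part 1 (y - x))"
      proof (cases "norm (y - x) < 1")
        case True
        then have "norm y \<le> 1 + norm x" by norm
        then have "(1 + norm y) powr q \<le> (2 + norm x) powr q" using q by (intro powr_mono2) auto
        then have "\<bar>f y\<bar> \<le> B * (2 + norm x) powr q"
          using B[of y] B0 mult_left_mono order_trans by blast
        then show ?thesis
          using B0 by (simp add: abs_mult log_part_nonneg mult_right_mono)
      next
        case False
        then show ?thesis by (simp add: log_part_def)
      qed
    qed
  qed measurable
qed

text \<open>Both sides of the tested equation converge as \<open>e\<close> tends to 0: the bubbles
  concentrate at \<open>x\<close> and at 0, and the smoothed kernels converge off these two points
  below a common integrable majorant.\<close>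

lemma representation:
  shows "integrable lborel (\<lambda>y. f y * (ln (norm y) - ln (norm (y - x))))"
    and "gamma_const n * (u x - u 0) = (LINT y|lborel. f y * (ln (norm y) - ln (norm (y - x))))"
proof -
  define w where "w y = \<bar>f y\<bar> * (ln (1 + norm x)) + \<bar>f y\<bar> * log_part 1 (y - 0) + \<bar>f y\<bar> * log_part 1 (y - x)" for y
  have w: "integrable lborel w"
    unfolding w_def[abs_def]
    by (intro Bochner_Integration.integrable_add integrable_mult_left integrable_abs f_int integrable_log_part)
  have ae: "AE y in lborel. y \<noteq> 0 \<and> y \<noteq> x"
    by (intro AE_conjI AE_lborel_singleton)
  have bd: "\<bar>f y * (ln (norm y) - ln (norm (y - x)))\<bar> \<le> w y" if "y \<noteq> 0 \<and> y \<noteq> x" for y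
  proof -
    have "\<bar>f y * (ln (norm y) - ln (norm (y - x)))\<bar> \<le>
        \<bar>f y\<bar> * (ln (1 + norm x) + log_part 1 y + log_part 1 (y - x))"
      unfolding abs_mult using that by (intro mult_left_mono abs_ln_norm_diff_le) auto
    then show ?thesis by (simp add: w_def distrib_left)
  qed
  show "integrable lborel (\<lambda>y. f y * (ln (norm y) - ln (norm (y - x))))"
    by (rule Bochner_Integration.integrable_bound[OF w], measurable)
      (use ae in eventually_elim, use bd abs_ge_self order_trans in \<open>fastforce simp del: abs_mult\<close>)
  \<comment> \<open>Any null sequence in the interval from 0 to 1 would do; the majorant for the
    bubbles is uniform there.\<close>
  define E where "E k = 1 / (1 + real k)" for k
  have E: "E \<longlonglongrightarrow> 0" "0 < E k" "E k \<le> 1" for k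
    using LIMSEQ_inverse_real_of_nat by (simp_all add: E_def[abs_def] inverse_eq_divide)
  let ?g = "\<lambda>k y. f y * (- (1 / 2) * ln (qd (E k) x y) + 1 / 2 * ln (qd (E k) 0 y))"
  have R: "(\<lambda>k. LINT y|lborel. ?g k y) \<longlonglongrightarrow> (LINT y|lborel. f y * (ln (norm y) - ln (norm (y - x))))"
  proof (rule integral_dominated_convergence[OF _ _ w])
    show "AE y in lborel. (\<lambda>k. ?g k y) \<longlonglongrightarrow> f y * (ln (norm y) - ln (norm (y - x)))"
      using ae
    proof eventually_elim
      case (elim y)
      have *: "(\<lambda>k. ln (qd (E k) c y)) \<longlonglongrightarrow> ln ((norm (y - c))\<^sup>2)" if "y \<noteq> c" for c
      proof -
        have "(\<lambda>k. qd (E k) c y) \<longlonglongrightarrow> 0\<^sup>2 + (norm (y - c))\<^sup>2"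
          unfolding qd_def by (intro tendsto_intros E(1))
        then show ?thesis using that by (intro tendsto_ln) auto
      qed
      have "(\<lambda>k. ?g k y) \<longlonglongrightarrow> f y * (- (1 / 2) * ln ((norm (y - x))\<^sup>2) + 1 / 2 * ln ((norm (y - 0))\<^sup>2))"
        using elim by (intro tendsto_intros *) auto
      then show ?case using elim by (simp add: ln_realpow algebra_simps)
    qed
    show "AE y in lborel. norm (?g k y) \<le> w y" for k
      using ae
    proof eventually_elim
      case (elim y)
      have "\<bar>?g k y\<bar> \<le> \<bar>f y * (ln (norm y) - ln (norm (y - x)))\<bar>"
        unfolding abs_mult using elim E(2) by (intro mult_left_mono abs_log_qd_diff_le) auto
      then show ?case using bd[OF elim] by simp
    qed
  qed (unfold qd_def, measurable)
  have "(\<lambda>k. 4 ^ n / 2 * fact (2 * n - 1) * (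
      (LINT y|lborel. u y * (E k ^ (2 * n) / qd (E k) x y ^ (2 * n))) -
      (LINT y|lborel. u y * (E k ^ (2 * n) / qd (E k) 0 y ^ (2 * n))))) \<longlonglongrightarrow>
    4 ^ n / 2 * fact (2 * n - 1) * (u x * (LINT z::'a|lborel. 1 / (1 + (norm z)\<^sup>2) ^ (2 * n)) -
      u 0 * (LINT z::'a|lborel. 1 / (1 + (norm z)\<^sup>2) ^ (2 * n)))"
    by (intro tendsto_intros bubble_average_tendsto E)
  also have "4 ^ n / 2 * fact (2 * n - 1) * (u x * (LINT z::'a|lborel. 1 / (1 + (norm z)\<^sup>2) ^ (2 * n)) -
      u 0 * (LINT z::'a|lborel. 1 / (1 + (norm z)\<^sup>2) ^ (2 * n))) = gamma_const n * (u x - u 0)"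
    unfolding bubble_mass[symmetric] by (simp add: algebra_simps)
  also have "(\<lambda>k. 4 ^ n / 2 * fact (2 * n - 1) * (
      (LINT y|lborel. u y * (E k ^ (2 * n) / qd (E k) x y ^ (2 * n))) -
      (LINT y|lborel. u y * (E k ^ (2 * n) / qd (E k) 0 y ^ (2 * n))))) = (\<lambda>k. LINT y|lborel. ?g k y)"
    unfolding weak_bubble[OF E(2), symmetric] right_diff_distrib
      Bochner_Integration.integral_diff[OF bubble_average(1)[OF E(2,3)] bubble_average(1)[OF E(2,3)]] ..
  finally show "gamma_const n * (u x - u 0) = (LINT y|lborel. f y * (ln (norm y) - ln (norm (y - x))))"
    using R by (rule LIMSEQ_unique)
qed

end

section \<open>Asymptotics of the logarithmic potential\<close>

text \<open>Inside the unit ball \<open>ln (1 / norm z)\<close> is \<open>ln (1 / r)\<close> plus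
  \<open>ln (r / norm z)\<close>; \<open>r\<close> stays free, to be adapted to the position of the
  ball.\<close>

lemma log_part_split:
  fixes z :: "'a::euclidean_space"
  assumes "0 < r" "r \<le> 1"
  shows "log_part 1 z \<le> indicator (ball 0 1) z * (- ln r) + indicator (ball 0 1) z * log_part r z"
proof (cases "norm z < 1")
  case True
  have "ln r \<le> 0" using assms by simp
  then show ?thesis using True by (auto simp: log_part_def indicator_def dist_norm)
next
  case False
  then have "ln (norm z) \<ge> 0" by simp
  then show ?thesis using False by (simp add: log_part_def indicator_def dist_norm)
qed

text \<open>Every fixed point eventually lies outside the escaping ball, and
  \<open>\<bar>g y\<bar>\<close> dominates. The lemma is applied to \<open>f\<close> and to
  \<open>f\<close> with a logarithmic weight.\<close>

lemma ball_mass_tendsto_0: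
  fixes g :: "'a::euclidean_space \<Rightarrow> real"
  assumes g: "integrable lborel g" and X: "filterlim X at_infinity sequentially"
  shows "(\<lambda>k. LINT y|lborel. indicator (ball 0 1) (y - X k) * \<bar>g y\<bar>) \<longlonglongrightarrow> 0"
proof -
  have [measurable]: "g \<in> borel_measurable borel"
    using borel_measurable_integrable[OF g] by simp
  have "(\<lambda>k. LINT y|lborel. indicator (ball 0 1) (y - X k) * \<bar>g y\<bar>) \<longlonglongrightarrow> (LINT y::'a|lborel. 0)"
  proof (rule integral_dominated_convergence[where w = "\<lambda>y. \<bar>g y\<bar>"])
    show "AE y in lborel. (\<lambda>k. indicator (ball 0 1) (y - X k) * \<bar>g y\<bar>) \<longlonglongrightarrow> 0"
    proof (intro AE_I2)
      fix y :: 'a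
      have "filterlim (\<lambda>k. norm (X k)) at_top sequentially"
        using X by (rule filterlim_at_infinity_imp_norm_at_top)
      then have "eventually (\<lambda>k. norm (X k) \<ge> norm y + 1) sequentially"
        by (simp add: filterlim_at_top)
      then have "eventually (\<lambda>k. 0 = indicator (ball 0 1) (y - X k) * \<bar>g y\<bar>) sequentially"
      proof eventually_elim
        case (elim k)
        then have "norm (y - X k) \<ge> 1" by norm
        then show ?case by (simp add: indicator_def dist_norm norm_minus_commute)
      qed
      then show "(\<lambda>k. indicator (ball 0 1) (y - X k) * \<bar>g y\<bar>) \<longlonglongrightarrow> 0"
        by (rule Lim_transform_eventually[OF tendsto_const])
    qed
    show "AE y in lborel. norm (indicator (ball 0 1) (y - X k) * \<bar>g y\<bar>) \<le> \<bar>g y\<bar>" for k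
      by (auto simp: indicator_def)
    show "integrable lborel (\<lambda>y. \<bar>g y\<bar>)" using g by (rule integrable_abs)
  qed (auto simp: indicator_def)
  then show ?thesis by simp
qed

text \<open>The norms of \<open>y - x\<close> and \<open>x\<close> differ by at most
  \<open>norm y\<close>, and both are at least \<open>norm x - norm y\<close>; the tangent
  inequality for the logarithm then bounds the difference.\<close>

lemma ln_norm_diff_tendsto_0:
  fixes y :: "'a::euclidean_space"
  shows "((\<lambda>x. ln (norm (y - x)) - ln (norm x)) \<longlongrightarrow> 0) at_infinity"
proof (rule Lim_null_comparison)
  have top: "filterlim (\<lambda>x::'a. norm x) at_top at_infinity"
    by (rule filterlim_norm_at_top)
  have "filterlim (\<lambda>x::'a. - norm y + norm x) at_top at_infinity"
    by (rule filterlim_tendsto_add_at_top[OF tendsto_const top])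
  then show "((\<lambda>x::'a. norm y / (- norm y + norm x)) \<longlongrightarrow> 0) at_infinity"
    by (intro tendsto_divide_0[OF tendsto_const] filterlim_at_top_imp_at_infinity)
  have "eventually (\<lambda>x::'a. norm x \<ge> norm y + 1) at_infinity"
    using top by (simp add: filterlim_at_top)
  then show "eventually (\<lambda>x. norm (ln (norm (y - x)) - ln (norm x)) \<le> norm y / (- norm y + norm x)) at_infinity"
  proof eventually_elim
    case (elim x)
    define p where "p = norm x"
    define q where "q = norm (y - x)"
    define r where "r = - norm y + norm x"
    have r: "r > 0" "r \<le> p" "r \<le> q" "\<bar>q - p\<bar> \<le> norm y"
      using elim norm_ge_zero[of y] unfolding p_def q_def r_def by norm+
    have "ln q - ln p \<le> (q - p) / p" "ln p - ln q \<le> (p - q) / q"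
      using r by (auto intro!: ln_diff_le)
    moreover have "(q - p) / p \<le> norm y / r" "(p - q) / q \<le> norm y / r"
      using r by (auto intro!: frac_le)
    ultimately show ?case
      unfolding r_def[symmetric] unfolding p_def[symmetric] q_def[symmetric] real_norm_def abs_le_iff
      by linarith
  qed
qed

context distributional_solution
begin

text \<open>Split the unit ball around \<open>x\<close> at a radius \<open>r\<close> that is a
  negative power of \<open>norm x\<close>. Outside it the logarithm is at most
  \<open>- ln r\<close>, a multiple of \<open>ln (norm x)\<close>, and multiplies the mass of
  \<open>f\<close>. Inside, \<open>f\<close> is replaced by its polynomial bound, which the integral
  of \<open>log_part r\<close>, proportional to \<open>r ^ DIM('a)\<close>, outweighs.\<close>

lemma near_field_bound:
  obtains C q where "q \<ge> 0" "\<And>x. norm x \<ge> 1 \<Longrightarrow> (LINT y|lborel. \<bar>f y\<bar> * log_part 1 (y - x)) \<le>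
    q * (ln (norm x) * (LINT y|lborel. indicator (ball 0 1) (y - x) * \<bar>f y\<bar>)) + C * (1 / norm x)"
proof -
  obtain B q where q: "q \<ge> 0" and B: "\<And>x. \<bar>f x\<bar> \<le> B * (1 + norm x) powr q" using f_growth by blast
  have B0: "B \<ge> 0" using order_trans[OF abs_ge_zero B[of 0]] by simp
  let ?V = "unit_ball_vol (real DIM('a)) / real DIM('a)"
  have "(LINT y|lborel. \<bar>f y\<bar> * log_part 1 (y - x)) \<le>
    (q + 1) * (ln (norm x) * (LINT y|lborel. indicator (ball 0 1) (y - x) * \<bar>f y\<bar>)) + (B * 3 powr q * ?V) * (1 / norm x)"
    if x: "norm x \<ge> 1" for x
  proof -
    \<comment> \<open>The exponent exceeds the growth exponent of \<open>f\<close> by one, leaving a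
      remainder of size \<open>1 / norm x\<close>; the exponent \<open>q + 1\<close> is also the
      constant delivered in front of the logarithm.\<close>
    define r where "r = norm x powr (- (q + 1))"
    have x0: "norm x > 0" using x by linarith
    have r: "0 < r" "r \<le> 1"
      using x q powr_mono[of "- (q + 1)" 0 "norm x"] x0 by (auto simp: r_def)
    have lr: "- ln r = (q + 1) * ln (norm x)"
      using x0 by (simp add: r_def ln_powr algebra_simps)
    have i1: "integrable lborel (\<lambda>y. indicator (ball 0 1) (y - x) * \<bar>f y\<bar>)"
      by (rule Bochner_Integration.integrable_bound[OF f_int]) (auto simp: indicator_def)
    have i2: "integrable lborel (\<lambda>y. log_part r (y - x))"
      by (intro integrable_lborel_shift integral_log_part(1) r)
    have "\<bar>f y\<bar> * log_part 1 (y - x) \<le> (- ln r) * (indicator (ball 0 1) (y - x) * \<bar>f y\<bar>)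
        + B * 3 powr q * norm x powr q * log_part r (y - x)" for y
    proof -
      have "indicator (ball 0 1) (y - x) * \<bar>f y\<bar> \<le> B * 3 powr q * norm x powr q"
      proof (cases "norm (y - x) < 1")
        case True
        then have "1 + norm y \<le> 3 * norm x" using x by norm
        then have "(1 + norm y) powr q \<le> (3 * norm x) powr q" using q by (intro powr_mono2) auto
        then have "B * (1 + norm y) powr q \<le> B * (3 * norm x) powr q" using B0 by (rule mult_left_mono)
        then have "\<bar>f y\<bar> \<le> B * (3 * norm x) powr q" using B[of y] by linarith
        then show ?thesis using True B0 by (simp add: powr_mult indicator_def dist_norm mult.assoc)
      qed (use B0 in \<open>simp add: indicator_def dist_norm norm_minus_commute\<close>)
      then have "(indicator (ball 0 1) (y - x) * \<bar>f y\<bar>) * log_part r (y - x) \<le>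
          B * 3 powr q * norm x powr q * log_part r (y - x)"
        by (intro mult_right_mono log_part_nonneg)
      moreover have "\<bar>f y\<bar> * log_part 1 (y - x) \<le>
          \<bar>f y\<bar> * (indicator (ball 0 1) (y - x) * (- ln r) + indicator (ball 0 1) (y - x) * log_part r (y - x))"
        by (intro mult_left_mono log_part_split r) auto
      ultimately show ?thesis by (simp add: algebra_simps)
    qed
    then have "(LINT y|lborel. \<bar>f y\<bar> * log_part 1 (y - x)) \<le>
        (LINT y|lborel. (- ln r) * (indicator (ball 0 1) (y - x) * \<bar>f y\<bar>)
        + B * 3 powr q * norm x powr q * log_part r (y - x))"
      by (intro integral_mono integrable_log_part Bochner_Integration.integrable_add integrable_mult_right i1 i2)
    also have "\<dots> = (- ln r) * (LINT y|lborel. indicator (ball 0 1) (y - x) * \<bar>f y\<bar>)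
        + B * 3 powr q * norm x powr q * (LINT y|lborel. log_part r (y - x))"
      by (subst Bochner_Integration.integral_add) (auto intro!: integrable_mult_right i1 i2)
    also have "(LINT y|lborel. log_part r (y - x)) = (LINT y::'a|lborel. log_part r y)"
      by (subst integral_lborel_affine[of _ 1 x]) auto
    also have "\<dots> = ?V * r ^ DIM('a)"
      using r by (simp add: integral_log_part(2))
    also have "B * 3 powr q * norm x powr q * (?V * r ^ DIM('a)) = (B * 3 powr q * ?V) * (norm x powr q * r ^ DIM('a))"
      by simp
    also have "\<dots> \<le> (B * 3 powr q * ?V) * (1 / norm x)"
    proof (rule mult_left_mono)
      have "r ^ DIM('a) \<le> r ^ 1"
        using r by (intro power_decreasing) (auto simp: Suc_le_eq)
      then have "norm x powr q * r ^ DIM('a) \<le> norm x powr q * r"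
        by (intro mult_left_mono) auto
      also have "\<dots> = norm x powr (q + - (q + 1))" unfolding r_def powr_add ..
      also have "\<dots> = 1 / norm x" using x0 by (simp add: powr_minus inverse_eq_divide)
      finally show "norm x powr q * r ^ DIM('a) \<le> 1 / norm x" .
      show "0 \<le> B * 3 powr q * ?V" using B0 by simp
    qed
    finally show ?thesis unfolding lr by (simp add: mult.assoc)
  qed
  then show thesis using q by (intro that[of "q + 1" "B * 3 powr q * ?V"]) auto
qed

text \<open>Dominated convergence with a moving singularity: the bound is a fixed integrable part
  plus a multiple of \<open>log_part 1\<close> centred at \<open>X k\<close>, and the moving part
  has no common majorant but vanishes in the mean. The scale \<open>s k\<close> admits kernels
  divided by a growing logarithm.\<close>

lemma kernel_tendsto_0:
  fixes \<kappa> :: "nat \<Rightarrow> 'a \<Rightarrow> real"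
  assumes [measurable]: "\<And>k. \<kappa> k \<in> borel_measurable borel" and hm[measurable]: "h \<in> borel_measurable borel"
    and s: "\<And>k. s k \<ge> 0" and h: "\<And>y. h y \<ge> 0" "integrable lborel (\<lambda>y. \<bar>f y\<bar> * h y)"
    and bound: "\<And>k. AE y in lborel. \<bar>\<kappa> k y\<bar> \<le> s k * log_part 1 (y - X k) + h y"
    and lim: "AE y in lborel. (\<lambda>k. \<kappa> k y) \<longlonglongrightarrow> 0"
    and near: "(\<lambda>k. s k * (LINT y|lborel. \<bar>f y\<bar> * log_part 1 (y - X k))) \<longlonglongrightarrow> 0"
  shows "(\<lambda>k. LINT y|lborel. f y * \<kappa> k y) \<longlonglongrightarrow> 0"
proof -
  \<comment> \<open>The part of the kernel in excess of the singular term. It is dominated by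
    \<open>h\<close>, and it tends to 0 because it is at most
    \<open>\<bar>\<kappa> k y\<bar>\<close>.\<close>
  define D where "D k y = max 0 (\<bar>\<kappa> k y\<bar> - s k * log_part 1 (y - X k))" for k y
  have Dm[measurable]: "D k \<in> borel_measurable borel" for k unfolding D_def by measurable
  have D: "0 \<le> D k y" "D k y \<le> \<bar>\<kappa> k y\<bar>" "\<bar>\<kappa> k y\<bar> \<le> s k * log_part 1 (y - X k) + D k y" for k y
    using mult_nonneg_nonneg[OF s[of k] log_part_nonneg[of 1 "y - X k"]] by (auto simp: D_def)
  have Dh: "AE y in lborel. D k y \<le> h y" for k
    using bound[of k]
  proof eventually_elim
    case (elim y)
    then show ?case using h(1)[of y] by (auto simp: D_def)
  qed
  have Dint: "integrable lborel (\<lambda>y. \<bar>f y\<bar> * D k y)" for k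
  proof (rule Bochner_Integration.integrable_bound[OF h(2)])
    show "AE y in lborel. norm (\<bar>f y\<bar> * D k y) \<le> norm (\<bar>f y\<bar> * h y)"
      using Dh[of k] by eventually_elim (use D(1) h(1) in \<open>auto simp: abs_mult intro!: mult_left_mono\<close>)
  qed measurable
  have "(\<lambda>k. LINT y|lborel. \<bar>f y\<bar> * D k y) \<longlonglongrightarrow> (LINT y::'a|lborel. 0)"
  proof (rule integral_dominated_convergence[OF _ _ h(2)])
    show "AE y in lborel. (\<lambda>k. \<bar>f y\<bar> * D k y) \<longlonglongrightarrow> 0"
      using lim
    proof eventually_elim
      case (elim y)
      have "(\<lambda>k. D k y) \<longlonglongrightarrow> 0"
        by (rule Lim_null_comparison[OF _ tendsto_rabs_zero[OF elim]]) (use D in auto)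
      then show ?case by (rule tendsto_mult_right_zero)
    qed
    show "AE y in lborel. norm (\<bar>f y\<bar> * D k y) \<le> \<bar>f y\<bar> * h y" for k
      using Dh[of k] by eventually_elim (use D(1) in \<open>auto simp: abs_mult intro!: mult_left_mono\<close>)
  qed measurable
  then have lim2: "(\<lambda>k. s k * (LINT y|lborel. \<bar>f y\<bar> * log_part 1 (y - X k)) + (LINT y|lborel. \<bar>f y\<bar> * D k y)) \<longlonglongrightarrow> 0"
    using tendsto_add[OF near] by simp
  show ?thesis
  proof (rule Lim_null_comparison[OF always_eventually[rule_format] lim2])
    fix k
    have i: "integrable lborel (\<lambda>y. s k * (\<bar>f y\<bar> * log_part 1 (y - X k)) + \<bar>f y\<bar> * D k y)"
      by (intro Bochner_Integration.integrable_add integrable_mult_right integrable_log_part Dint)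
    have le: "\<bar>f y * \<kappa> k y\<bar> \<le> s k * (\<bar>f y\<bar> * log_part 1 (y - X k)) + \<bar>f y\<bar> * D k y" for y
      using mult_left_mono[OF D(3)[of k y] abs_ge_zero[of "f y"]] by (simp add: abs_mult algebra_simps)
    have i2: "integrable lborel (\<lambda>y. f y * \<kappa> k y)"
      by (rule Bochner_Integration.integrable_bound[OF i]) (auto intro!: AE_I2 order_trans[OF le abs_ge_self])
    have "norm (LINT y|lborel. f y * \<kappa> k y) \<le> (LINT y|lborel. \<bar>f y * \<kappa> k y\<bar>)"
      unfolding real_norm_def by (rule integral_abs_bound)
    also have "\<dots> \<le> (LINT y|lborel. s k * (\<bar>f y\<bar> * log_part 1 (y - X k)) + \<bar>f y\<bar> * D k y)"
      by (intro integral_mono integrable_abs i i2 le)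
    also have "\<dots> = s k * (LINT y|lborel. \<bar>f y\<bar> * log_part 1 (y - X k)) + (LINT y|lborel. \<bar>f y\<bar> * D k y)"
      by (subst Bochner_Integration.integral_add) (auto intro!: integrable_mult_right integrable_log_part Dint)
    finally show "norm (LINT y|lborel. f y * \<kappa> k y) \<le>
      s k * (LINT y|lborel. \<bar>f y\<bar> * log_part 1 (y - X k)) + (LINT y|lborel. \<bar>f y\<bar> * D k y)" .
  qed
qed

text \<open>Division by \<open>ln (norm x)\<close> makes the kernel bounded up to logarithmic
  singularities, so integrability of \<open>f\<close> suffices, and it cancels the logarithm in
  front of the near-field mass.\<close>

lemma leading_order:
  "((\<lambda>x. (gamma_const n * (u x - u 0) + (LINT y|lborel. f y) * ln (norm x)) / ln (norm x)) \<longlongrightarrow> 0) at_infinity"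
proof (rule tendsto_at_infinity_sequentiallyI[where R = 2])
  fix X :: "nat \<Rightarrow> 'a"
  assume X: "filterlim X at_infinity sequentially" and X2: "\<And>k. 2 \<le> norm (X k)"
  define l where "l k = ln (norm (X k))" for k
  have l2: "l k \<ge> ln 2" for k unfolding l_def using X2[of k] by (intro ln_mono) auto
  have l0: "l k > 0" for k using l2[of k] ln_gt_zero[of "2::real"] by linarith
  have l_top: "filterlim l at_top sequentially"
    unfolding l_def[abs_def]
    by (rule filterlim_compose[OF ln_at_top filterlim_at_infinity_imp_norm_at_top[OF X]])
  have inv: "(\<lambda>k. 1 / l k) \<longlonglongrightarrow> 0"
    by (intro tendsto_divide_0[OF tendsto_const] filterlim_at_top_imp_at_infinity l_top)
  \<comment> \<open>The summand \<open>l k\<close> contributes the integral of \<open>f\<close>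
    times \<open>ln (norm (X k))\<close> and makes the kernel tend to 0 pointwise instead of to
    -1.\<close>
  define \<kappa> where "\<kappa> k y = (ln (norm y) - ln (norm (y - X k)) + l k) / l k" for k y
  \<comment> \<open>Of the constant 3, one unit is the added \<open>l k\<close>, and two come from
    \<open>ln (1 + norm (X k)) \<le> 2 * l k\<close>, valid for norms at least 2. Division by
    \<open>l k\<close> is bounded by division by \<open>ln 2\<close>.\<close>
  define h where "h y = log_part 1 y / ln 2 + 3" for y :: 'a
  have "(\<lambda>k. LINT y|lborel. f y * \<kappa> k y) \<longlonglongrightarrow> 0"
  proof (rule kernel_tendsto_0[where s = "\<lambda>k. 1 / l k" and h = h and X = X])
    show "\<kappa> k \<in> borel_measurable borel" for k unfolding \<kappa>_def by measurable
    show "h \<in> borel_measurable borel" unfolding h_def by measurable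
    show "1 / l k \<ge> 0" for k using l0[of k] by simp
    show "h y \<ge> 0" for y using log_part_nonneg[of 1 y] by (simp add: h_def)
    have "integrable lborel (\<lambda>y. \<bar>f y\<bar> * log_part 1 (y - 0) * (1 / ln 2) + \<bar>f y\<bar> * 3)"
      by (intro Bochner_Integration.integrable_add integrable_mult_left integrable_log_part integrable_abs f_int)
    then show "integrable lborel (\<lambda>y. \<bar>f y\<bar> * h y)" by (simp add: h_def distrib_left)
    show "AE y in lborel. \<bar>\<kappa> k y\<bar> \<le> 1 / l k * log_part 1 (y - X k) + h y" for k
    proof -
      have "AE y in lborel. y \<noteq> 0 \<and> y \<noteq> X k" by (intro AE_conjI AE_lborel_singleton)
      then show ?thesis
      proof eventually_elim
        case (elim y)
        have "1 + norm (X k) \<le> norm (X k) * norm (X k)"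
          using mult_mono[OF X2[of k] order_refl[of "norm (X k)"]] X2[of k] by simp
        then have "ln (1 + norm (X k)) \<le> ln (norm (X k) * norm (X k))"
          by (intro ln_mono) (auto intro: add_pos_nonneg)
        also have "\<dots> = 2 * l k" using X2[of k] by (subst ln_mult) (auto simp: l_def)
        finally have "\<bar>ln (norm y) - ln (norm (y - X k)) + l k\<bar> \<le> log_part 1 (y - X k) + log_part 1 y + 3 * l k"
          using abs_ln_norm_diff_le[of y "X k"] elim l0[of k] by linarith
        then have "\<bar>\<kappa> k y\<bar> \<le> (log_part 1 (y - X k) + log_part 1 y + 3 * l k) / l k"
          unfolding \<kappa>_def abs_divide using l0[of k] by (simp add: divide_right_mono)
        also have "\<dots> = 1 / l k * log_part 1 (y - X k) + log_part 1 y / l k + 3"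
          using l0[of k] by (simp add: add_divide_distrib)
        also have "log_part 1 y / l k \<le> log_part 1 y / ln 2"
          using l2[of k] log_part_nonneg[of 1 y] by (intro divide_left_mono mult_pos_pos l0) auto
        finally show ?case by (simp add: h_def)
      qed
    qed
    show "AE y in lborel. (\<lambda>k. \<kappa> k y) \<longlonglongrightarrow> 0"
    proof (intro AE_I2)
      fix y
      have "(\<lambda>k. ln (norm (y - X k)) - ln (norm (X k))) \<longlonglongrightarrow> 0"
        by (rule filterlim_compose[OF ln_norm_diff_tendsto_0 X])
      then have "(\<lambda>k. (1 / l k) * (ln (norm y) - (ln (norm (y - X k)) - ln (norm (X k))))) \<longlonglongrightarrow> 0 * (ln (norm y) - 0)"
        by (intro tendsto_intros inv)
      then show "(\<lambda>k. \<kappa> k y) \<longlonglongrightarrow> 0" by (simp add: \<kappa>_def l_def diff_diff_eq2 add_diff_eq diff_add_eq)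
    qed
    obtain C q where q: "q \<ge> 0" and C: "\<And>x. norm x \<ge> 1 \<Longrightarrow> (LINT y|lborel. \<bar>f y\<bar> * log_part 1 (y - x)) \<le>
        q * (ln (norm x) * (LINT y|lborel. indicator (ball 0 1) (y - x) * \<bar>f y\<bar>)) + C * (1 / norm x)"
      using near_field_bound by blast
    let ?T = "\<lambda>k. LINT y|lborel. \<bar>f y\<bar> * log_part 1 (y - X k)"
    let ?m = "\<lambda>k. LINT y|lborel. indicator (ball 0 1) (y - X k) * \<bar>f y\<bar>"
    have invX: "(\<lambda>k. 1 / norm (X k)) \<longlonglongrightarrow> 0"
      by (intro tendsto_divide_0[OF tendsto_const] filterlim_at_top_imp_at_infinity filterlim_at_infinity_imp_norm_at_top X)
    have "(\<lambda>k. q * ?m k + C * (1 / norm (X k)) * (1 / l k)) \<longlonglongrightarrow> q * 0 + C * 0 * 0"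
      by (intro tendsto_intros ball_mass_tendsto_0 f_int X inv invX)
    then have lim: "(\<lambda>k. q * ?m k + C * (1 / norm (X k)) * (1 / l k)) \<longlonglongrightarrow> 0" by simp
    show "(\<lambda>k. 1 / l k * ?T k) \<longlonglongrightarrow> 0"
    proof (rule Lim_null_comparison[OF always_eventually[rule_format] lim])
      fix k
      have "0 \<le> ?T k" by (intro integral_nonneg_AE) (auto simp: log_part_nonneg)
      moreover have "?T k / l k \<le> (q * (l k * ?m k) + C * (1 / norm (X k))) / l k"
        using C[of "X k"] X2[of k] l0[of k] by (intro divide_right_mono) (auto simp: l_def)
      moreover have "(q * (l k * ?m k) + C * (1 / norm (X k))) / l k = q * ?m k + C * (1 / norm (X k)) * (1 / l k)"
        using l0[of k] by (simp add: add_divide_distrib)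
      ultimately show "norm (1 / l k * ?T k) \<le> q * ?m k + C * (1 / norm (X k)) * (1 / l k)"
        using l0[of k] by (simp add: abs_mult)
    qed
  qed
  also have "(\<lambda>k. LINT y|lborel. f y * \<kappa> k y) = (\<lambda>k. (gamma_const n * (u (X k) - u 0) +
      (LINT y|lborel. f y) * ln (norm (X k))) / ln (norm (X k)))"
  proof
    fix k
    have "f y * \<kappa> k y = (1 / l k) * (f y * (ln (norm y) - ln (norm (y - X k))) + f y * l k)" for y
      by (simp add: \<kappa>_def distrib_left add_divide_distrib)
    then have "(LINT y|lborel. f y * \<kappa> k y) =
        (1 / l k) * (LINT y|lborel. f y * (ln (norm y) - ln (norm (y - X k))) + f y * l k)"
      by simp
    also have "\<dots> = (1 / l k) * (gamma_const n * (u (X k) - u 0) + (LINT y|lborel. f y) * l k)"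
      using representation[of "X k"] f_int by simp
    finally show "(LINT y|lborel. f y * \<kappa> k y) = (gamma_const n * (u (X k) - u 0) +
      (LINT y|lborel. f y) * ln (norm (X k))) / ln (norm (X k))"
      by (simp add: l_def)
  qed
  finally show "(\<lambda>k. (gamma_const n * (u (X k) - u 0) +
      (LINT y|lborel. f y) * ln (norm (X k))) / ln (norm (X k))) \<longlonglongrightarrow> 0" .
qed

text \<open>Without division by the logarithm, the constant integral of
  \<open>ln (norm y) * f y\<close> is split off, and the remaining kernel compares
  \<open>norm (X k)\<close> with \<open>norm (y - X k)\<close>. The weight
  \<open>ln (2 + norm y)\<close> dominates it away from the singularity and also absorbs the
  logarithm of the near-field bound.\<close>

lemma refined_asymptotics:
  assumes int: "integrable lborel (\<lambda>y. f y * ln (2 + norm y))"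
  shows "integrable lborel (\<lambda>y. ln (norm y) * f y)"
    and "((\<lambda>x. gamma_const n * (u x - u 0) + (LINT y|lborel. f y) * ln (norm x)
      - (LINT y|lborel. ln (norm y) * f y)) \<longlongrightarrow> 0) at_infinity"
proof -
  have int': "integrable lborel (\<lambda>y. \<bar>f y\<bar> * ln (2 + norm y))"
    using integrable_abs[OF int] by (simp add: abs_mult add_nonneg_nonneg)
  have "integrable lborel (\<lambda>y. \<bar>f y\<bar> * ln (2 + norm y) + \<bar>f y\<bar> * log_part 1 (y - 0))"
    by (intro Bochner_Integration.integrable_add int' integrable_log_part)
  then show ln_int: "integrable lborel (\<lambda>y. ln (norm y) * f y)"
  proof (rule Bochner_Integration.integrable_bound)
    show "AE y in lborel. norm (ln (norm y) * f y) \<le>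
        norm (\<bar>f y\<bar> * ln (2 + norm y) + \<bar>f y\<bar> * log_part 1 (y - 0))"
    proof (intro AE_I2)
      fix y :: 'a
      have "ln (norm y) \<le> ln (2 + norm y)"
      proof (cases "y = 0")
        case False
        then show ?thesis by (intro ln_mono) auto
      qed simp
      moreover have "0 \<le> ln (2 + norm y)" by simp
      moreover have "\<bar>a\<bar> \<le> b + max 0 (- a)" if "a \<le> b" "0 \<le> b" for a b :: real
        using that by auto
      ultimately have "\<bar>ln (norm y)\<bar> \<le> ln (2 + norm y) + log_part 1 (y - 0)"
        by (simp add: log_part_def)
      then have "\<bar>f y\<bar> * \<bar>ln (norm y)\<bar> \<le> \<bar>f y\<bar> * (ln (2 + norm y) + log_part 1 (y - 0))"
        by (intro mult_left_mono) auto
      then show "norm (ln (norm y) * f y) \<le> norm (\<bar>f y\<bar> * ln (2 + norm y) + \<bar>f y\<bar> * log_part 1 (y - 0))"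
        by (simp add: abs_mult distrib_left mult.commute)
    qed
  qed measurable
  show "((\<lambda>x. gamma_const n * (u x - u 0) + (LINT y|lborel. f y) * ln (norm x)
      - (LINT y|lborel. ln (norm y) * f y)) \<longlongrightarrow> 0) at_infinity"
  proof (rule tendsto_at_infinity_sequentiallyI[where R = 1])
    fix X :: "nat \<Rightarrow> 'a"
    assume X: "filterlim X at_infinity sequentially" and X1: "\<And>k. 1 \<le> norm (X k)"
    define \<kappa> where "\<kappa> k y = ln (norm (X k)) - ln (norm (y - X k))" for k y
    have "(\<lambda>k. LINT y|lborel. f y * \<kappa> k y) \<longlonglongrightarrow> 0"
    proof (rule kernel_tendsto_0[where s = "\<lambda>k. 1" and h = "\<lambda>y. ln (2 + norm y)" and X = X])
      show "\<kappa> k \<in> borel_measurable borel" for k unfolding \<kappa>_def by measurable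
      show "(\<lambda>y::'a. ln (2 + norm y)) \<in> borel_measurable borel" by measurable
      show "integrable lborel (\<lambda>y. \<bar>f y\<bar> * ln (2 + norm y))" by (rule int')
      show "AE y in lborel. \<bar>\<kappa> k y\<bar> \<le> 1 * log_part 1 (y - X k) + ln (2 + norm y)" for k
      proof -
        have "AE y in lborel. y \<noteq> X k" by (rule AE_lborel_singleton)
        then show ?thesis
        proof eventually_elim
          case (elim y)
          have p: "norm (X k) > 0" "norm (y - X k) > 0" using elim X1[of k] by auto
          have "norm (X k) \<le> norm (y - X k) + norm y" "norm (y - X k) \<le> norm (X k) + norm y" by norm+
          from ln_diff_le_add[OF p norm_ge_zero this(1)] ln_diff_le_add[OF p(2,1) norm_ge_zero this(2)]
          have "\<bar>\<kappa> k y\<bar> \<le> log_part 1 (y - X k) + ln (1 + norm y)"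
            using X1[of k] by (simp add: \<kappa>_def log_part_def abs_le_iff)
          moreover have "ln (1 + norm y) \<le> ln (2 + norm y)" by (intro ln_mono) (auto intro: add_pos_nonneg)
          ultimately show ?case by simp
        qed
      qed
      show "AE y in lborel. (\<lambda>k. \<kappa> k y) \<longlonglongrightarrow> 0"
      proof (intro AE_I2)
        fix y
        have "(\<lambda>k. ln (norm (y - X k)) - ln (norm (X k))) \<longlonglongrightarrow> 0"
          by (rule filterlim_compose[OF ln_norm_diff_tendsto_0 X])
        from tendsto_minus[OF this] show "(\<lambda>k. \<kappa> k y) \<longlonglongrightarrow> 0" by (simp add: \<kappa>_def)
      qed
      obtain C q where q: "q \<ge> 0" and C: "\<And>x. norm x \<ge> 1 \<Longrightarrow> (LINT y|lborel. \<bar>f y\<bar> * log_part 1 (y - x)) \<le>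
          q * (ln (norm x) * (LINT y|lborel. indicator (ball 0 1) (y - x) * \<bar>f y\<bar>)) + C * (1 / norm x)"
        using near_field_bound by blast
      let ?T = "\<lambda>k. LINT y|lborel. \<bar>f y\<bar> * log_part 1 (y - X k)"
      let ?m = "\<lambda>k. LINT y|lborel. indicator (ball 0 1) (y - X k) * \<bar>f y\<bar>"
      let ?M = "\<lambda>k. LINT y|lborel. indicator (ball 0 1) (y - X k) * \<bar>f y * ln (2 + norm y)\<bar>"
      \<comment> \<open>On the unit ball around \<open>X k\<close>, \<open>norm (X k)\<close> is at
        most \<open>2 + norm y\<close>, so the logarithm can be moved under the integral as the
        weight.\<close>
      have mM: "ln (norm (X k)) * ?m k \<le> ?M k" for k
      proof -
        have i1: "integrable lborel (\<lambda>y. indicator (ball 0 1) (y - X k) * \<bar>f y\<bar>)"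
          by (rule Bochner_Integration.integrable_bound[OF f_int]) (auto simp: indicator_def)
        have i2: "integrable lborel (\<lambda>y. indicator (ball 0 1) (y - X k) * \<bar>f y * ln (2 + norm y)\<bar>)"
          by (rule Bochner_Integration.integrable_bound[OF int]) (auto simp: indicator_def)
        have "ln (norm (X k)) * ?m k = (LINT y|lborel. ln (norm (X k)) * (indicator (ball 0 1) (y - X k) * \<bar>f y\<bar>))"
          by simp
        also have "\<dots> \<le> ?M k"
        proof (intro integral_mono integrable_mult_right i1 i2)
          fix y
          show "ln (norm (X k)) * (indicator (ball 0 1) (y - X k) * \<bar>f y\<bar>) \<le>
              indicator (ball 0 1) (y - X k) * \<bar>f y * ln (2 + norm y)\<bar>"
          proof (cases "norm (y - X k) < 1")
            case True
            then have "norm (X k) \<le> 2 + norm y" by norm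
            then have "ln (norm (X k)) \<le> ln (2 + norm y)" using X1[of k] by (intro ln_mono) auto
            then show ?thesis
              using True by (simp add: indicator_def dist_norm abs_mult mult.commute mult_left_mono)
          qed (simp add: indicator_def dist_norm norm_minus_commute)
        qed
        finally show ?thesis .
      qed
      have invX: "(\<lambda>k. 1 / norm (X k)) \<longlonglongrightarrow> 0"
        by (intro tendsto_divide_0[OF tendsto_const] filterlim_at_top_imp_at_infinity filterlim_at_infinity_imp_norm_at_top X)
      have lim: "(\<lambda>k. q * ?M k + C * (1 / norm (X k))) \<longlonglongrightarrow> 0"
        using tendsto_add[OF tendsto_mult_right_zero[OF ball_mass_tendsto_0[OF int X], of q]
            tendsto_mult_right_zero[OF invX, of C]] by simp
      show "(\<lambda>k. 1 * ?T k) \<longlonglongrightarrow> 0"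
      proof (rule Lim_null_comparison[OF always_eventually[rule_format] lim])
        fix k
        have "0 \<le> ?T k" by (intro integral_nonneg_AE) (auto simp: log_part_nonneg)
        moreover have "?T k \<le> q * (ln (norm (X k)) * ?m k) + C * (1 / norm (X k))"
          by (rule C[OF X1])
        moreover have "q * (ln (norm (X k)) * ?m k) \<le> q * ?M k"
          by (rule mult_left_mono[OF mM q])
        ultimately show "norm (1 * ?T k) \<le> q * ?M k + C * (1 / norm (X k))" by simp
      qed
    qed simp_all
    also have "(\<lambda>k. LINT y|lborel. f y * \<kappa> k y) = (\<lambda>k. gamma_const n * (u (X k) - u 0) +
        (LINT y|lborel. f y) * ln (norm (X k)) - (LINT y|lborel. ln (norm y) * f y))"
    proof
      fix k
      have "f y * \<kappa> k y = f y * (ln (norm y) - ln (norm (y - X k))) + f y * ln (norm (X k)) - ln (norm y) * f y" for y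
        by (simp add: \<kappa>_def algebra_simps)
      then show "(LINT y|lborel. f y * \<kappa> k y) = gamma_const n * (u (X k) - u 0) +
          (LINT y|lborel. f y) * ln (norm (X k)) - (LINT y|lborel. ln (norm y) * f y)"
        using representation[of "X k"] f_int ln_int by simp
    qed
    finally show "(\<lambda>k. gamma_const n * (u (X k) - u 0) + (LINT y|lborel. f y) * ln (norm (X k))
      - (LINT y|lborel. ln (norm y) * f y)) \<longlonglongrightarrow> 0" .
  qed
qed

end

section \<open>The asymptotic expansion\<close>

lemma ln_le_powr:
  assumes "x \<ge> 1" "a > 0"
  shows "ln x \<le> (1 / a) * x powr (a::real)"
  using ln_powr_bound[OF assms] by simp

text \<open>Continuity on a compact ball supplies what the asymptotic bound leaves open.
  \<open>ln (1 + norm x)\<close> replaces \<open>ln (norm x)\<close> so that the bound is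
  nonnegative everywhere.\<close>

lemma log_growth:
  fixes u :: "'a::euclidean_space \<Rightarrow> real"
  assumes "continuous_on UNIV u" "u \<in> O[at_infinity](\<lambda>x. ln (norm x))"
  obtains A c where "A \<ge> 0" "c \<ge> 0" "\<And>x. \<bar>u x\<bar> \<le> A + c * ln (1 + norm x)"
proof -
  obtain c where c: "c > 0" "eventually (\<lambda>x. norm (u x) \<le> c * norm (ln (norm x))) at_infinity"
    using assms(2) by (rule landau_o.bigE)
  then obtain b where b: "\<And>x. b \<le> norm x \<Longrightarrow> norm (u x) \<le> c * norm (ln (norm x))"
    by (auto simp: eventually_at_infinity)
  have "bounded (u ` cball 0 (max b 1))"
    by (intro compact_imp_bounded compact_continuous_image continuous_on_subset[OF assms(1)]) auto
  then obtain A where A: "A > 0" "\<And>x. norm x \<le> max b 1 \<Longrightarrow> \<bar>u x\<bar> \<le> A"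
    by (auto simp: bounded_pos)
  have "\<bar>u x\<bar> \<le> A + c * ln (1 + norm x)" for x
  proof (cases "norm x \<le> max b 1")
    case True
    have "0 \<le> c * ln (1 + norm x)" using c(1) by simp
    then show ?thesis using A(2)[OF True] by linarith
  next
    case False
    then have x1: "b \<le> norm x" "1 \<le> norm x" by auto
    have "ln (norm x) \<le> ln (1 + norm x)" using x1 by (intro ln_mono) linarith+
    then have "c * ln (norm x) \<le> c * ln (1 + norm x)" using c(1) by (intro mult_left_mono) auto
    then show ?thesis using b[OF x1(1)] x1(2) A(1) by simp
  qed
  then show thesis using that[of A c] A(1) c(1) by simp
qed

lemma exp_log_bound:
  assumes "a \<le> A + c * ln t" "t > 0" "m \<ge> (0::real)"
  shows "exp (m * a) \<le> exp (m * A) * t powr (m * c)"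
proof -
  have "m * a \<le> m * (A + c * ln t)" using assms by (intro mult_left_mono)
  then have "exp (m * a) \<le> exp (m * A + (m * c) * ln t)" by (simp add: algebra_simps)
  then show ?thesis using assms by (simp add: exp_add powr_def)
qed

text \<open>Integrability is asserted as well because the integral of a nonintegrable function is 0
  by convention; it gives the constant in the expansion its intended meaning.\<close>

theorem theorem1p4:
  fixes n :: nat and K u :: "'a::euclidean_space \<Rightarrow> real"
  assumes "n \<ge> 1"
    and "DIM('a) = 2 * n"
    and "continuous_on UNIV K"
    and "\<exists>x. K x \<noteq> 0"
    and "\<exists>C>0. \<exists>l\<ge>0. \<forall>x. \<bar>K x\<bar> \<le> C * (norm x powr l + 1)"
    and "is_solution n K u"
    and "u \<in> O[at_infinity](\<lambda>x. ln (norm x))"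
    and "integrable lborel (\<lambda>x. K x * exp (2 * real n * u x))"
    and "ereal (Lambda n K u) > - alpha1 n K * ereal (gamma_const n)"
  shows "integrable lborel (\<lambda>y. ln (norm y) * K y * exp (2 * real n * u y)) \<and>
    (\<lambda>x. u x - (- Lambda n K u / gamma_const n * ln (norm x) + u 0
           + 1 / gamma_const n *
             (LINT y|lborel. ln (norm y) * K y * exp (2 * real n * u y))))
      \<in> o[at_infinity](\<lambda>x. 1)"
proof -
  define f where "f x = K x * exp (2 * real n * u x)" for x
  have u_cont: "continuous_on UNIV u"
    using assms(6) by (simp add: is_solution_def)
  obtain A c where A: "A \<ge> 0" "c \<ge> 0" "\<And>x. \<bar>u x\<bar> \<le> A + c * ln (1 + norm x)"
    using log_growth[OF u_cont assms(7)] by blast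
  have pos: "1 + norm x > 0" for x :: 'a by (simp add: add_pos_nonneg)
  \<comment> \<open>\<open>ln t\<close> is at most 4 times \<open>t powr (1 / 4)\<close> for
    \<open>t \<ge> 1\<close>, whence the constant \<open>A + 4 * c\<close>.\<close>
  have u_growth: "\<bar>u x\<bar> \<le> (A + 4 * c) * (1 + norm x) powr (1 / 4)" for x
  proof -
    have "1 \<le> (1 + norm x) powr (1 / 4)" by (rule ge_one_powr_ge_zero) auto
    then have "A * 1 \<le> A * (1 + norm x) powr (1 / 4)" using A(1) by (rule mult_left_mono)
    moreover have "c * ln (1 + norm x) \<le> c * (4 * (1 + norm x) powr (1 / 4))"
      using ln_le_powr[of "1 + norm x" "1 / 4"] A(2) by (intro mult_left_mono) auto
    ultimately show ?thesis using A(3)[of x] by (simp add: algebra_simps)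
  qed
  obtain C l where C: "C > 0" "l \<ge> 0" "\<And>x. \<bar>K x\<bar> \<le> C * (norm x powr l + 1)"
    using assms(5) by blast
  have f_growth: "\<bar>f x\<bar> \<le> (2 * C * exp (2 * real n * A)) * (1 + norm x) powr (l + 2 * real n * c)" for x
  proof -
    have "norm x powr l \<le> (1 + norm x) powr l" using C(2) by (intro powr_mono2) auto
    moreover have "1 \<le> (1 + norm x) powr l" using C(2) by (intro ge_one_powr_ge_zero) auto
    ultimately have "C * (norm x powr l + 1) \<le> C * (2 * (1 + norm x) powr l)"
      using C(1) by (intro mult_left_mono) auto
    then have "\<bar>K x\<bar> \<le> 2 * C * (1 + norm x) powr l" using C(3)[of x] by simp
    moreover have "exp (2 * real n * u x) \<le> exp (2 * real n * A) * (1 + norm x) powr (2 * real n * c)"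
      using A(3)[of x] by (intro exp_log_bound pos) auto
    ultimately have "\<bar>f x\<bar> \<le> (2 * C * (1 + norm x) powr l) * (exp (2 * real n * A) * (1 + norm x) powr (2 * real n * c))"
      unfolding f_def abs_mult using C(1) by (intro mult_mono) auto
    then show ?thesis by (simp add: powr_add mult_ac)
  qed
  interpret distributional_solution n u f
  proof
    show "continuous_on UNIV f"
      unfolding f_def by (intro continuous_intros assms(3) u_cont)
    show "(LINT x|lborel. u x * (neg_laplacian ^^ n) \<phi> x) = (LINT x|lborel. f x * \<phi> x)"
      if "test_function \<phi>" for \<phi>
      using assms(6) that by (simp add: is_solution_def f_def)
    show "integrable lborel f" using assms(8) by (simp add: f_def[abs_def])
    show "\<exists>A. \<forall>x. \<bar>u x\<bar> \<le> A * (1 + norm x) powr (1 / 4)" using u_growth by blast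
    show "\<exists>B q. 0 \<le> q \<and> (\<forall>x. \<bar>f x\<bar> \<le> B * (1 + norm x) powr q)"
      using f_growth A(2) C(2) by (intro exI[of _ "2 * C * exp (2 * real n * A)"] exI[of _ "l + 2 * real n * c"]) auto
  qed (use assms(1,2) u_cont in auto)
  define \<gamma> where "\<gamma> = gamma_const n"
  define \<Lambda> where "\<Lambda> = Lambda n K u"
  have \<Lambda>: "(LINT y|lborel. f y) = \<Lambda>" by (simp add: \<Lambda>_def Lambda_def f_def)
  have \<gamma>: "\<gamma> > 0" by (simp add: \<gamma>_def gamma_const_closed_form[OF assms(1)])
  \<comment> \<open>As \<gamma> is positive, the hypothesis says that
    \<open>- \<Lambda> / \<gamma>\<close> lies below the supremum, so some admissible exponent
    exceeds it. The value \<open>+\<infinity>\<close> fits as well; \<open>-\<infinity>\<close>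
    contradicts the hypothesis.\<close>
  obtain \<beta> where \<beta>: "integrable lborel (\<lambda>x. K x * (1 + norm x) powr (2 * real n * \<beta>))" "- \<Lambda> / \<gamma> < \<beta>"
  proof -
    have "ereal (- \<Lambda> / \<gamma>) < alpha1 n K"
    proof (cases "alpha1 n K")
      case (real r)
      then have "- r * \<gamma> < \<Lambda>" using assms(9) by (simp add: \<gamma>_def \<Lambda>_def)
      then show ?thesis using real \<gamma> by (simp add: field_simps)
    next
      case MInf
      then show ?thesis using assms(9) \<gamma> by (simp add: \<gamma>_def)
    qed simp
    then show thesis
      unfolding alpha1_def less_Sup_iff using that by auto
  qed
  \<comment> \<open>Half the gap between \<beta> and \<open>- \<Lambda> / \<gamma>\<close>: one half
    pays for the error in the leading-order asymptotics, the other remains to absorb a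
    logarithm.\<close>
  define \<delta> where "\<delta> = (\<beta> + \<Lambda> / \<gamma>) / 2"
  have \<delta>: "\<delta> > 0" using \<beta>(2) by (simp add: \<delta>_def)
  obtain M where M: "\<And>x. u x \<le> M + (\<beta> - \<delta>) * ln (1 + norm x)"
  proof -
    have "eventually (\<lambda>x. \<bar>(\<gamma> * (u x - u 0) + \<Lambda> * ln (norm x)) / ln (norm x)\<bar> < \<gamma> * \<delta>) at_infinity"
      using tendstoD[OF leading_order, of "\<gamma> * \<delta>"] \<gamma> \<delta> by (simp add: \<Lambda> \<gamma>_def[symmetric])
    then obtain b where b: "\<And>x. b \<le> norm x \<Longrightarrow> \<bar>(\<gamma> * (u x - u 0) + \<Lambda> * ln (norm x)) / ln (norm x)\<bar> < \<gamma> * \<delta>"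
      by (auto simp: eventually_at_infinity)
    define R where "R = max b 2"
    have "bounded ((\<lambda>x. u x - (\<beta> - \<delta>) * ln (1 + norm x)) ` cball 0 R)"
      by (intro compact_imp_bounded compact_continuous_image continuous_intros continuous_on_subset[OF u_cont])
        (auto simp: add_nonneg_eq_0_iff)
    then obtain M0 where "\<forall>x\<in>cball 0 R. \<bar>u x - (\<beta> - \<delta>) * ln (1 + norm x)\<bar> \<le> M0"
      unfolding bounded_iff by (auto simp del: mem_cball)
    then have M0: "\<bar>u x - (\<beta> - \<delta>) * ln (1 + norm x)\<bar> \<le> M0" if "norm x \<le> R" for x
      using that by simp
    have "u x \<le> max M0 (u 0 + \<bar>\<beta> - \<delta>\<bar>) + (\<beta> - \<delta>) * ln (1 + norm x)" for x
    proof (cases "norm x \<le> R")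
      case True
      then show ?thesis using M0[OF True] by linarith
    next
      case False
      then have x: "b \<le> norm x" "2 \<le> norm x" by (auto simp: R_def)
      have l: "ln (norm x) > 0" using x(2) by (intro ln_gt_zero) linarith
      have "(\<gamma> * (u x - u 0) + \<Lambda> * ln (norm x)) / ln (norm x) \<le> \<gamma> * \<delta>"
        using b[OF x(1)] by linarith
      then have "\<gamma> * (u x - u 0) + \<Lambda> * ln (norm x) \<le> \<gamma> * \<delta> * ln (norm x)"
        using l by (simp add: pos_divide_le_eq)
      then have "\<gamma> * (u x - u 0) \<le> \<gamma> * ((\<delta> - \<Lambda> / \<gamma>) * ln (norm x))"
        using \<gamma> by (simp add: algebra_simps)
      moreover have "\<delta> - \<Lambda> / \<gamma> = \<beta> - \<delta>" by (simp add: \<delta>_def field_simps)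
      ultimately have 1: "u x - u 0 \<le> (\<beta> - \<delta>) * ln (norm x)"
        using \<gamma> by simp
      have "ln (1 + norm x) - ln (norm x) \<le> (1 + norm x - norm x) / norm x"
        using x(2) by (intro ln_diff_le) auto
      also have "\<dots> \<le> 1"
        using x(2) by (subst pos_divide_le_eq) linarith+
      finally have "ln (1 + norm x) - ln (norm x) \<le> 1" .
      moreover have "ln (norm x) \<le> ln (1 + norm x)"
        using x(2) by (intro ln_mono) linarith+
      ultimately have "\<bar>ln (norm x) - ln (1 + norm x)\<bar> \<le> 1"
        by simp
      \<comment> \<open>\<open>\<beta> - \<delta>\<close> may have either sign, so passing from
        \<open>ln (norm x)\<close> to \<open>ln (1 + norm x)\<close> costs its absolute
        value.\<close>
      then have "\<bar>(\<beta> - \<delta>) * (ln (norm x) - ln (1 + norm x))\<bar> \<le> \<bar>\<beta> - \<delta>\<bar> * 1"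
        unfolding abs_mult by (rule mult_left_mono) simp
      from abs_le_D1[OF this]
      have "(\<beta> - \<delta>) * ln (norm x) \<le> (\<beta> - \<delta>) * ln (1 + norm x) + \<bar>\<beta> - \<delta>\<bar>"
        unfolding right_diff_distrib by simp
      then show ?thesis using 1 by linarith
    qed
    then show thesis using that by blast
  qed
  have f_log: "integrable lborel (\<lambda>y. f y * ln (2 + norm y))"
  proof -
    \<comment> \<open>The exponential is at most a multiple of \<open>1 + norm x\<close> to the
      power \<open>2n(\<beta> - \<delta>)\<close>. The missing power \<open>d\<close> dominates
      \<open>ln (2 + norm x)\<close>, and the product is the weight that \<beta> makes integrable
      against \<open>K\<close>.\<close>
    define d where "d = 2 * real n * \<delta>"
    have d: "d > 0" using \<delta> assms(1) by (simp add: d_def)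
    define D where "D = exp (2 * real n * M) * (1 + 1 / d)"
    have "integrable lborel (\<lambda>x. D * (K x * (1 + norm x) powr (2 * real n * \<beta>)))"
      by (intro integrable_mult_right \<beta>(1))
    then show ?thesis
    proof (rule Bochner_Integration.integrable_bound)
      show "AE x in lborel. norm (f x * ln (2 + norm x)) \<le> norm (D * (K x * (1 + norm x) powr (2 * real n * \<beta>)))"
      proof (intro AE_I2)
        fix x :: 'a
        let ?t = "1 + norm x"
        have "ln (2 + norm x) \<le> ln (2 * ?t)" by (intro ln_mono) (auto intro: add_pos_nonneg)
        also have "\<dots> = ln 2 + ln ?t" using pos[of x] by (subst ln_mult) auto
        also have "\<dots> \<le> 1 * ?t powr d + (1 / d) * ?t powr d"
          using ln_le_powr[of ?t d] d ge_one_powr_ge_zero[of ?t d] ln_2_less_1 by (intro add_mono) auto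
        finally have 1: "ln (2 + norm x) \<le> (1 + 1 / d) * ?t powr d" by (simp add: distrib_right)
        have 2: "exp (2 * real n * u x) \<le> exp (2 * real n * M) * ?t powr (2 * real n * (\<beta> - \<delta>))"
          by (intro exp_log_bound M pos) simp
        have "exp (2 * real n * u x) * ln (2 + norm x) \<le>
            (exp (2 * real n * M) * ?t powr (2 * real n * (\<beta> - \<delta>))) * ((1 + 1 / d) * ?t powr d)"
          using 1 2 by (intro mult_mono) auto
        also have "\<dots> = D * (?t powr (2 * real n * (\<beta> - \<delta>)) * ?t powr d)"
          by (simp add: D_def)
        also have "\<dots> = D * ?t powr (2 * real n * \<beta>)"
          unfolding powr_add[symmetric] by (simp add: d_def algebra_simps)
        finally have "\<bar>K x\<bar> * (exp (2 * real n * u x) * ln (2 + norm x)) \<le> \<bar>K x\<bar> * (D * ?t powr (2 * real n * \<beta>))"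
          by (rule mult_left_mono) simp
        moreover have "D \<ge> 0" using d by (simp add: D_def)
        ultimately show "norm (f x * ln (2 + norm x)) \<le> norm (D * (K x * ?t powr (2 * real n * \<beta>)))"
          by (simp add: f_def abs_mult mult_ac)
      qed
    qed measurable
  qed
  have eq: "(\<lambda>y. ln (norm y) * f y) = (\<lambda>y. ln (norm y) * K y * exp (2 * real n * u y))"
    by (simp add: f_def fun_eq_iff)
  note asym = refined_asymptotics[OF f_log, unfolded eq \<Lambda>, folded \<gamma>_def]
  let ?J = "LINT y|lborel. ln (norm y) * K y * exp (2 * real n * u y)"
  have "((\<lambda>x. 1 / \<gamma> * (\<gamma> * (u x - u 0) + \<Lambda> * ln (norm x) - ?J)) \<longlongrightarrow> 1 / \<gamma> * 0) at_infinity"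
    by (intro tendsto_intros asym(2))
  moreover have "1 / \<gamma> * (\<gamma> * (u x - u 0) + \<Lambda> * ln (norm x) - ?J) =
      u x - (- \<Lambda> / \<gamma> * ln (norm x) + u 0 + 1 / \<gamma> * ?J)" for x
    using \<gamma> by (simp add: field_simps)
  ultimately have "((\<lambda>x. u x - (- \<Lambda> / \<gamma> * ln (norm x) + u 0 + 1 / \<gamma> * ?J)) \<longlongrightarrow> 0) at_infinity"
    by simp
  then have "(\<lambda>x. u x - (- \<Lambda> / \<gamma> * ln (norm x) + u 0 + 1 / \<gamma> * ?J)) \<in> o[at_infinity](\<lambda>x. 1)"
    by (intro smalloI_tendsto) auto
  then show ?thesis using asym(1) by (simp only: \<Lambda>_def \<gamma>_def)
qed

end
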